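(* Let $d\in\{1,2\}$ and $\sigma>2/d$. There exist $\varepsilon>0$ and a constant $C$ such that whenever $$\|\{u_n(0)\}\|_{l^{(8+2d)/(d+7)}(\mathbb Z^d)}\le\varepsilon,$$ the solution $\{u_n(t)\}$ of the discrete nonlinear Schrödinger equation (with either choice of sign) $$ i\,\partial_tu_n+(\Delta_d u)_n\pm|u_n|^{2\sigma}u_n=0,\qquad n\in\mathbb Z^d, $$ with initial data $\{u_n(0)\}$ satisfies, for all $p$ with $2\le p\le (8+2d)/(d+1)$ and all $t>0$, $$\|\{u_n(t)\}\|_{l^p}\le C\,t^{-d(p-2)/(3p)}\,\|\{u_n(0)\}\|_{l^{p'}} .$$ In particular, there are no nonzero standing wave solutions $u_n(t)=e^{i\Lambda t}\phi_n$ ($\Lambda\in\mathbb R$) of this equation with $\|\{\phi_n\}\|_{l^{(8+2d)/(d+7)}}\le\varepsilon$.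
   Context: The discrete Laplacian on complex sequences on $\mathbb Z^d$ (lattice spacing $1$) is $(\Delta_d u)_n=\sum_{j=1}^d(u_{n+e_j}+u_{n-e_j}-2u_n)$, with $e_1,\dots,e_d$ the standard basis. The exponent $p'$ is the Hölder conjugate of $p$, $1/p+1/p'=1$. *)

theory Defs
  imports "HOL-Analysis.Analysis"
begin

text \<open>
  The lattice is \<open>int ^ 'd\<close>, of dimension \<open>CARD('d)\<close>; its standard basis vectors are \<open>axis j 1\<close>.
  Since \<open>infsum\<close> is \<open>0\<close> for non-summable families, \<open>lp_norm\<close> is meaningful
  only on \<open>lp_space\<close>, for exponents \<open>0 < p < \<infinity>\<close>.
\<close>

definition lp_space :: "real \<Rightarrow> ('a \<Rightarrow> complex) set" where
  "lp_space p = {v. (\<lambda>n. norm (v n) powr p) summable_on UNIV}"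

definition lp_norm :: "real \<Rightarrow> ('a \<Rightarrow> complex) \<Rightarrow> real" where
  "lp_norm p v = (\<Sum>\<^sub>\<infinity>n. norm (v n) powr p) powr (1 / p)"

definition discrete_laplacian :: "(int ^ 'd::finite \<Rightarrow> complex) \<Rightarrow> (int ^ 'd \<Rightarrow> complex)" where
  "discrete_laplacian v n = (\<Sum>j\<in>UNIV. v (n + axis j 1) + v (n - axis j 1) - 2 * v n)"

text \<open>
  Solutions live in the class \<open>C([0,\<infinity>); l\<^sup>2)\<close>, in which the Cauchy problem is well posed;
  the equation holds at every site and every time (one-sided derivative at time \<open>0\<close>). Values at
  negative times are irrelevant. The parameter \<open>s\<close> is the sign of the nonlinearity.
\<close>

definition dnls_solution ::
    "real \<Rightarrow> real \<Rightarrow> (real \<Rightarrow> (int ^ 'd::finite \<Rightarrow> complex)) \<Rightarrow> bool" where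
  "dnls_solution s \<sigma> u \<longleftrightarrow>
     (\<forall>t\<ge>0. u t \<in> lp_space 2) \<and>
     (\<forall>t\<ge>0. ((\<lambda>\<tau>. lp_norm 2 (\<lambda>n. u \<tau> n - u t n)) \<longlongrightarrow> 0) (at t within {0..})) \<and>
     (\<forall>t\<ge>0. \<forall>n. \<exists>D. ((\<lambda>\<tau>. u \<tau> n) has_vector_derivative D) (at t within {0..}) \<and>
        \<i> * D + discrete_laplacian (u t) n
          + of_real s * of_real (norm (u t n) powr (2 * \<sigma>)) * u t n = 0)"

end

theory Submission
  imports Defs "HOL-Complex_Analysis.Complex_Analysis"
begin

text \<open>
  The one-dimensional free propagator is a Bessel kernel of size \<open>t powr (-1/3)\<close> (van der Corput), so
  by Riesz-Thorin the free flow maps \<open>l\<^sup>p'\<close> to \<open>l\<^sup>p\<close> with norm \<open>O((1 + t) powr (- d(p-2)/(3p)))\<close>.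
  At the largest exponent \<open>r = (8 + 2d)/(d + 1)\<close> the nonlinearity, controlled by the decaying
  \<open>l\<^sup>r\<close> norm, contributes an integrable Duhamel term because \<open>\<sigma> > 2/d\<close>, and a continuity argument closes.
  For intermediate \<open>p\<close> the Duhamel term need not be integrable. There, freeze \<open>V = \<plusminus>|u|\<^sup>2\<^sup>\<sigma>\<close>: the
  linear propagator with potential \<open>V\<close> is an isometry of \<open>l\<^sup>2\<close> and decays from \<open>l\<^sup>r'\<close> to \<open>l\<^sup>r\<close> by the same argument,
  so it can be interpolated, and \<open>u\<close> is the image of its own initial datum.
\<close>

unbundle no fps_syntax

section \<open>Quantitative membership in sequence spaces\<close>

text \<open>The exponents come from one computation. At r = (8 + 2d)/(d + 1) the free decay rate
  d(r-2)/(3r) equals d/(d+4). The nonlinear Duhamel term carries 2\<sigma> + 1 factors decaying at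
  this rate, and (2\<sigma> + 1) d/(d+4) > 1 says exactly \<sigma> > 2/d. To control |u|^(2\<sigma>)
  by the l^r norm one also needs r - 2 = 6/(d+1) <= 2\<sigma>; since 6/(d+1) <= 4/d iff d <= 2, this
  is where the restriction on the dimension enters. All l^p bounds are obtained by duality from
  pairings with finitely supported vectors. Duhamel's formula is likewise weak: a solution is paired
  with the backward free evolution of the test vector, so that only scalar time integrals occur and
  no propagator has to be built as an operator on l^2. The predicate \<open>lp_le\<close> joins
  membership and bound in a statement about finite sums. It is therefore untouched by the default
  value of \<open>infsum\<close>, and it passes to pointwise limits.\<close>

definition lp_le :: "real \<Rightarrow> ('a \<Rightarrow> complex) \<Rightarrow> real \<Rightarrow> bool" where
  "lp_le p v A \<longleftrightarrow> 0 \<le> A \<and> (\<forall>F. finite F \<longrightarrow> (\<Sum>n\<in>F. norm (v n) powr p) \<le> A powr p)"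

text \<open>Values off \<open>F\<close> do not enter, so this measures vectors supported in
  \<open>F\<close> as well as truncations to \<open>F\<close>.\<close>

definition lp_fin :: "real \<Rightarrow> 'a set \<Rightarrow> ('a \<Rightarrow> complex) \<Rightarrow> real" where
  "lp_fin p F v = (\<Sum>n\<in>F. norm (v n) powr p) powr (1 / p)"

lemma lp_le_nonneg: "lp_le p v A \<Longrightarrow> 0 \<le> A"
  by (simp add: lp_le_def)

lemma lp_le_sum: "lp_le p v A \<Longrightarrow> finite F \<Longrightarrow> (\<Sum>n\<in>F. norm (v n) powr p) \<le> A powr p"
  by (simp add: lp_le_def)

lemma lp_norm_nonneg: "0 \<le> lp_norm p v"
  by (simp add: lp_norm_def)

lemma lp_fin_nonneg: "0 \<le> lp_fin p F v"
  by (simp add: lp_fin_def)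

lemma lp_le_imp:
  assumes "lp_le p v A" "p > 0"
  shows "v \<in> lp_space p" "lp_norm p v \<le> A"
proof -
  have s: "(\<lambda>n. norm (v n) powr p) summable_on UNIV"
  proof (rule nonneg_bdd_above_summable_on)
    show "bdd_above (sum (\<lambda>n. cmod (v n) powr p) ` {F. F \<subseteq> UNIV \<and> finite F})"
      using lp_le_sum[OF assms(1)] by (auto simp: bdd_above_def)
  qed simp
  then show "v \<in> lp_space p" by (simp add: lp_space_def)
  have "(\<Sum>\<^sub>\<infinity>n. norm (v n) powr p) \<le> A powr p"
    using s by (rule infsum_le_finite_sums) (use lp_le_sum[OF assms(1)] in auto)
  then have "lp_norm p v \<le> (A powr p) powr (1/p)"
    unfolding lp_norm_def using assms(2) by (intro powr_mono2) (auto intro: infsum_nonneg)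
  then show "lp_norm p v \<le> A"
    using assms(2) lp_le_nonneg[OF assms(1)] by (simp add: powr_powr)
qed

lemma lp_le_mono_right: "lp_le p v A \<Longrightarrow> A \<le> B \<Longrightarrow> 0 \<le> p \<Longrightarrow> lp_le p v B"
  unfolding lp_le_def by (meson order_trans powr_mono2)

lemma lp_le_norm:
  assumes "v \<in> lp_space p" "p > 0"
  shows "lp_le p v (lp_norm p v)"
proof -
  have s: "(\<lambda>n. norm (v n) powr p) summable_on UNIV" using assms by (simp add: lp_space_def)
  have "lp_norm p v powr p = (\<Sum>\<^sub>\<infinity>n. norm (v n) powr p)"
    using assms(2) by (simp add: lp_norm_def powr_powr infsum_nonneg)
  then show ?thesis
    unfolding lp_le_def using finite_sum_le_infsum[OF s] by (auto simp: lp_norm_nonneg)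
qed

lemma lp_le_pointwise:
  assumes "lp_le p v A" "p > 0"
  shows "norm (v n) \<le> A"
proof -
  have "norm (v n) powr p \<le> A powr p" using lp_le_sum[OF assms(1), of "{n}"] by simp
  then show ?thesis using assms lp_le_nonneg[OF assms(1)]
    by (meson norm_ge_zero powr_less_mono2 not_le)
qed

lemma lp_le_dominated:
  assumes "lp_le p v A" "p \<ge> 0" "\<And>n. norm (w n) \<le> norm (v n)"
  shows "lp_le p w A"
  unfolding lp_le_def
proof (intro conjI allI impI)
  fix F :: "'a set" assume "finite F"
  have "(\<Sum>n\<in>F. cmod (w n) powr p) \<le> (\<Sum>n\<in>F. cmod (v n) powr p)"
    by (intro sum_mono powr_mono2) (use assms in auto)
  also have "\<dots> \<le> A powr p" by (rule lp_le_sum) fact+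
  finally show "(\<Sum>n\<in>F. cmod (w n) powr p) \<le> A powr p" .
qed (use assms lp_le_nonneg in auto)

lemma lp_le_cmult:
  assumes "lp_le p v A"
  shows "lp_le p (\<lambda>n. c * v n) (norm c * A)"
  unfolding lp_le_def
proof (intro conjI allI impI)
  fix F :: "'a set" assume "finite F"
  have "(\<Sum>n\<in>F. cmod (c * v n) powr p) = norm c powr p * (\<Sum>n\<in>F. cmod (v n) powr p)"
    by (simp add: norm_mult powr_mult sum_distrib_left)
  also have "\<dots> \<le> norm c powr p * A powr p"
    by (intro mult_left_mono lp_le_sum[OF assms]) (use \<open>finite F\<close> in auto)
  finally show "(\<Sum>n\<in>F. cmod (c * v n) powr p) \<le> (cmod c * A) powr p"
    using lp_le_nonneg[OF assms] by (simp add: powr_mult)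
qed (use lp_le_nonneg[OF assms] in auto)

text \<open>Every entry is at most \<open>A\<close>, so the surplus power q - p costs at most
  A^(q-p). With embedding constant 1, an l^2 bound controls all higher exponents.\<close>

lemma lp_le_exponent_mono:
  assumes "lp_le p v A" "0 < p" "p \<le> q"
  shows "lp_le q v A"
  unfolding lp_le_def
proof (intro conjI allI impI)
  fix F :: "'a set" assume F: "finite F"
  note pt = lp_le_pointwise[OF assms(1,2)]
  have A: "0 \<le> A" using assms(1) by (rule lp_le_nonneg)
  have "(\<Sum>n\<in>F. cmod (v n) powr q) \<le> (\<Sum>n\<in>F. cmod (v n) powr p * A powr (q - p))"
  proof (rule sum_mono)
    fix n
    have "cmod (v n) powr q = cmod (v n) powr p * cmod (v n) powr (q - p)"
      by (simp add: powr_add[symmetric])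
    also have "\<dots> \<le> cmod (v n) powr p * A powr (q - p)"
      by (intro mult_left_mono powr_mono2) (use assms pt in auto)
    finally show "cmod (v n) powr q \<le> cmod (v n) powr p * A powr (q - p)" .
  qed
  also have "\<dots> \<le> A powr p * A powr (q - p)"
    unfolding sum_distrib_right[symmetric]
    by (intro mult_right_mono lp_le_sum[OF assms(1) F]) auto
  also have "\<dots> = A powr q" by (simp add: powr_add[symmetric])
  finally show "(\<Sum>n\<in>F. cmod (v n) powr q) \<le> A powr q" .
qed (use assms lp_le_nonneg in auto)

lemma lp_le_zero: "0 < p \<Longrightarrow> lp_le p v 0 \<Longrightarrow> v n = 0"
  using lp_le_pointwise[of p v 0 n] by simp

lemma lp_le_fin:
  assumes "finite F" "\<And>n. n \<notin> F \<Longrightarrow> h n = 0" "p > 0"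
  shows "lp_le p h (lp_fin p F h)"
  unfolding lp_le_def
proof (intro conjI allI impI)
  fix G :: "'a set" assume G: "finite G"
  have "(\<Sum>n\<in>G. cmod (h n) powr p) = (\<Sum>n\<in>G \<inter> F. cmod (h n) powr p)"
    using assms G by (intro sum.mono_neutral_right) auto
  also have "\<dots> \<le> (\<Sum>n\<in>F. cmod (h n) powr p)"
    by (intro sum_mono2) (use assms in auto)
  also have "\<dots> = lp_fin p F h powr p"
    using assms by (simp add: lp_fin_def powr_powr sum_nonneg)
  finally show "(\<Sum>n\<in>G. cmod (h n) powr p) \<le> lp_fin p F h powr p" .
qed (rule lp_fin_nonneg)

lemma lp_fin_le:
  assumes "lp_le p h A" "finite F" "p > 0"
  shows "lp_fin p F h \<le> A"
proof -
  have "lp_fin p F h \<le> (A powr p) powr (1/p)"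
    unfolding lp_fin_def using assms by (intro powr_mono2 lp_le_sum) (auto intro: sum_nonneg)
  then show ?thesis using assms lp_le_nonneg[OF assms(1)] by (simp add: powr_powr)
qed

section \<open>Hoelder's inequality, duality and Minkowski's inequality\<close>

lemma holder_lp_le:
  fixes v :: "'a \<Rightarrow> complex"
  assumes v: "lp_le p v A" and w: "lp_le q w B" and pq: "p > 1" "q > 1" "1/p + 1/q = 1"
    and F: "finite F"
  shows "(\<Sum>n\<in>F. norm (v n) * norm (w n)) \<le> A * B"
proof (cases "A = 0 \<or> B = 0")
  case True
  then show ?thesis
    using lp_le_zero[of p v] lp_le_zero[of q w] v w pq by auto
next
  case False
  then have A: "A > 0" and B: "B > 0" using lp_le_nonneg[OF v] lp_le_nonneg[OF w] by auto
  have "(\<Sum>n\<in>F. (norm (v n) / A) * (norm (w n) / B))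
     \<le> (\<Sum>n\<in>F. (norm (v n) / A) powr p / p + (norm (w n) / B) powr q / q)"
    by (intro sum_mono Youngs_inequality) (use pq A B in auto)
  also have "\<dots> = (\<Sum>n\<in>F. norm (v n) powr p) / A powr p / p + (\<Sum>n\<in>F. norm (w n) powr q) / B powr q / q"
    using A B by (simp add: sum.distrib powr_divide sum_divide_distrib)
  also have "\<dots> \<le> 1 / p + 1 / q"
    using lp_le_sum[OF v F] lp_le_sum[OF w F] A B pq
    by (intro add_mono divide_right_mono) auto
  finally have "(\<Sum>n\<in>F. (norm (v n) / A) * (norm (w n) / B)) \<le> 1" using pq by simp
  then have "(\<Sum>n\<in>F. norm (v n) * norm (w n)) / (A * B) \<le> 1"
    by (simp add: sum_divide_distrib)
  then show ?thesis using A B by (simp add: divide_le_eq)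
qed

text \<open>Converse of Hoelder's inequality. It reduces l^p bounds for evolutions to estimates of
  finite pairings, in which the test vector can be evolved instead of the solution.\<close>

lemma lp_le_dual:
  fixes v :: "'a \<Rightarrow> complex"
  assumes pq: "p > 1" "q > 1" "1/p + 1/q = 1" and A: "0 \<le> A"
    and *: "\<And>F h. finite F \<Longrightarrow> (\<And>n. n \<notin> F \<Longrightarrow> h n = 0) \<Longrightarrow>
        norm (\<Sum>n\<in>F. h n * v n) \<le> A * lp_fin q F h"
  shows "lp_le p v A"
  unfolding lp_le_def
proof (intro conjI allI impI A)
  fix F :: "'a set" assume F: "finite F"
  define S where "S = (\<Sum>n\<in>F. cmod (v n) powr p)"
  \<comment> \<open>The extremal vector for Hoelder: its phase makes each product h v nonnegative,
    and its size gives |h|^q = |v|^p.\<close>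
  define h where "h n = (if n \<in> F then cnj (sgn (v n)) * of_real (norm (v n) powr (p - 1)) else 0)" for n
  have S0: "S \<ge> 0" by (simp add: S_def sum_nonneg)
  have pq': "(p - 1) * q = p" using pq by (simp add: field_simps)
  have hv: "h n * v n = of_real (norm (v n) powr p)" if "n \<in> F" for n
  proof (cases "v n = 0")
    case False
    have "cnj (sgn (v n)) * v n = of_real (norm (v n))"
      using False by (simp add: sgn_div_norm scaleR_conv_of_real field_simps complex_norm_square[symmetric] power2_eq_square)
    then have "h n * v n = of_real (norm (v n) * norm (v n) powr (p - 1))"
      using that by (simp add: h_def mult_ac)
    also have "norm (v n) * norm (v n) powr (p - 1) = norm (v n) powr p"
      using powr_mult_base[of "norm (v n)" "p - 1"] by simp
    finally show ?thesis .
  qed (simp add: h_def)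
  have nh: "norm (h n) powr q = norm (v n) powr p" if "n \<in> F" for n
    using that pq by (cases "v n = 0") (simp_all add: h_def norm_mult norm_sgn powr_powr pq')
  have "(\<Sum>n\<in>F. h n * v n) = of_real S"
    unfolding S_def of_real_sum by (intro sum.cong hv refl)
  then have "norm (\<Sum>n\<in>F. h n * v n) = S" using S0 by simp
  moreover have "lp_fin q F h = S powr (1/q)" using nh by (simp add: lp_fin_def S_def)
  \<comment> \<open>Dividing by S^(1/q) will leave S^(1/p) <= A; only S = 0 has to be set
    aside.\<close>
  ultimately have le: "S \<le> A * S powr (1/q)" using *[OF F, of h] by (simp add: h_def)
  have "S powr (1/p) \<le> A" if "S > 0"
  proof -
    have "S = S powr (1/p) * S powr (1/q)" using that pq by (simp add: powr_add[symmetric])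
    with le have "S powr (1/p) * S powr (1/q) \<le> A * S powr (1/q)" by simp
    then show ?thesis using that by simp
  qed
  then have "S powr (1/p) \<le> A" using S0 A by (cases "S = 0") auto
  then have "(S powr (1/p)) powr p \<le> A powr p" using pq by (intro powr_mono2) auto
  then have "S \<le> A powr p" using S0 pq by (simp add: powr_powr)
  then show "(\<Sum>n\<in>F. cmod (v n) powr p) \<le> A powr p" by (simp add: S_def)
qed

text \<open>Minkowski's inequality by duality and two uses of Hoelder. The case p = 1 has no finite
  conjugate exponent and is added in \<open>lp_le_add_ge_1\<close>.\<close>

lemma lp_le_add:
  fixes v :: "'a \<Rightarrow> complex"
  assumes "lp_le p v A" "lp_le p w B" "p > 1"
  shows "lp_le p (\<lambda>n. v n + w n) (A + B)"
proof -
  define q where "q = p / (p - 1)"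
  have pq: "q > 1" "1/p + 1/q = 1" using assms(3) by (auto simp: q_def field_simps)
  show ?thesis
  proof (rule lp_le_dual[OF assms(3) pq])
    fix F :: "'a set" and h :: "'a \<Rightarrow> complex" assume F: "finite F" and "\<And>n. n \<notin> F \<Longrightarrow> h n = 0"
    then have h: "lp_le q h (lp_fin q F h)" using pq by (intro lp_le_fin) auto
    have "norm (\<Sum>n\<in>F. h n * (v n + w n)) \<le> (\<Sum>n\<in>F. norm (v n) * norm (h n)) + (\<Sum>n\<in>F. norm (w n) * norm (h n))"
      unfolding sum.distrib[symmetric]
      by (intro order_trans[OF norm_sum] sum_mono order_trans[OF norm_triangle_ineq])
         (simp add: norm_mult ring_distribs[symmetric] mult_left_mono norm_triangle_ineq mult.commute)
    also have "\<dots> \<le> A * lp_fin q F h + B * lp_fin q F h"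
      by (intro add_mono holder_lp_le[OF _ h assms(3) pq F] assms)
    finally show "norm (\<Sum>n\<in>F. h n * (v n + w n)) \<le> (A + B) * lp_fin q F h" by (simp add: ring_distribs)
  qed (use lp_le_nonneg[OF assms(1)] lp_le_nonneg[OF assms(2)] in simp)
qed

lemma lp_le_zero_vector: "lp_le p (\<lambda>_. 0) 0"
  by (simp add: lp_le_def)

lemma lp_le_add_ge_1:
  fixes v :: "'a \<Rightarrow> complex"
  assumes v: "lp_le p v A" and w: "lp_le p w B" and "p \<ge> 1"
  shows "lp_le p (\<lambda>n. v n + w n) (A + B)"
proof (cases "p = 1")
  case True
  have AB: "A \<ge> 0" "B \<ge> 0" using v w by (auto intro: lp_le_nonneg)
  have "(\<Sum>n\<in>F. cmod (v n + w n)) \<le> A + B" if "finite F" for F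
  proof -
    have "(\<Sum>n\<in>F. cmod (v n + w n)) \<le> (\<Sum>n\<in>F. cmod (v n)) + (\<Sum>n\<in>F. cmod (w n))"
      unfolding sum.distrib[symmetric] by (intro sum_mono norm_triangle_ineq)
    then show ?thesis
      using lp_le_sum[OF v that] lp_le_sum[OF w that] True AB by simp
  qed
  then show ?thesis using AB True by (simp add: lp_le_def)
qed (use assms in \<open>auto intro: lp_le_add\<close>)

lemma lp_le_sum_family:
  fixes v :: "'b \<Rightarrow> 'a \<Rightarrow> complex"
  assumes "finite J" "\<And>j. j \<in> J \<Longrightarrow> lp_le p (v j) (A j)" "p \<ge> 1"
  shows "lp_le p (\<lambda>n. \<Sum>j\<in>J. v j n) (\<Sum>j\<in>J. A j)"
  using assms(1,2)
proof (induction J rule: finite_induct)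
  case empty
  then show ?case by (simp add: lp_le_zero_vector)
next
  case (insert j J)
  then show ?case using assms(3) by (simp add: lp_le_add_ge_1)
qed

lemma lp_le_reindex:
  assumes "lp_le p v A" "inj g"
  shows "lp_le p (\<lambda>n. v (g n)) A"
  unfolding lp_le_def
proof (intro conjI allI impI)
  fix F :: "'b set" assume F: "finite F"
  have "(\<Sum>n\<in>F. cmod (v (g n)) powr p) = (\<Sum>n\<in>g ` F. cmod (v n) powr p)"
    using assms(2) by (subst sum.reindex) (auto intro: inj_on_subset)
  also have "\<dots> \<le> A powr p" using F by (intro lp_le_sum[OF assms(1)]) simp
  finally show "(\<Sum>n\<in>F. cmod (v (g n)) powr p) \<le> A powr p" .
qed (rule lp_le_nonneg[OF assms(1)])

text \<open>Fatou's lemma in this setting: the bound concerns finite sums only, so convergence at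
  each site is enough.\<close>

lemma lp_le_limit:
  fixes v :: "'a \<Rightarrow> complex"
  assumes lim: "\<And>n. ((\<lambda>k. w k n) \<longlongrightarrow> v n) G" and ev: "eventually (\<lambda>k. lp_le p (w k) A) G" and "G \<noteq> bot" "p > 0"
  shows "lp_le p v A"
  unfolding lp_le_def
proof (intro conjI allI impI)
  from ev \<open>G \<noteq> bot\<close> obtain k where "lp_le p (w k) A" using eventually_happens' by blast
  then show "0 \<le> A" by (rule lp_le_nonneg)
  fix F :: "'a set" assume F: "finite F"
  have "((\<lambda>k. \<Sum>n\<in>F. cmod (w k n) powr p) \<longlongrightarrow> (\<Sum>n\<in>F. cmod (v n) powr p)) G"
    by (intro tendsto_sum tendsto_powr' tendsto_norm lim tendsto_const) (use \<open>p > 0\<close> in auto)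
  then show "(\<Sum>n\<in>F. cmod (v n) powr p) \<le> A powr p"
  proof (rule tendsto_upperbound)
    show "\<forall>\<^sub>F i in G. (\<Sum>n\<in>F. cmod (w i n) powr p) \<le> A powr p"
      using ev by eventually_elim (rule lp_le_sum[OF _ F])
  qed fact
qed

text \<open>Hoelder for three factors with exponents p, p and p/(p-2), whose reciprocals add up to
  1. The last factor has the shape of a potential |u|^(p-2) acting between two functions in
  l^p.\<close>

lemma lp_le_mult3:
  fixes a b c :: "'a \<Rightarrow> complex"
  assumes a: "lp_le p a A" and b: "lp_le p b B" and c: "lp_le p c C" and p: "p > 2" and F: "finite F"
  shows "(\<Sum>n\<in>F. norm (a n) * norm (b n) * norm (c n) powr (p - 2)) \<le> A * B * C powr (p - 2)"
proof (cases "A = 0 \<or> B = 0 \<or> C = 0")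
  case True
  then show ?thesis
    using lp_le_zero[of p a] lp_le_zero[of p b] lp_le_zero[of p c] a b c p by auto
next
  case False
  then have A: "A > 0" and B: "B > 0" and C: "C > 0"
    using lp_le_nonneg[OF a] lp_le_nonneg[OF b] lp_le_nonneg[OF c] by auto
  have young: "x * y * z powr (p - 2) \<le> x powr p / p + y powr p / p + (1 - 2/p) * z powr p"
    if "x \<ge> 0" "y \<ge> 0" "z \<ge> 0" for x y z :: real
  proof -
    \<comment> \<open>Young with the conjugate exponents p/2 and p/(p-2); the first term is then
      split by the inequality of arithmetic and geometric means.\<close>
    have 1: "x * y * z powr (p - 2) \<le> (x * y) powr (p/2) / (p/2) + (z powr (p-2)) powr (p/(p-2)) / (p/(p-2))"
      using that p by (intro Youngs_inequality) (auto simp: field_simps)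
    have "x powr p = (x powr (p/2))\<^sup>2" "y powr p = (y powr (p/2))\<^sup>2"
      by (simp_all add: power2_eq_square powr_add[symmetric])
    then have "(x * y) powr (p/2) \<le> (x powr p + y powr p) / 2"
      using sum_squares_bound[of "x powr (p/2)" "y powr (p/2)"] that by (simp add: powr_mult)
    then have 2: "(x * y) powr (p/2) / (p/2) \<le> ((x powr p + y powr p) / 2) / (p/2)"
      using p by (intro divide_right_mono) auto
    have "(p - 2) * (p / (p - 2)) = p" using p by simp
    then have "(z powr (p-2)) powr (p/(p-2)) = z powr p" by (simp only: powr_powr)
    then have 3: "(z powr (p-2)) powr (p/(p-2)) / (p/(p-2)) = (1 - 2/p) * z powr p"
      using p by (simp add: field_simps)
    have "((x powr p + y powr p) / 2) / (p/2) = x powr p / p + y powr p / p"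
      by (simp add: add_divide_distrib)
    with 1 2 3 show ?thesis by linarith
  qed
  have "(\<Sum>n\<in>F. (norm (a n)/A) * (norm (b n)/B) * (norm (c n)/C) powr (p - 2)) \<le>
     (\<Sum>n\<in>F. (norm (a n)/A) powr p / p + (norm (b n)/B) powr p / p + (1 - 2/p) * (norm (c n)/C) powr p)"
    using A B C by (intro sum_mono young) simp_all
  also have "\<dots> = (\<Sum>n\<in>F. norm (a n) powr p) / A powr p / p + (\<Sum>n\<in>F. norm (b n) powr p) / B powr p / p
      + (1 - 2/p) * ((\<Sum>n\<in>F. norm (c n) powr p) / C powr p)"
    using A B C by (simp add: sum.distrib powr_divide sum_divide_distrib sum_distrib_left)
  also have "\<dots> \<le> 1 / p + 1 / p + (1 - 2/p) * 1"
    using lp_le_sum[OF a F] lp_le_sum[OF b F] lp_le_sum[OF c F] A B C p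
    by (intro add_mono divide_right_mono mult_left_mono) simp_all
  also have "1 / p + 1 / p + (1 - 2/p) * 1 = 1" by simp
  finally have "(\<Sum>n\<in>F. (norm (a n)/A) * (norm (b n)/B) * (norm (c n)/C) powr (p - 2)) \<le> 1" .
  also have "(\<Sum>n\<in>F. (norm (a n)/A) * (norm (b n)/B) * (norm (c n)/C) powr (p - 2)) =
     (\<Sum>n\<in>F. norm (a n) * norm (b n) * norm (c n) powr (p - 2)) / (A * B * C powr (p - 2))"
    unfolding sum_divide_distrib using C by (intro sum.cong refl) (simp add: powr_divide)
  finally show ?thesis using A B C by (simp add: divide_le_eq)
qed

section \<open>Interpolation\<close>

lemma le_if_mult_inverse_le_1: "x * inverse y \<le> 1 \<Longrightarrow> 0 < y \<Longrightarrow> x \<le> (y::real)"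
  by (simp add: field_simps)

text \<open>Hadamard's three lines theorem with boundary values at most 1. The factor exp(\<eta>(z^2
  - 1)) has modulus at most 1 on the strip and decays as |Im z| grows, so the maximum principle on a
  finite rectangle applies; at the end \<eta> tends to 0.\<close>

lemma three_lines_unit:
  fixes f :: "complex \<Rightarrow> complex"
  assumes hol: "f holomorphic_on UNIV"
    and bdd: "\<And>z. 0 \<le> Re z \<Longrightarrow> Re z \<le> 1 \<Longrightarrow> norm (f z) \<le> B"
    and e0: "\<And>z. Re z = 0 \<Longrightarrow> norm (f z) \<le> 1" and e1: "\<And>z. Re z = 1 \<Longrightarrow> norm (f z) \<le> 1"
    and \<theta>: "0 \<le> \<theta>" "\<theta> \<le> 1"
  shows "norm (f (of_real \<theta>)) \<le> 1"
proof -
  have key: "norm (f (of_real \<theta>)) \<le> exp \<eta>" if \<eta>: "\<eta> > 0" for \<eta> :: real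
  proof -
    \<comment> \<open>High enough that the Gaussian factor beats \<open>B\<close> on the horizontal
      edges: since R >= 1, \<eta> R^2 >= \<eta> (R - 1) = ln (max B 1).\<close>
    define R where "R = 1 + ln (max B 1) / \<eta>"
    have R: "R \<ge> 1" using \<eta> by (simp add: R_def)
    have "ln (max B 1) = \<eta> * (R - 1)" using \<eta> by (simp add: R_def)
    also have "\<dots> \<le> \<eta> * R\<^sup>2"
    proof -
      have "R * 1 \<le> R * R" using R by (intro mult_left_mono) auto
      then show ?thesis using \<eta> by (intro mult_left_mono) (auto simp: power2_eq_square)
    qed
    finally have "exp (ln (max B 1)) \<le> exp (\<eta> * R\<^sup>2)" by (simp only: exp_le_cancel_iff)
    moreover have "exp (ln (max B 1)) = max B 1" by (rule exp_ln) simp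
    ultimately have "B \<le> exp (\<eta> * R\<^sup>2)" by linarith
    then have BR: "B * exp (- (\<eta> * R\<^sup>2)) \<le> 1"
      by (simp add: exp_minus field_simps)
    define g where "g z = f z * exp (of_real \<eta> * (z\<^sup>2 - 1))" for z
    define S where "S = cbox (Complex 0 (-R)) (Complex 1 R)"
    have ng: "norm (g z) = norm (f z) * exp (\<eta> * ((Re z)\<^sup>2 - (Im z)\<^sup>2 - 1))" for z
      by (simp add: g_def norm_mult power2_eq_square)
    have ng_le: "norm (g z) \<le> norm (f z) * exp (- (\<eta> * (Im z)\<^sup>2))" if "0 \<le> Re z" "Re z \<le> 1" for z
    proof -
      have "(Re z)\<^sup>2 \<le> 1" using that by (simp add: power_le_one)
      then have "\<eta> * ((Re z)\<^sup>2 - (Im z)\<^sup>2 - 1) \<le> \<eta> * (- (Im z)\<^sup>2)"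
        using \<eta> by (intro mult_left_mono) auto
      then show ?thesis unfolding ng by (intro mult_left_mono) auto
    qed
    have ng_le1: "norm (g z) \<le> norm (f z)" if "0 \<le> Re z" "Re z \<le> 1" for z
    proof -
      have "exp (- (\<eta> * (Im z)\<^sup>2)) \<le> 1" using \<eta> by simp
      then have "norm (f z) * exp (- (\<eta> * (Im z)\<^sup>2)) \<le> norm (f z) * 1"
        by (intro mult_left_mono) auto
      then show ?thesis using ng_le[OF that] by simp
    qed
    have holg: "g holomorphic_on UNIV"
      unfolding g_def by (intro holomorphic_intros hol)
    have "norm (g (of_real \<theta>)) \<le> 1"
    proof (rule maximum_modulus_frontier[of g S])
      show "g holomorphic_on interior S" using holg by (rule holomorphic_on_subset) simp
      show "continuous_on (closure S) g"
        using holg by (meson holomorphic_on_imp_continuous_on continuous_on_subset subset_UNIV)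
      show "bounded S" by (simp add: S_def)
      show "of_real \<theta> \<in> S" using \<theta> R by (simp add: S_def in_cbox_complex_iff)
      fix z assume "z \<in> frontier S"
      then have z: "0 \<le> Re z" "Re z \<le> 1" "-R \<le> Im z" "Im z \<le> R"
        and edge: "Re z = 0 \<or> Re z = 1 \<or> Im z = R \<or> Im z = -R"
        unfolding S_def frontier_cbox by (auto simp: in_cbox_complex_iff in_box_complex_iff)
      show "norm (g z) \<le> 1"
      proof (cases "Re z = 0 \<or> Re z = 1")
        case True
        then show ?thesis using ng_le1[OF z(1,2)] e0[of z] e1[of z] by fastforce
      next
        case False
        then have "(Im z)\<^sup>2 = R\<^sup>2" using edge by auto
        then have "norm (g z) \<le> norm (f z) * exp (- (\<eta> * R\<^sup>2))" using ng_le[OF z(1,2)] by simp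
        also have "\<dots> \<le> B * exp (- (\<eta> * R\<^sup>2))" using bdd[OF z(1,2)] by (intro mult_right_mono) auto
        finally show ?thesis using BR by simp
      qed
    qed
    then have le: "norm (f (of_real \<theta>)) * exp (\<eta> * (\<theta>\<^sup>2 - 1)) \<le> 1" by (simp add: ng)
    have "norm (f (of_real \<theta>)) \<le> exp (\<eta> * (1 - \<theta>\<^sup>2))"
    proof -
      have "exp (\<eta> * (\<theta>\<^sup>2 - 1)) = inverse (exp (\<eta> * (1 - \<theta>\<^sup>2)))"
        by (simp add: exp_minus[symmetric] algebra_simps)
      with le have "norm (f (of_real \<theta>)) * inverse (exp (\<eta> * (1 - \<theta>\<^sup>2))) \<le> 1" by (simp only:)
      then show ?thesis by (rule le_if_mult_inverse_le_1) simp
    qed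
    also have "\<dots> \<le> exp (\<eta> * 1)" using \<eta> by (subst exp_le_cancel_iff, intro mult_left_mono) auto
    finally show ?thesis by simp
  qed
  have "((\<lambda>\<eta>. exp \<eta>) \<longlongrightarrow> exp (0::real)) (at_right 0)" by (intro tendsto_intros)
  then have "(exp \<longlongrightarrow> (1::real)) (at_right 0)" by simp
  then show ?thesis
  proof (rule tendsto_lowerbound)
    show "\<forall>\<^sub>F \<eta> in at_right 0. norm (f (of_real \<theta>)) \<le> exp \<eta>"
      using key by (auto simp: eventually_at_right_field intro!: exI[of _ 1])
  qed simp
qed

text \<open>Thorin's argument: h and g are embedded into analytic families whose moduli on Re z = 0
  and Re z = 1 have norm 1 in l^q0 and l^q1, and which return h and g at z = \<theta>. The two
  exponentials in \<open>f\<close> normalise the edge bounds \<open>M0\<close> and \<open>M1\<close>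
  to 1.\<close>

lemma riesz_thorin_normalized:
  fixes K :: "'a \<Rightarrow> 'b \<Rightarrow> complex"
  assumes F: "finite F" "finite G" and q: "q0 > 0" "q1 > 0" "q > 0" "1/q = (1-\<theta>)/q0 + \<theta>/q1"
    and \<theta>: "0 \<le> \<theta>" "\<theta> \<le> 1" and M: "M0 > 0" "M1 > 0"
    and b0: "\<And>h g. norm (\<Sum>n\<in>F. \<Sum>m\<in>G. h n * K n m * g m) \<le> M0 * lp_fin q0 F h * lp_fin q0 G g"
    and b1: "\<And>h g. norm (\<Sum>n\<in>F. \<Sum>m\<in>G. h n * K n m * g m) \<le> M1 * lp_fin q1 F h * lp_fin q1 G g"
    and nh: "(\<Sum>n\<in>F. norm (h n) powr q) = 1" and ng: "(\<Sum>m\<in>G. norm (g m) powr q) = 1"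
  shows "norm (\<Sum>n\<in>F. \<Sum>m\<in>G. h n * K n m * g m) \<le> M0 powr (1-\<theta>) * M1 powr \<theta>"
proof -
  \<comment> \<open>The reciprocal exponent, interpolated analytically; its value at z = \<theta> is
    1/q.\<close>
  define L where "L z = (1 - z) / of_real q0 + z / of_real q1" for z :: complex
  \<comment> \<open>This is sgn w times |w| to the complex power q L z; w = 0 is separate because
    the power is written through the logarithm.\<close>
  define E where "E w z = (if w = 0 then 0 else sgn w * exp (of_real (q * ln (norm w)) * L z))" for w z :: complex
  define f where "f z = (\<Sum>n\<in>F. \<Sum>m\<in>G. E (h n) z * K n m * E (g m) z)
      * exp (of_real (ln M0) * (z - 1)) * exp (- of_real (ln M1) * z)" for z
  have ReL: "Re (L z) = (1 - Re z) / q0 + Re z / q1" for z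
    by (simp add: L_def)
  have nE: "norm (E w z) = (if w = 0 then 0 else exp (q * ln (norm w) * ((1 - Re z) / q0 + Re z / q1)))" for w z
    by (auto simp: E_def norm_mult norm_sgn ReL)
  have n0: "norm (E w z) powr q0 = norm w powr q" if "Re z = 0" for w z
    using that q by (auto simp: nE powr_def)
  have n1: "norm (E w z) powr q1 = norm w powr q" if "Re z = 1" for w z
    using that q by (auto simp: nE powr_def)
  have nM: "norm (exp (of_real (ln M0) * (z - 1)) * exp (- of_real (ln M1) * z)) = M0 powr (Re z - 1) * M1 powr (- Re z)" for z
    using M by (simp add: norm_mult powr_def mult.commute)
  have nf: "norm (f z) = norm (\<Sum>n\<in>F. \<Sum>m\<in>G. E (h n) z * K n m * E (g m) z) * (M0 powr (Re z - 1) * M1 powr (- Re z))" for z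
    unfolding f_def mult.assoc norm_mult[of "sum _ _"] by (simp only: nM)
  have edge0: "norm (f z) \<le> 1" if "Re z = 0" for z
  proof -
    have "norm (\<Sum>n\<in>F. \<Sum>m\<in>G. E (h n) z * K n m * E (g m) z) \<le> M0"
      using b0[of "\<lambda>n. E (h n) z" "\<lambda>m. E (g m) z"] by (simp add: lp_fin_def n0[OF that] nh ng)
    then show ?thesis using M by (simp add: nf that powr_minus field_simps)
  qed
  have edge1: "norm (f z) \<le> 1" if "Re z = 1" for z
  proof -
    have "norm (\<Sum>n\<in>F. \<Sum>m\<in>G. E (h n) z * K n m * E (g m) z) \<le> M1"
      using b1[of "\<lambda>n. E (h n) z" "\<lambda>m. E (g m) z"] by (simp add: lp_fin_def n1[OF that] nh ng)
    then show ?thesis using M by (simp add: nf that powr_minus field_simps)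
  qed
  \<comment> \<open>A crude bound for |E w z| on the strip. The three lines theorem asks for some
    bound there, and its size does not affect the result.\<close>
  define b where "b w = exp (\<bar>q * ln (norm w)\<bar> * (1/q0 + 1/q1))" for w :: complex
  define B where "B = (\<Sum>n\<in>F. \<Sum>m\<in>G. b (h n) * norm (K n m) * b (g m)) * (exp \<bar>ln M0\<bar> * exp \<bar>ln M1\<bar>)"
  have Eb: "norm (E w z) \<le> b w" if "0 \<le> Re z" "Re z \<le> 1" for w z
  proof (cases "w = 0")
    case False
    have l: "0 \<le> (1 - Re z) / q0 + Re z / q1" "(1 - Re z) / q0 + Re z / q1 \<le> 1/q0 + 1/q1"
      using that q by (auto intro!: add_mono divide_right_mono)
    have "q * ln (norm w) * ((1 - Re z) / q0 + Re z / q1) \<le> \<bar>q * ln (norm w)\<bar> * (1/q0 + 1/q1)"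
      using l by (intro mult_mono) auto
    then show ?thesis using False by (simp add: nE b_def)
  qed (simp add: E_def b_def)
  have bound: "norm (f z) \<le> B" if z: "0 \<le> Re z" "Re z \<le> 1" for z
  proof -
    have w: "M0 powr (Re z - 1) * M1 powr (- Re z) \<le> exp \<bar>ln M0\<bar> * exp \<bar>ln M1\<bar>"
    proof (intro mult_mono)
      have "\<bar>(Re z - 1) * ln M0\<bar> \<le> 1 * \<bar>ln M0\<bar>" unfolding abs_mult using z by (intro mult_right_mono) auto
      then show "M0 powr (Re z - 1) \<le> exp \<bar>ln M0\<bar>" using M by (simp add: powr_def)
      have "\<bar>(- Re z) * ln M1\<bar> \<le> 1 * \<bar>ln M1\<bar>" unfolding abs_mult using z by (intro mult_right_mono) auto
      then show "M1 powr (- Re z) \<le> exp \<bar>ln M1\<bar>" using M by (simp add: powr_def)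
    qed auto
    have "norm (\<Sum>n\<in>F. \<Sum>m\<in>G. E (h n) z * K n m * E (g m) z) \<le> (\<Sum>n\<in>F. \<Sum>m\<in>G. b (h n) * norm (K n m) * b (g m))"
      by (intro order_trans[OF norm_sum] sum_mono)
         (auto simp: norm_mult b_def[symmetric] intro!: mult_mono Eb z, auto simp: b_def)
    then show ?thesis unfolding nf B_def by (rule mult_mono[OF _ w]) (auto intro!: sum_nonneg simp: b_def)
  qed
  have hol: "f holomorphic_on UNIV"
  proof -
    have "E w holomorphic_on UNIV" for w
      unfolding E_def L_def using q by (cases "w = 0") (auto intro!: holomorphic_intros)
    then show ?thesis unfolding f_def by (intro holomorphic_intros) auto
  qed
  have fin: "norm (f (of_real \<theta>)) \<le> 1"
    by (rule three_lines_unit[OF hol bound edge0 edge1 \<theta>])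
  have E\<theta>: "E w (of_real \<theta>) = w" for w
  proof (cases "w = 0")
    case False
    have "L (of_real \<theta>) = of_real ((1-\<theta>)/q0 + \<theta>/q1)" by (simp add: L_def)
    also have "\<dots> = of_real (1/q)" by (simp only: q(4))
    finally have "of_real (q * ln (norm w)) * L (of_real \<theta>) = of_real (ln (norm w))"
      using q(3) by (simp only: of_real_mult[symmetric]) simp
    then have "E w (of_real \<theta>) = sgn w * of_real (norm w)"
      using False by (simp add: E_def exp_of_real del: of_real_mult)
    then show ?thesis using False by (simp add: sgn_div_norm scaleR_conv_of_real)
  qed (simp add: E_def)
  have "norm (\<Sum>n\<in>F. \<Sum>m\<in>G. h n * K n m * g m) * (M0 powr (\<theta> - 1) * M1 powr (- \<theta>)) \<le> 1"
    using fin by (simp add: nf E\<theta>)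
  moreover have "M0 powr (\<theta> - 1) * M1 powr (- \<theta>) = inverse (M0 powr (1-\<theta>) * M1 powr \<theta>)"
    by (simp add: powr_minus[symmetric])
  ultimately have "norm (\<Sum>n\<in>F. \<Sum>m\<in>G. h n * K n m * g m) * inverse (M0 powr (1-\<theta>) * M1 powr \<theta>) \<le> 1"
    by (simp only:)
  then show ?thesis by (rule le_if_mult_inverse_le_1) (use M in simp)
qed

lemma lp_fin_eq_0:
  assumes "finite F" "lp_fin p F h = 0" "n \<in> F"
  shows "h n = 0"
proof -
  have "(\<Sum>n\<in>F. norm (h n) powr p) = 0" using assms by (simp add: lp_fin_def)
  then have "norm (h n) powr p = 0" using assms by (simp add: sum_nonneg_eq_0_iff)
  then show ?thesis by simp
qed

text \<open>Both slots carry the same exponent because the form of an operator from l^q to the dual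
  exponent is bounded on l^q x l^q. The general case follows by scaling both arguments to norm 1; a
  vector of norm 0 vanishes on its set.\<close>

theorem riesz_thorin:
  fixes K :: "'a \<Rightarrow> 'b \<Rightarrow> complex"
  assumes F: "finite F" "finite G" and q: "q0 > 0" "q1 > 0" "q > 0" "1/q = (1-\<theta>)/q0 + \<theta>/q1"
    and \<theta>: "0 \<le> \<theta>" "\<theta> \<le> 1" and M: "M0 > 0" "M1 > 0"
    and b0: "\<And>h g. norm (\<Sum>n\<in>F. \<Sum>m\<in>G. h n * K n m * g m) \<le> M0 * lp_fin q0 F h * lp_fin q0 G g"
    and b1: "\<And>h g. norm (\<Sum>n\<in>F. \<Sum>m\<in>G. h n * K n m * g m) \<le> M1 * lp_fin q1 F h * lp_fin q1 G g"
  shows "norm (\<Sum>n\<in>F. \<Sum>m\<in>G. h n * K n m * g m) \<le> M0 powr (1-\<theta>) * M1 powr \<theta> * lp_fin q F h * lp_fin q G g"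
proof (cases "lp_fin q F h = 0 \<or> lp_fin q G g = 0")
  case True
  have "(\<Sum>n\<in>F. \<Sum>m\<in>G. h n * K n m * g m) = 0"
    using True by (auto simp: lp_fin_eq_0[OF F(1)] lp_fin_eq_0[OF F(2)] intro!: sum.neutral)
  then show ?thesis using True by auto
next
  case False
  define a where "a = lp_fin q F h"
  define c where "c = lp_fin q G g"
  have ac: "a > 0" "c > 0" using False lp_fin_nonneg[of q F h] lp_fin_nonneg[of q G g] by (auto simp: a_def c_def)
  have a: "a powr q = (\<Sum>n\<in>F. norm (h n) powr q)" and c: "c powr q = (\<Sum>n\<in>G. norm (g n) powr q)"
    using q(3) by (simp_all add: a_def c_def lp_fin_def powr_powr sum_nonneg)
  have "norm (\<Sum>n\<in>F. \<Sum>m\<in>G. (h n / of_real a) * K n m * (g m / of_real c)) \<le> M0 powr (1-\<theta>) * M1 powr \<theta>"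
  proof (rule riesz_thorin_normalized[OF F q \<theta> M b0 b1])
    show "(\<Sum>n\<in>F. norm (h n / of_real a) powr q) = 1"
      using ac a[symmetric] by (simp add: norm_divide powr_divide sum_divide_distrib[symmetric])
    show "(\<Sum>n\<in>G. norm (g n / of_real c) powr q) = 1"
      using ac c[symmetric] by (simp add: norm_divide powr_divide sum_divide_distrib[symmetric])
  qed
  moreover have "(\<Sum>n\<in>F. \<Sum>m\<in>G. (h n / of_real a) * K n m * (g m / of_real c)) =
     (\<Sum>n\<in>F. \<Sum>m\<in>G. h n * K n m * g m) / of_real (a * c)"
    by (simp add: sum_divide_distrib mult.assoc)
  ultimately have "norm (\<Sum>n\<in>F. \<Sum>m\<in>G. h n * K n m * g m) / (a * c) \<le> M0 powr (1-\<theta>) * M1 powr \<theta>"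
    using ac by (simp only: norm_divide norm_of_real abs_of_pos mult_pos_pos)
  then have "norm (\<Sum>n\<in>F. \<Sum>m\<in>G. h n * K n m * g m) \<le> M0 powr (1-\<theta>) * M1 powr \<theta> * (a * c)"
    using ac by (simp only: pos_divide_le_eq mult_pos_pos)
  then show ?thesis by (simp only: a_def c_def mult.assoc)
qed

section \<open>Oscillatory integrals and the one-dimensional kernel\<close>

lemma cis_integral_bound_trivial:
  fixes \<phi> :: "real \<Rightarrow> real"
  assumes "a \<le> b" "continuous_on {a..b} \<phi>"
  shows "norm (integral {a..b} (\<lambda>x. cis (\<phi> x))) \<le> b - a"
proof -
  have "norm (integral {a..b} (\<lambda>x. cis (\<phi> x))) \<le> integral {a..b} (\<lambda>x. 1::real)"
    by (rule integral_norm_bound_integral)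
       (auto intro!: integrable_continuous_real continuous_intros assms(2))
  then show ?thesis using assms(1) by simp
qed

lemma has_vector_derivative_cis:
  assumes "(\<phi> has_real_derivative \<psi>) (at x within S)"
  shows "((\<lambda>x. cis (\<phi> x)) has_vector_derivative (\<i> * of_real \<psi> * cis (\<phi> x))) (at x within S)"
proof -
  have "(\<phi> has_vector_derivative \<psi>) (at x within S)"
    using assms by (simp add: has_real_derivative_iff_has_vector_derivative)
  moreover have "(cis has_vector_derivative (\<i> * cis (\<phi> x))) (at (\<phi> x) within \<phi> ` S)"
    by (auto intro!: derivative_eq_intros simp: has_vector_derivative_def cis.ctr complex_eq_iff scaleR_conv_of_real)
  ultimately have "(cis \<circ> \<phi> has_vector_derivative \<psi> *\<^sub>R (\<i> * cis (\<phi> x))) (at x within S)"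
    by (rule vector_diff_chain_within)
  then show ?thesis by (simp add: o_def scaleR_conv_of_real mult_ac)
qed

text \<open>Integration by parts. The sign of \<omega> makes 1/\<psi> monotone, so the integral of
  the modulus of its derivative is again a boundary term; four boundary terms of size at most
  1/\<mu> give the constant 4.\<close>

lemma van_der_corput_first:
  fixes \<phi> \<psi> \<omega> :: "real \<Rightarrow> real"
  assumes ab: "a \<le> b" and \<phi>: "\<And>x. (\<phi> has_real_derivative \<psi> x) (at x)"
    and \<psi>: "\<And>x. (\<psi> has_real_derivative \<omega> x) (at x)" and \<omega>: "continuous_on UNIV \<omega>"
    and \<omega>0: "\<And>x. x \<in> {a..b} \<Longrightarrow> \<omega> x \<ge> 0"
    and \<mu>: "\<mu> > 0" "\<And>x. x \<in> {a..b} \<Longrightarrow> \<bar>\<psi> x\<bar> \<ge> \<mu>"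
  shows "norm (integral {a..b} (\<lambda>x. cis (\<phi> x))) \<le> 4 / \<mu>"
proof -
  have nz: "\<psi> x \<noteq> 0" if "x \<in> {a..b}" for x using \<mu>(2)[OF that] \<mu>(1) by auto
  have c\<phi>: "continuous_on {a..b} \<phi>"
    by (rule DERIV_continuous_on) (rule has_field_derivative_at_within[OF \<phi>])
  have c\<psi>: "continuous_on {a..b} \<psi>"
    by (rule DERIV_continuous_on) (rule has_field_derivative_at_within[OF \<psi>])
  have c\<omega>: "continuous_on {a..b} \<omega>"
    by (rule continuous_on_subset[OF \<omega>]) simp
  \<comment> \<open>An antiderivative of cis \<phi> up to the error i cis \<phi> r, where r is minus
    the derivative of 1/\<psi>.\<close>
  define G where "G x = - \<i> * cis (\<phi> x) * of_real (inverse (\<psi> x))" for x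
  define r where "r x = \<omega> x / (\<psi> x)\<^sup>2" for x
  have dinv: "((\<lambda>x. inverse (\<psi> x)) has_real_derivative - r x) (at x within {a..b})" if "x \<in> {a..b}" for x
    using nz[OF that] by (auto intro!: derivative_eq_intros has_field_derivative_at_within[OF \<psi>]
        simp: r_def power2_eq_square field_simps)
  have dG: "(G has_vector_derivative (cis (\<phi> x) + \<i> * cis (\<phi> x) * of_real (r x))) (at x within {a..b})"
    if "x \<in> {a..b}" for x
  proof -
    have "((\<lambda>x. of_real (inverse (\<psi> x)) :: complex) has_vector_derivative of_real (- r x)) (at x within {a..b})"
      using dinv[OF that] by (intro has_vector_derivative_of_real)
         (simp add: has_real_derivative_iff_has_vector_derivative)
    then have "(G has_vector_derivative (- \<i> * cis (\<phi> x)) * of_real (- r x) +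
          (- \<i> * (\<i> * of_real (\<psi> x) * cis (\<phi> x))) * of_real (inverse (\<psi> x))) (at x within {a..b})"
      unfolding G_def
      by (intro has_vector_derivative_mult has_vector_derivative_mult_right
          has_vector_derivative_cis has_field_derivative_at_within[OF \<phi>])
    then show ?thesis using nz[OF that] by (simp add: field_simps)
  qed
  have i1: "((\<lambda>x. cis (\<phi> x) + \<i> * cis (\<phi> x) * of_real (r x)) has_integral (G b - G a)) {a..b}"
    using dG by (intro fundamental_theorem_of_calculus ab)
  have i2: "(r has_integral (- inverse (\<psi> b) - (- inverse (\<psi> a)))) {a..b}"
  proof (rule fundamental_theorem_of_calculus[OF ab])
    fix x assume "x \<in> {a..b}"
    from DERIV_minus[OF dinv[OF this]]
    show "((\<lambda>x. - inverse (\<psi> x)) has_vector_derivative r x) (at x within {a..b})"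
      by (simp add: has_real_derivative_iff_has_vector_derivative)
  qed
  have cr: "continuous_on {a..b} r"
    unfolding r_def by (intro continuous_intros c\<omega> c\<psi>) (use nz in auto)
  have i3: "(\<lambda>x. \<i> * cis (\<phi> x) * of_real (r x)) integrable_on {a..b}"
    by (intro integrable_continuous_real continuous_intros c\<phi> cr)
  have "((\<lambda>x. cis (\<phi> x)) has_integral (G b - G a - integral {a..b} (\<lambda>x. \<i> * cis (\<phi> x) * of_real (r x)))) {a..b}"
    using has_integral_diff[OF i1 integrable_integral[OF i3]] by simp
  then have "norm (integral {a..b} (\<lambda>x. cis (\<phi> x))) = norm (G b - G a - integral {a..b} (\<lambda>x. \<i> * cis (\<phi> x) * of_real (r x)))"
    by (simp add: integral_unique)
  also have "\<dots> \<le> norm (G b) + norm (G a) + norm (integral {a..b} (\<lambda>x. \<i> * cis (\<phi> x) * of_real (r x)))"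
    by (smt (verit) norm_triangle_ineq4)
  also have "norm (integral {a..b} (\<lambda>x. \<i> * cis (\<phi> x) * of_real (r x))) \<le> integral {a..b} r"
    using i2 i3 \<omega>0 by (intro integral_norm_bound_integral) (auto simp: norm_mult norm_divide norm_power r_def)
  also have "integral {a..b} r = - inverse (\<psi> b) - (- inverse (\<psi> a))" using i2 by (rule integral_unique)
  finally have le: "norm (integral {a..b} (\<lambda>x. cis (\<phi> x))) \<le> norm (G b) + norm (G a) + (- inverse (\<psi> b) - (- inverse (\<psi> a)))"
    by simp
  have inv: "\<bar>inverse (\<psi> x)\<bar> \<le> 1 / \<mu>" if "x \<in> {a..b}" for x
    unfolding abs_inverse
    using le_imp_inverse_le[OF \<mu>(2)[OF that] \<mu>(1)] by (simp add: inverse_eq_divide)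
  have nG: "norm (G x) = \<bar>inverse (\<psi> x)\<bar>" for x
    unfolding G_def norm_mult by (simp del: of_real_inverse)
  have "norm (G b) + norm (G a) + (- inverse (\<psi> b) - (- inverse (\<psi> a))) \<le> 1/\<mu> + 1/\<mu> + (1/\<mu> + 1/\<mu>)"
  proof -
    have "\<bar>inverse (\<psi> a)\<bar> \<le> 1/\<mu>" "\<bar>inverse (\<psi> b)\<bar> \<le> 1/\<mu>" by (rule inv, use ab in simp)+
    then show ?thesis
      unfolding nG using abs_ge_self[of "inverse (\<psi> a)"] abs_ge_minus_self[of "inverse (\<psi> b)"] by linarith
  qed
  with le show ?thesis by simp
qed

text \<open>Since \<psi> grows at rate at least \<mu>^2, it satisfies |\<psi>| >= \<mu> at distance
  1/\<mu> from the point c where it changes sign. The two outer pieces contribute 4/\<mu> each by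
  the first estimate, and the middle one at most its length 2/\<mu>.\<close>

lemma van_der_corput_second:
  fixes \<phi> \<psi> \<omega> :: "real \<Rightarrow> real"
  assumes ab: "a \<le> b" and \<phi>: "\<And>x. (\<phi> has_real_derivative \<psi> x) (at x)"
    and \<psi>: "\<And>x. (\<psi> has_real_derivative \<omega> x) (at x)" and \<omega>: "continuous_on UNIV \<omega>"
    and \<mu>: "\<mu> > 0" "\<And>x. x \<in> {a..b} \<Longrightarrow> \<omega> x \<ge> \<mu>\<^sup>2"
  shows "norm (integral {a..b} (\<lambda>x. cis (\<phi> x))) \<le> 10 / \<mu>"
proof -
  have growth: "\<psi> y - \<psi> x \<ge> \<mu>\<^sup>2 * (y - x)" if "a \<le> x" "x \<le> y" "y \<le> b" for x y
  proof -
    have "\<psi> x - \<mu>\<^sup>2 * x \<le> \<psi> y - \<mu>\<^sup>2 * y"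
      using that(2)
    proof (rule DERIV_nonneg_imp_nondecreasing)
      fix z assume "x \<le> z" "z \<le> y"
      then show "\<exists>D. ((\<lambda>x. \<psi> x - \<mu>\<^sup>2 * x) has_real_derivative D) (at z) \<and> 0 \<le> D"
        using \<mu>(2)[of z] that by (intro exI[of _ "\<omega> z - \<mu>\<^sup>2"]) (auto intro!: derivative_eq_intros \<psi>)
    qed
    then show ?thesis by (simp add: algebra_simps)
  qed
  have c\<phi>: "continuous_on S \<phi>" for S
    by (rule DERIV_continuous_on) (rule has_field_derivative_at_within[OF \<phi>])
  have c\<psi>: "continuous_on S \<psi>" for S
    by (rule DERIV_continuous_on) (rule has_field_derivative_at_within[OF \<psi>])
  \<comment> \<open>If \<psi> has a constant sign, c is an endpoint and one of the two implications
    is vacuous; otherwise it is a zero.\<close>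
  have "\<exists>c\<in>{a..b}. (c < b \<longrightarrow> \<psi> c \<ge> 0) \<and> (a < c \<longrightarrow> \<psi> c \<le> 0)"
  proof (cases "\<psi> a \<ge> 0 \<or> \<psi> b \<le> 0")
    case True
    then show ?thesis using ab by (metis atLeastAtMost_iff less_irrefl order_refl)
  next
    case False
    then obtain c where "a \<le> c" "c \<le> b" "\<psi> c = 0"
      using IVT'[of \<psi> a 0 b] ab c\<psi> by auto
    then show ?thesis by (intro bexI[of _ c]) simp_all
  qed
  then obtain c where c: "a \<le> c" "c \<le> b" "c < b \<Longrightarrow> \<psi> c \<ge> 0" "a < c \<Longrightarrow> \<psi> c \<le> 0"
    by (metis atLeastAtMost_iff)
  define \<eta> where "\<eta> = 1 / \<mu>"
  have \<eta>: "\<eta> > 0" "\<mu>\<^sup>2 * \<eta> = \<mu>" using \<mu>(1) by (auto simp: \<eta>_def power2_eq_square)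
  define p where "p = max a (c - \<eta>)"
  define r where "r = min b (c + \<eta>)"
  have pr: "a \<le> p" "p \<le> r" "r \<le> b" "r - p \<le> 2 * \<eta>" using ab c \<eta> by (auto simp: p_def r_def)
  define f where "f x = cis (\<phi> x)" for x
  have int: "f integrable_on {x..y}" for x y
    unfolding f_def by (intro integrable_continuous_real continuous_intros c\<phi>)
  have left: "norm (integral {a..p} f) \<le> 4 / \<mu>"
  proof (cases "p = a")
    case False
    then have p: "p = c - \<eta>" "a < c" using \<eta> by (auto simp: p_def max_def split: if_splits)
    show ?thesis unfolding f_def
    proof (rule van_der_corput_first[OF pr(1) \<phi> \<psi> \<omega> _ \<mu>(1)])
      fix x assume x: "x \<in> {a..p}"
      show "\<omega> x \<ge> 0" using \<mu>(2)[of x] x pr order_trans[OF zero_le_power2] by fastforce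
      have "\<mu>\<^sup>2 * \<eta> \<le> \<mu>\<^sup>2 * (c - x)" using x p by (intro mult_left_mono) auto
      also have "\<dots> \<le> \<psi> c - \<psi> x" using x p c \<eta> by (intro growth) auto
      also have "\<dots> \<le> - \<psi> x" using c p by auto
      finally show "\<mu> \<le> \<bar>\<psi> x\<bar>" using \<eta> by simp
    qed
  qed (use \<mu> in simp)
  have right: "norm (integral {r..b} f) \<le> 4 / \<mu>"
  proof (cases "r = b")
    case False
    then have p: "r = c + \<eta>" "c < b" using \<eta> by (auto simp: r_def min_def split: if_splits)
    show ?thesis unfolding f_def
    proof (rule van_der_corput_first[OF pr(3) \<phi> \<psi> \<omega> _ \<mu>(1)])
      fix x assume x: "x \<in> {r..b}"
      show "\<omega> x \<ge> 0" using \<mu>(2)[of x] x pr order_trans[OF zero_le_power2] by fastforce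
      have "\<mu>\<^sup>2 * \<eta> \<le> \<mu>\<^sup>2 * (x - c)" using x p by (intro mult_left_mono) auto
      also have "\<dots> \<le> \<psi> x - \<psi> c" using x p c \<eta> by (intro growth) auto
      also have "\<dots> \<le> \<psi> x" using c p by auto
      finally show "\<mu> \<le> \<bar>\<psi> x\<bar>" using \<eta> by simp
    qed
  qed (use \<mu> in simp)
  have mid: "norm (integral {p..r} f) \<le> 2 * \<eta>"
    using cis_integral_bound_trivial[OF pr(2) c\<phi>] pr(4) unfolding f_def by linarith
  have "integral {a..b} f = integral {a..p} f + integral {p..r} f + integral {r..b} f"
    using Henstock_Kurzweil_Integration.integral_combine[of a p r f]
      Henstock_Kurzweil_Integration.integral_combine[of a r b f] int pr by simp
  then have "norm (integral {a..b} f) \<le> 4 / \<mu> + 2 * \<eta> + 4 / \<mu>"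
    using left mid right norm_triangle_ineq[of "integral {a..p} f + integral {p..r} f" "integral {r..b} f"]
      norm_triangle_ineq[of "integral {a..p} f" "integral {p..r} f"] by simp
  then show ?thesis by (simp add: \<eta>_def f_def[abs_def])
qed

text \<open>Complex conjugation replaces \<phi> by -\<phi> and preserves the modulus of the
  integral.\<close>

lemma van_der_corput_second_neg:
  fixes \<phi> \<psi> \<omega> :: "real \<Rightarrow> real"
  assumes ab: "a \<le> b" and \<phi>: "\<And>x. (\<phi> has_real_derivative \<psi> x) (at x)"
    and \<psi>: "\<And>x. (\<psi> has_real_derivative \<omega> x) (at x)" and \<omega>: "continuous_on UNIV \<omega>"
    and \<mu>: "\<mu> > 0" "\<And>x. x \<in> {a..b} \<Longrightarrow> \<omega> x \<le> - \<mu>\<^sup>2"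
  shows "norm (integral {a..b} (\<lambda>x. cis (\<phi> x))) \<le> 10 / \<mu>"
proof -
  have "norm (integral {a..b} (\<lambda>x. cis (- \<phi> x))) \<le> 10 / \<mu>"
  proof (rule van_der_corput_second[OF ab])
    show "((\<lambda>x. - \<phi> x) has_real_derivative - \<psi> x) (at x)" for x by (intro derivative_intros \<phi>)
    show "((\<lambda>x. - \<psi> x) has_real_derivative - \<omega> x) (at x)" for x by (intro derivative_intros \<psi>)
    show "continuous_on UNIV (\<lambda>x. - \<omega> x)" by (intro continuous_intros \<omega>)
    show "\<mu>\<^sup>2 \<le> - \<omega> x" if "x \<in> {a..b}" for x using \<mu>(2)[OF that] by simp
  qed fact
  also have "(\<lambda>x. cis (- \<phi> x)) = (\<lambda>x. cnj (cis (\<phi> x)))" by (simp add: cis_cnj)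
  also have "integral {a..b} (\<lambda>x. cnj (cis (\<phi> x))) = cnj (integral {a..b} (\<lambda>x. cis (\<phi> x)))"
    by (simp add: integral_cnj)
  finally show ?thesis by simp
qed

text \<open>The inverse Fourier transform of exp(it(2 cos \<theta> - 2)), that is exp(-2it) i^k
  J_k(2t) with the Bessel function J_k. The period is chosen to start at -pi/2 so that the zeros of
  the cosine lie at its ends and its midpoint.\<close>

definition lattice_kernel :: "real \<Rightarrow> int \<Rightarrow> complex" where
  "lattice_kernel t k = integral {-pi/2..3*pi/2} (\<lambda>\<theta>. cis (2 * t * (cos \<theta> - 1) + of_int k * \<theta>)) / of_real (2 * pi)"

lemma lattice_kernel_le_1: "norm (lattice_kernel t k) \<le> 1"
proof -
  have "norm (integral {-pi/2..3*pi/2} (\<lambda>\<theta>. cis (2 * t * (cos \<theta> - 1) + of_int k * \<theta>))) \<le> 3*pi/2 - (-pi/2)"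
    by (rule cis_integral_bound_trivial) (auto intro!: continuous_intros)
  then show ?thesis by (simp add: lattice_kernel_def norm_divide norm_mult)
qed

lemma lattice_kernel_0: "lattice_kernel 0 k = (if k = 0 then 1 else 0)"
proof (cases "k = 0")
  case True
  then show ?thesis by (simp add: lattice_kernel_def scaleR_conv_of_real)
next
  case False
  have "((\<lambda>\<theta>. cis (of_int k * \<theta>)) has_integral
      (cis (of_int k * (3*pi/2)) * (- \<i> / of_int k) - cis (of_int k * (-pi/2)) * (- \<i> / of_int k))) {-pi/2..3*pi/2}"
  proof (rule fundamental_theorem_of_calculus)
    fix x :: real assume "x \<in> {-pi/2..3*pi/2}"
    have "((\<lambda>\<theta>. cis (of_int k * \<theta>)) has_vector_derivative \<i> * of_real (of_int k) * cis (of_int k * x)) (at x within {-pi/2..3*pi/2})"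
      by (rule has_vector_derivative_cis) (auto intro!: derivative_eq_intros)
    then have "((\<lambda>\<theta>. cis (of_int k * \<theta>) * (- \<i> / of_int k)) has_vector_derivative
        (\<i> * of_real (of_int k) * cis (of_int k * x)) * (- \<i> / of_int k)) (at x within {-pi/2..3*pi/2})"
      by (rule has_vector_derivative_mult_left)
    then show "((\<lambda>\<theta>. cis (of_int k * \<theta>) * (- \<i> / of_int k)) has_vector_derivative cis (of_int k * x)) (at x within {-pi/2..3*pi/2})"
      using False by (simp add: field_simps)
  qed simp
  moreover have "cis (of_int k * (3*pi/2)) = cis (of_int k * (-pi/2))"
  proof -
    have "cis (of_int k * (3*pi/2)) = cis (of_int k * (-pi/2)) * cis (2 * pi * of_int k)"
      by (simp add: cis_mult algebra_simps)
    then show ?thesis by (simp add: cis_multiple_2pi)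
  qed
  ultimately show ?thesis using False by (simp add: lattice_kernel_def integral_unique)
qed

text \<open>Differentiation under the integral produces the symbol 2(cos \<theta> - 1) = cis
  \<theta> + cis (-\<theta>) - 2, and multiplication by cis (\<plusminus>\<theta>) shifts k by
  one.\<close>

lemma lattice_kernel_deriv:
  "((\<lambda>t. lattice_kernel t k) has_vector_derivative
     \<i> * (lattice_kernel t (k + 1) + lattice_kernel t (k - 1) - 2 * lattice_kernel t k)) (at t within S)"
proof -
  define I where "I = cbox (-pi/2) (3*pi/2)"
  define f where "f t \<theta> = cis (2 * t * (cos \<theta> - 1) + of_int k * \<theta>)" for t \<theta>
  have i: "f t integrable_on I" "(\<lambda>\<theta>. cis (2 * t * (cos \<theta> - 1) + of_int m * \<theta>)) integrable_on I" for m t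
    unfolding I_def f_def cbox_interval by (intro integrable_continuous_real continuous_intros)+
  have "((\<lambda>t. integral I (f t)) has_vector_derivative integral I (\<lambda>\<theta>. \<i> * of_real (2 * (cos \<theta> - 1)) * f t \<theta>)) (at t within UNIV)"
    unfolding I_def
  proof (rule leibniz_rule_vector_derivative)
    show "((\<lambda>t. f t \<theta>) has_vector_derivative \<i> * of_real (2 * (cos \<theta> - 1)) * f t \<theta>) (at t within UNIV)" for t \<theta>
      unfolding f_def by (rule has_vector_derivative_cis) (auto intro!: derivative_eq_intros)
    show "f t integrable_on cbox (-pi/2) (3*pi/2)" for t using i by (simp add: I_def)
    show "continuous_on (UNIV \<times> cbox (-pi/2) (3*pi/2)) (\<lambda>(t, \<theta>). \<i> * of_real (2 * (cos \<theta> - 1)) * f t \<theta>)"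
      unfolding f_def case_prod_beta by (intro continuous_intros)
  qed auto
  then have d: "((\<lambda>t. integral I (f t) / of_real (2 * pi)) has_vector_derivative
      integral I (\<lambda>\<theta>. \<i> * of_real (2 * (cos \<theta> - 1)) * f t \<theta>) / of_real (2 * pi)) (at t)"
    by (intro has_vector_derivative_divide) simp
  have e: "of_real (2 * (cos \<theta> - 1)) = cis \<theta> + cis (- \<theta>) - 2" for \<theta>
    by (simp add: complex_eq_iff)
  have "integral I (\<lambda>\<theta>. \<i> * of_real (2 * (cos \<theta> - 1)) * f t \<theta>)
     = integral I (\<lambda>\<theta>. \<i> * (cis (2 * t * (cos \<theta> - 1) + of_int (k + 1) * \<theta>)
        + cis (2 * t * (cos \<theta> - 1) + of_int (k - 1) * \<theta>) - 2 * f t \<theta>))"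
  proof (rule integral_cong)
    fix \<theta>
    have "cis (2 * t * (cos \<theta> - 1) + of_int (k + 1) * \<theta>) = cis \<theta> * f t \<theta>"
      "cis (2 * t * (cos \<theta> - 1) + of_int (k - 1) * \<theta>) = cis (- \<theta>) * f t \<theta>"
      unfolding f_def cis_mult by (simp_all add: algebra_simps)
    then show "\<i> * of_real (2 * (cos \<theta> - 1)) * f t \<theta> = \<i> * (cis (2 * t * (cos \<theta> - 1) + of_int (k + 1) * \<theta>)
        + cis (2 * t * (cos \<theta> - 1) + of_int (k - 1) * \<theta>) - 2 * f t \<theta>)"
      unfolding e by (simp add: algebra_simps)
  qed
  also have "\<dots> = \<i> * (integral I (\<lambda>\<theta>. cis (2 * t * (cos \<theta> - 1) + of_int (k + 1) * \<theta>))
        + integral I (\<lambda>\<theta>. cis (2 * t * (cos \<theta> - 1) + of_int (k - 1) * \<theta>)) - 2 * integral I (f t))"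
    using i by (simp add: integral_add integral_diff integrable_add integrable_on_cmult_left del: of_int_add of_int_diff)
  finally have "integral I (\<lambda>\<theta>. \<i> * of_real (2 * (cos \<theta> - 1)) * f t \<theta>) / of_real (2 * pi) =
     \<i> * (lattice_kernel t (k + 1) + lattice_kernel t (k - 1) - 2 * lattice_kernel t k)"
    unfolding lattice_kernel_def I_def f_def[abs_def] cbox_interval
    by (simp only: add_divide_distrib diff_divide_distrib times_divide_eq_right[symmetric])
  with d show ?thesis
    by (simp add: lattice_kernel_def I_def f_def[abs_def] cbox_interval has_vector_derivative_at_within)
qed

lemma sin_ge_half:
  assumes "0 \<le> x" "x \<le> (1::real)"
  shows "x / 2 \<le> sin x"
proof -
  have "sin 0 - 0 / 2 \<le> sin x - x / 2"
    using assms(1)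
  proof (rule DERIV_nonneg_imp_nondecreasing)
    fix z assume z: "0 \<le> z" "z \<le> x"
    have "cos (pi/3) \<le> cos z" using z assms pi_gt3 by (intro cos_monotone_0_pi_le) auto
    then show "\<exists>D. ((\<lambda>x. sin x - x / 2) has_real_derivative D) (at z) \<and> 0 \<le> D"
      by (intro exI[of _ "cos z - 1/2"]) (auto intro!: derivative_eq_intros simp: cos_60)
  qed
  then show ?thesis by simp
qed

text \<open>The third derivative of the phase does not vanish where the second one does, whence the
  exponent \<open>1/3\<close>: remove neighbourhoods of size \<open>t powr (-1/3)\<close> of the zeros of the cosine.\<close>

lemma lattice_kernel_decay_aux:
  assumes t: "t \<ge> 1"
  shows "norm (lattice_kernel t k) \<le> 4 * t powr (-1/3)"
proof -
  define \<delta> where "\<delta> = t powr (-1/3)"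
  define \<mu> where "\<mu> = t powr (1/3)"
  have \<delta>: "0 < \<delta>" "\<delta> \<le> 1" and \<mu>: "\<mu> > 0"
    using t powr_mono[of "-1/3" 0 t] by (auto simp: \<delta>_def \<mu>_def)
  \<comment> \<open>This balances the pieces: away from the zeros the second derivative of the phase
    is at least 2 t sin \<delta> >= t \<delta> = \<mu>^2, and 1/\<mu> = \<delta>. The five pieces
    contribute (1 + 10 + 2 + 10 + 1) \<delta>, and 24/(2 pi) <= 4.\<close>
  have \<mu>2: "\<mu>\<^sup>2 = t * \<delta>"
    using t powr_mult_base[of t "-1/3"] by (simp add: \<mu>_def \<delta>_def power2_eq_square powr_add[symmetric])
  have inv: "1 / \<mu> = \<delta>" by (simp add: \<mu>_def \<delta>_def powr_minus_divide)
  have s\<delta>: "t * \<delta> \<le> 2 * t * sin \<delta>" using sin_ge_half[of \<delta>] \<delta> t by simp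
  define \<phi> where "\<phi> \<theta> = 2 * t * (cos \<theta> - 1) + of_int k * \<theta>" for \<theta>
  define \<psi> where "\<psi> \<theta> = - 2 * t * sin \<theta> + of_int k" for \<theta>
  define \<omega> where "\<omega> \<theta> = - 2 * t * cos \<theta>" for \<theta>
  have D: "(\<phi> has_real_derivative \<psi> x) (at x)" "(\<psi> has_real_derivative \<omega> x) (at x)" for x
    unfolding \<phi>_def \<psi>_def \<omega>_def by (auto intro!: derivative_eq_intros)
  have c: "continuous_on UNIV \<omega>" "continuous_on S \<phi>" for S
    unfolding \<omega>_def \<phi>_def by (intro continuous_intros)+
  define f where "f \<theta> = cis (\<phi> \<theta>)" for \<theta>
  have int: "f integrable_on {x..y}" for x y
    unfolding f_def by (intro integrable_continuous_real continuous_intros c)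
  have cos1: "cos x \<ge> sin \<delta>" if "- pi/2 + \<delta> \<le> x" "x \<le> pi/2 - \<delta>" for x
  proof -
    have "cos (pi/2 - \<delta>) \<le> cos \<bar>x\<bar>"
      using that \<delta> pi_gt3 by (intro cos_monotone_0_pi_le) auto
    then show ?thesis by (simp add: cos_diff)
  qed
  have v1: "norm (integral {-pi/2 + \<delta>..pi/2 - \<delta>} f) \<le> 10 / \<mu>"
    unfolding f_def
  proof (rule van_der_corput_second_neg[OF _ D c(1) \<mu>])
    fix x assume "x \<in> {- pi/2 + \<delta>..pi/2 - \<delta>}"
    then have "2 * t * sin \<delta> \<le> 2 * t * cos x" using cos1 t by (intro mult_left_mono) auto
    then show "\<omega> x \<le> - \<mu>\<^sup>2" using s\<delta> by (simp add: \<omega>_def \<mu>2)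
  qed (use \<delta> pi_gt3 in auto)
  have v2: "norm (integral {pi/2 + \<delta>..3*pi/2 - \<delta>} f) \<le> 10 / \<mu>"
    unfolding f_def
  proof (rule van_der_corput_second[OF _ D c(1) \<mu>])
    fix x assume "x \<in> {pi/2 + \<delta>..3*pi/2 - \<delta>}"
    then have "sin \<delta> \<le> cos (x - pi)" by (intro cos1) auto
    then have "2 * t * sin \<delta> \<le> 2 * t * (- cos x)" using t by (intro mult_left_mono) (auto simp: cos_diff)
    then show "\<mu>\<^sup>2 \<le> \<omega> x" using s\<delta> by (simp add: \<omega>_def \<mu>2)
  qed (use \<delta> pi_gt3 in auto)
  have tr: "norm (integral {x..y} f) \<le> y - x" if "x \<le> y" for x y
    unfolding f_def by (rule cis_integral_bound_trivial[OF that c(2)])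
  note comb = Henstock_Kurzweil_Integration.integral_combine[OF _ _ int]
  have "integral {-pi/2..3*pi/2} f = integral {-pi/2..-pi/2+\<delta>} f + (integral {-pi/2+\<delta>..pi/2-\<delta>} f
     + (integral {pi/2-\<delta>..pi/2+\<delta>} f + (integral {pi/2+\<delta>..3*pi/2-\<delta>} f + integral {3*pi/2-\<delta>..3*pi/2} f)))"
    using \<delta> pi_gt3 by (subst comb | simp)+
  then have "norm (integral {-pi/2..3*pi/2} f) \<le> norm (integral {-pi/2..-pi/2+\<delta>} f) + (norm (integral {-pi/2+\<delta>..pi/2-\<delta>} f)
     + (norm (integral {pi/2-\<delta>..pi/2+\<delta>} f) + (norm (integral {pi/2+\<delta>..3*pi/2-\<delta>} f) + norm (integral {3*pi/2-\<delta>..3*pi/2} f))))"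
    by (simp only:) (intro order_trans[OF norm_triangle_ineq] add_left_mono order_refl)
  also have "\<dots> \<le> \<delta> + (10 / \<mu> + (2 * \<delta> + (10 / \<mu> + \<delta>)))"
    using tr[of "-pi/2" "-pi/2+\<delta>"] tr[of "pi/2-\<delta>" "pi/2+\<delta>"] tr[of "3*pi/2-\<delta>" "3*pi/2"] v1 v2 \<delta>
    by (intro add_mono) auto
  also have "\<dots> = 24 * \<delta>" using inv by (simp add: field_simps)
  finally have "norm (lattice_kernel t k) \<le> 24 * \<delta> / (2 * pi)"
    unfolding lattice_kernel_def f_def[abs_def] \<phi>_def[abs_def] norm_divide norm_of_real
    using \<delta> by (intro frac_le) auto
  also have "\<dots> \<le> 24 * \<delta> / (2 * 3)" using pi_gt3 \<delta> by (intro divide_left_mono) auto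
  finally show ?thesis by (simp add: \<delta>_def)
qed

text \<open>For small t the trivial bound 1 takes over. Using 1 + t removes the singularity at t =
  0, which would otherwise have to be handled in the time convolutions. For t >= 1 the change costs
  the factor 2^(1/3) <= 2.\<close>

lemma lattice_kernel_decay:
  assumes t: "t \<ge> 0"
  shows "norm (lattice_kernel t k) \<le> 8 * (1 + t) powr (-1/3)"
proof (cases "t \<ge> 1")
  case True
  have "t powr (-1/3) \<le> ((1 + t) / 2) powr (-1/3)"
    using True by (intro powr_mono2') auto
  also have "\<dots> = (1 + t) powr (-1/3) * 2 powr (1/3)"
    using True by (simp add: powr_divide powr_minus field_simps)
  also have "\<dots> \<le> (1 + t) powr (-1/3) * 2"
    using powr_mono[of "1/3" 1 "2::real"] by (intro mult_left_mono) auto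
  finally show ?thesis using lattice_kernel_decay_aux[OF True, of k] by linarith
next
  case False
  have "1 = 8 * 8 powr (-1::real)" by (simp add: powr_minus)
  also have "\<dots> \<le> 8 * 2 powr (-1/3)" 
  proof -
    have "(8::real) powr (-1) \<le> 2 powr (-1)" by (simp add: powr_minus)
    also have "\<dots> \<le> 2 powr (-1/3)" by (intro powr_mono) auto
    finally show ?thesis by simp
  qed
  also have "\<dots> \<le> 8 * (1 + t) powr (-1/3)"
    using False t by (intro mult_left_mono powr_mono2') auto
  finally show ?thesis using lattice_kernel_le_1[of t k] by linarith
qed

section \<open>The lattice\<close>

lemma lp_le_laplacian:
  fixes v :: "int ^ 'd::finite \<Rightarrow> complex"
  assumes v: "lp_le p v A" and p: "p \<ge> 1"
  shows "lp_le p (discrete_laplacian v) (4 * real CARD('d) * A)"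
proof -
  have "lp_le p (\<lambda>n. v (n + axis j 1) + v (n - axis j 1) + (-2) * v n) (A + A + norm (-2::complex) * A)" for j
    by (intro lp_le_add_ge_1 lp_le_cmult lp_le_reindex[OF v] v p) (auto simp: inj_def)
  then have "lp_le p (\<lambda>n. \<Sum>j\<in>UNIV. v (n + axis j 1) + v (n - axis j 1) + (-2) * v n) (\<Sum>j\<in>(UNIV::'d set). A + A + norm (-2::complex) * A)"
    by (intro lp_le_sum_family p) auto
  then show ?thesis by (simp add: discrete_laplacian_def[abs_def] mult_ac)
qed

lemma discrete_laplacian_sum:
  "discrete_laplacian (\<lambda>n. \<Sum>k\<in>K. v k n) n = (\<Sum>k\<in>K. discrete_laplacian (v k) n)"
  unfolding discrete_laplacian_def
  by (subst sum.swap) (simp add: sum.distrib sum_subtractf sum_distrib_left)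

lemma discrete_laplacian_cmult:
  "discrete_laplacian (\<lambda>n. c * v n) n = c * discrete_laplacian v n"
  unfolding discrete_laplacian_def by (simp add: sum_distrib_left algebra_simps)

lemma discrete_laplacian_diff:
  "discrete_laplacian (\<lambda>n. v n - w n) n = discrete_laplacian v n - discrete_laplacian w n"
  unfolding discrete_laplacian_def by (simp add: sum_subtractf[symmetric] algebra_simps)

lemma discrete_laplacian_cnj:
  "discrete_laplacian (\<lambda>n. cnj (v n)) n = cnj (discrete_laplacian v n)"
  unfolding discrete_laplacian_def by simp

lemma continuous_on_discrete_laplacian:
  assumes "\<And>n. continuous_on S (\<lambda>t. v t n)"
  shows "continuous_on S (\<lambda>t. discrete_laplacian (v t) n)"
  unfolding discrete_laplacian_def by (intro continuous_intros assms)

text \<open>A sequence of finite sets in place of the net of all finite subsets, since dominated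
  convergence works along sequences.\<close>

definition exhaust :: "nat \<Rightarrow> 'a::countable set" where
  "exhaust k = {n. to_nat n < k}"

lemma finite_exhaust: "finite (exhaust k)"
proof -
  have "finite (to_nat ` (exhaust k :: 'a set))"
    by (rule finite_subset[of _ "{..<k}"]) (auto simp: exhaust_def)
  then show ?thesis by (rule finite_imageD) simp
qed

lemma filterlim_exhaust: "filterlim exhaust (finite_subsets_at_top (UNIV :: 'a::countable set)) sequentially"
  unfolding filterlim_finite_subsets_at_top
proof (intro allI impI)
  fix X :: "'a set" assume X: "finite X \<and> X \<subseteq> UNIV"
  show "\<forall>\<^sub>F k in sequentially. finite (exhaust k :: 'a set) \<and> X \<subseteq> exhaust k \<and> exhaust k \<subseteq> (UNIV :: 'a set)"
    using eventually_gt_at_top[of "Max (insert 0 (to_nat ` X))"]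
  proof eventually_elim
    case (elim k)
    then show ?case using X finite_exhaust[of k] by (auto simp: exhaust_def)
  qed
qed

lemma infsum_exhaust_limit:
  fixes f :: "'a::countable \<Rightarrow> 'b::real_normed_vector"
  assumes "f summable_on UNIV"
  shows "(\<lambda>k. \<Sum>n\<in>exhaust k. f n) \<longlonglongrightarrow> infsum f UNIV"
proof -
  have "(f has_sum infsum f UNIV) UNIV" using assms by simp
  then have "((\<lambda>X. sum f X) \<longlongrightarrow> infsum f UNIV) (finite_subsets_at_top UNIV)" by (simp add: has_sum_def)
  from filterlim_compose[OF this filterlim_exhaust] show ?thesis .
qed

lemma holder_infsum:
  fixes v w :: "'a \<Rightarrow> complex"
  assumes v: "lp_le p v A" and w: "lp_le q w B" and pq: "p > 1" "q > 1" "1/p + 1/q = 1"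
  shows "(\<lambda>n. v n * w n) summable_on UNIV" "norm (\<Sum>\<^sub>\<infinity>n. v n * w n) \<le> A * B"
proof -
  have b: "(\<Sum>n\<in>F. norm (v n * w n)) \<le> A * B" if "finite F" for F
    using holder_lp_le[OF v w pq that] by (simp add: norm_mult)
  have abs: "(\<lambda>n. norm (v n * w n)) summable_on UNIV"
    by (rule nonneg_bdd_above_summable_on) (use b in \<open>auto simp: bdd_above_def\<close>)
  then show "(\<lambda>n. v n * w n) summable_on UNIV" by (rule abs_summable_summable)
  have "norm (\<Sum>\<^sub>\<infinity>n. v n * w n) \<le> (\<Sum>\<^sub>\<infinity>n. norm (v n * w n))" by (rule norm_infsum_bound) fact
  also have "\<dots> \<le> A * B" using abs by (rule infsum_le_finite_sums) (use b in auto)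
  finally show "norm (\<Sum>\<^sub>\<infinity>n. v n * w n) \<le> A * B" .
qed

lemmas cauchy_schwarz_infsum = holder_infsum[where p = 2 and q = 2, simplified]

lemma has_sum_finite_sum:
  fixes f :: "'b \<Rightarrow> 'a \<Rightarrow> 'c::{topological_comm_monoid_add}"
  assumes "finite J" "\<And>j. j \<in> J \<Longrightarrow> (f j has_sum s j) A"
  shows "((\<lambda>n. \<Sum>j\<in>J. f j n) has_sum (\<Sum>j\<in>J. s j)) A"
  using assms by (induction J rule: finite_induct) (auto intro!: has_sum_add)

text \<open>Shifting the summation index moves each translation to the other factor. The pairing is
  bilinear, without conjugation.\<close>

lemma infsum_laplacian_symmetric:
  fixes x u :: "int ^ 'd::finite \<Rightarrow> complex"
  assumes x: "lp_le 2 x X" and u: "lp_le 2 u U"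
  shows "(\<Sum>\<^sub>\<infinity>n. x n * discrete_laplacian u n) = (\<Sum>\<^sub>\<infinity>n. discrete_laplacian x n * u n)"
proof -
  have sh: "lp_le 2 (\<lambda>n. v (n + e)) V" if "lp_le 2 v V" for v :: "int ^ 'd \<Rightarrow> complex" and V e
    by (rule lp_le_reindex[OF that]) (auto simp: inj_def)
  have s: "(\<lambda>n. x (n + e) * u (n + e')) summable_on UNIV" for e e'
    by (rule cauchy_schwarz_infsum(1)[OF sh[OF x] sh[OF u]])
  have s1: "(\<lambda>n. x n * u (n + e')) summable_on UNIV" "(\<lambda>n. x n * u n) summable_on UNIV"
      "(\<lambda>n. x (n + e) * u n) summable_on UNIV" for e e'
    using s[of 0 e'] s[of 0 0] s[of e 0] by simp_all
  have shift: "(\<Sum>\<^sub>\<infinity>n. x n * u (n + e)) = (\<Sum>\<^sub>\<infinity>n. x (n - e) * u n)" for e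
    by (rule infsum_reindex_bij_witness[of _ "\<lambda>n. n - e" "\<lambda>n. n + e"]) auto
  have 1: "((\<lambda>n. x n * discrete_laplacian u n) has_sum
      (\<Sum>j\<in>UNIV. (\<Sum>\<^sub>\<infinity>n. x n * u (n + axis j 1)) + (\<Sum>\<^sub>\<infinity>n. x n * u (n + (- axis j 1))) + (-2) * (\<Sum>\<^sub>\<infinity>n. x n * u n))) UNIV"
  proof -
    have "((\<lambda>n. \<Sum>j\<in>UNIV. x n * u (n + axis j 1) + x n * u (n + (- axis j 1)) + (-2) * (x n * u n)) has_sum
      (\<Sum>j\<in>UNIV. (\<Sum>\<^sub>\<infinity>n. x n * u (n + axis j 1)) + (\<Sum>\<^sub>\<infinity>n. x n * u (n + (- axis j 1))) + (-2) * (\<Sum>\<^sub>\<infinity>n. x n * u n))) UNIV"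
      by (intro has_sum_finite_sum finite has_sum_add has_sum_cmult_right has_sum_infsum s1)
    then show ?thesis by (simp add: discrete_laplacian_def sum_distrib_left algebra_simps)
  qed
  have 2: "((\<lambda>n. discrete_laplacian x n * u n) has_sum
      (\<Sum>j\<in>UNIV. (\<Sum>\<^sub>\<infinity>n. x (n + axis j 1) * u n) + (\<Sum>\<^sub>\<infinity>n. x (n + (- axis j 1)) * u n) + (-2) * (\<Sum>\<^sub>\<infinity>n. x n * u n))) UNIV"
  proof -
    have "((\<lambda>n. \<Sum>j\<in>UNIV. x (n + axis j 1) * u n + x (n + (- axis j 1)) * u n + (-2) * (x n * u n)) has_sum
      (\<Sum>j\<in>UNIV. (\<Sum>\<^sub>\<infinity>n. x (n + axis j 1) * u n) + (\<Sum>\<^sub>\<infinity>n. x (n + (- axis j 1)) * u n) + (-2) * (\<Sum>\<^sub>\<infinity>n. x n * u n))) UNIV"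
      by (intro has_sum_finite_sum finite has_sum_add has_sum_cmult_right has_sum_infsum s1)
    then show ?thesis by (simp add: discrete_laplacian_def sum_distrib_left algebra_simps)
  qed
  show ?thesis unfolding infsumI[OF 1] infsumI[OF 2] shift by (simp add: add.commute)
qed

text \<open>The common source of mass conservation and Duhamel's formula. As \<open>x\<close>
  follows the backward and \<open>u\<close> the forward equation, the two Laplacian terms in the
  derivative of the pairing cancel and only the sources \<open>a\<close> and \<open>b\<close>
  remain.\<close>

lemma has_integral_pairing:
  fixes x u a b :: "real \<Rightarrow> int ^ 'd::finite \<Rightarrow> complex"
  assumes T: "0 \<le> T"
    and dx: "\<And>t n. t \<in> {0..T} \<Longrightarrow> ((\<lambda>\<tau>. x \<tau> n) has_vector_derivative (b t n - \<i> * discrete_laplacian (x t) n)) (at t within {0..T})"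
    and du: "\<And>t n. t \<in> {0..T} \<Longrightarrow> ((\<lambda>\<tau>. u \<tau> n) has_vector_derivative (a t n + \<i> * discrete_laplacian (u t) n)) (at t within {0..T})"
    and x: "\<And>t. t \<in> {0..T} \<Longrightarrow> lp_le 2 (x t) X" and u: "\<And>t. t \<in> {0..T} \<Longrightarrow> lp_le 2 (u t) U"
    and a: "\<And>t. t \<in> {0..T} \<Longrightarrow> lp_le 2 (a t) A" and b: "\<And>t. t \<in> {0..T} \<Longrightarrow> lp_le 2 (b t) B"
  shows "((\<lambda>t. (\<Sum>\<^sub>\<infinity>n. x t n * a t n) + (\<Sum>\<^sub>\<infinity>n. b t n * u t n)) has_integral
     (\<Sum>\<^sub>\<infinity>n. x T n * u T n) - (\<Sum>\<^sub>\<infinity>n. x 0 n * u 0 n)) {0..T}"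
proof -
  define D where "D = 4 * real CARD('d)"
  have lapu: "lp_le 2 (\<lambda>n. \<i> * discrete_laplacian (u t) n) (D * U)" if "t \<in> {0..T}" for t
    using lp_le_cmult[OF lp_le_laplacian[OF u[OF that]], of \<i>] by (simp add: D_def)
  have lapx: "lp_le 2 (\<lambda>n. - \<i> * discrete_laplacian (x t) n) (D * X)" if "t \<in> {0..T}" for t
    using lp_le_cmult[OF lp_le_laplacian[OF x[OF that]], of "-\<i>"] by (simp add: D_def)
  have du': "lp_le 2 (\<lambda>n. a t n + \<i> * discrete_laplacian (u t) n) (A + D * U)" if "t \<in> {0..T}" for t
    by (rule lp_le_add[OF a[OF that] lapu[OF that]]) simp
  have dx': "lp_le 2 (\<lambda>n. b t n - \<i> * discrete_laplacian (x t) n) (B + D * X)" if "t \<in> {0..T}" for t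
    using lp_le_add[OF b[OF that] lapx[OF that]] by simp
  \<comment> \<open>The derivative of the product at one site. The Laplacian terms cancel only after
    summation over the whole lattice, hence the finite sums first and the limit afterwards.\<close>
  define r where "r t n = x t n * (a t n + \<i> * discrete_laplacian (u t) n) +
      (b t n - \<i> * discrete_laplacian (x t) n) * u t n" for t n
  have csum: "(\<lambda>n. x t n * (a t n + \<i> * discrete_laplacian (u t) n)) summable_on UNIV"
     "(\<lambda>n. (b t n - \<i> * discrete_laplacian (x t) n) * u t n) summable_on UNIV"
     "(\<lambda>n. x t n * a t n) summable_on UNIV" "(\<lambda>n. b t n * u t n) summable_on UNIV"
     "(\<lambda>n. x t n * discrete_laplacian (u t) n) summable_on UNIV"
     "(\<lambda>n. discrete_laplacian (x t) n * u t n) summable_on UNIV" if t: "t \<in> {0..T}" for t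
    by (rule cauchy_schwarz_infsum(1)[OF x[OF t] du'[OF t]] cauchy_schwarz_infsum(1)[OF dx'[OF t] u[OF t]]
        cauchy_schwarz_infsum(1)[OF x[OF t] a[OF t]] cauchy_schwarz_infsum(1)[OF b[OF t] u[OF t]]
        cauchy_schwarz_infsum(1)[OF x[OF t] lp_le_laplacian[OF u[OF t]]]
        cauchy_schwarz_infsum(1)[OF lp_le_laplacian[OF x[OF t]] u[OF t]]; simp)+
  show ?thesis
  proof (rule has_integral_dominated_convergence)
    fix k :: nat
    show "((\<lambda>t. \<Sum>n\<in>exhaust k. r t n) has_integral
       (\<Sum>n\<in>exhaust k. x T n * u T n) - (\<Sum>n\<in>exhaust k. x 0 n * u 0 n)) {0..T}"
    proof (rule fundamental_theorem_of_calculus[OF T])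
      fix t assume t: "t \<in> {0..T}"
      have "((\<lambda>\<tau>. x \<tau> n * u \<tau> n) has_vector_derivative r t n) (at t within {0..T})" for n
        unfolding r_def by (intro has_vector_derivative_mult dx du t)
      then show "((\<lambda>t. \<Sum>n\<in>exhaust k. x t n * u t n) has_vector_derivative (\<Sum>n\<in>exhaust k. r t n)) (at t within {0..T})"
        by (intro has_vector_derivative_sum)
    qed
    \<comment> \<open>A majorant independent of k and t, from Cauchy-Schwarz and the boundedness of
      the Laplacian on l^2.\<close>
    show "\<forall>t\<in>{0..T}. norm (\<Sum>n\<in>exhaust k. r t n) \<le> X * (A + D * U) + (B + D * X) * U"
    proof
      fix t assume t: "t \<in> {0..T}"
      have "norm (\<Sum>n\<in>exhaust k. r t n) \<le> (\<Sum>n\<in>exhaust k. norm (x t n) * norm (a t n + \<i> * discrete_laplacian (u t) n))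
         + (\<Sum>n\<in>exhaust k. norm (b t n - \<i> * discrete_laplacian (x t) n) * norm (u t n))"
        unfolding r_def sum.distrib[symmetric]
        by (intro order_trans[OF norm_sum] sum_mono order_trans[OF norm_triangle_ineq]) (simp add: norm_mult)
      also have "\<dots> \<le> X * (A + D * U) + (B + D * X) * U"
        by (intro add_mono holder_lp_le[OF x[OF t] du'[OF t]] holder_lp_le[OF dx'[OF t] u[OF t]] finite_exhaust) auto
      finally show "norm (\<Sum>n\<in>exhaust k. r t n) \<le> X * (A + D * U) + (B + D * X) * U" .
    qed
  next
    show "(\<lambda>_. X * (A + D * U) + (B + D * X) * U) integrable_on {0..T}" by (rule integrable_const_ivl)
    show "\<forall>t\<in>{0..T}. (\<lambda>k. \<Sum>n\<in>exhaust k. r t n) \<longlonglongrightarrow> (\<Sum>\<^sub>\<infinity>n. x t n * a t n) + (\<Sum>\<^sub>\<infinity>n. b t n * u t n)"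
    proof
      fix t assume t: "t \<in> {0..T}"
      have "(\<lambda>k. \<Sum>n\<in>exhaust k. r t n) \<longlonglongrightarrow> (\<Sum>\<^sub>\<infinity>n. r t n)"
        unfolding r_def by (intro infsum_exhaust_limit summable_on_add csum t)
      also have "(\<Sum>\<^sub>\<infinity>n. r t n) = (\<Sum>\<^sub>\<infinity>n. (x t n * a t n + b t n * u t n) +
          \<i> * (x t n * discrete_laplacian (u t) n + (-1) * (discrete_laplacian (x t) n * u t n)))"
        by (intro infsum_cong) (simp add: r_def algebra_simps)
      also have "\<dots> = ((\<Sum>\<^sub>\<infinity>n. x t n * a t n) + (\<Sum>\<^sub>\<infinity>n. b t n * u t n)) +
          \<i> * ((\<Sum>\<^sub>\<infinity>n. x t n * discrete_laplacian (u t) n) + (-1) * (\<Sum>\<^sub>\<infinity>n. discrete_laplacian (x t) n * u t n))"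
        by (intro infsumI has_sum_add has_sum_cmult_right has_sum_infsum csum t)
      also have "\<dots> = (\<Sum>\<^sub>\<infinity>n. x t n * a t n) + (\<Sum>\<^sub>\<infinity>n. b t n * u t n)"
        using infsum_laplacian_symmetric[OF x[OF t] u[OF t]] by simp
      finally show "(\<lambda>k. \<Sum>n\<in>exhaust k. r t n) \<longlonglongrightarrow> (\<Sum>\<^sub>\<infinity>n. x t n * a t n) + (\<Sum>\<^sub>\<infinity>n. b t n * u t n)" .
    qed
    show "(\<lambda>k. (\<Sum>n\<in>exhaust k. x T n * u T n) - (\<Sum>n\<in>exhaust k. x 0 n * u 0 n)) \<longlonglongrightarrow>
       (\<Sum>\<^sub>\<infinity>n. x T n * u T n) - (\<Sum>\<^sub>\<infinity>n. x 0 n * u 0 n)"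
      using T by (intro tendsto_diff infsum_exhaust_limit cauchy_schwarz_infsum(1)[OF x u]) auto
  qed
qed

section \<open>Linear Schroedinger equations with a potential\<close>

text \<open>The second clause fixes the class in which the Cauchy problem has unique solutions for
  locally bounded \<open>V\<close>; it also justifies the l^2 pairings.\<close>

definition schrodinger :: "(real \<Rightarrow> int ^ 'd::finite \<Rightarrow> real) \<Rightarrow> (real \<Rightarrow> int ^ 'd \<Rightarrow> complex) \<Rightarrow> bool" where
  "schrodinger V v \<longleftrightarrow>
     (\<forall>t\<ge>0. \<forall>n. ((\<lambda>\<tau>. v \<tau> n) has_vector_derivative \<i> * (discrete_laplacian (v t) n + of_real (V t n) * v t n)) (at t within {0..})) \<and>
     (\<forall>T. \<exists>B. \<forall>t\<in>{0..T}. lp_le 2 (v t) B)"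

definition locally_bounded_potential :: "(real \<Rightarrow> 'a \<Rightarrow> real) \<Rightarrow> bool" where
  "locally_bounded_potential V \<longleftrightarrow> (\<forall>n. continuous_on {0..} (\<lambda>t. V t n)) \<and> (\<forall>T. \<exists>B. \<forall>t\<in>{0..T}. \<forall>n. \<bar>V t n\<bar> \<le> B)"

text \<open>The terms of the Dyson series, that is the iterated time integrals of i(\<Delta> +
  V).\<close>

primrec picard_term :: "(real \<Rightarrow> int ^ 'd::finite \<Rightarrow> real) \<Rightarrow> (int ^ 'd \<Rightarrow> complex) \<Rightarrow> nat \<Rightarrow> real \<Rightarrow> int ^ 'd \<Rightarrow> complex" where
  "picard_term V f 0 = (\<lambda>t n. f n)"
| "picard_term V f (Suc k) = (\<lambda>t n. integral {0..t} (\<lambda>s. \<i> * (discrete_laplacian (picard_term V f k s) n + of_real (V s n) * picard_term V f k s n)))"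

lemma at_within_Icc_eq_Ici: "t < T \<Longrightarrow> at t within {0..T} = at t within {0..}" for t T :: real
  by (rule at_within_nhd[of _ "{..<T}"]) auto

lemma lp_le_potential:
  assumes "lp_le p w A" "p \<ge> 1" "\<And>n. \<bar>V n\<bar> \<le> B" "B \<ge> 0"
  shows "lp_le p (\<lambda>n. of_real (V n) * w n) (B * A)"
proof -
  have "lp_le p (\<lambda>n. of_real B * w n) (B * A)" using lp_le_cmult[OF assms(1), of "of_real B"] assms by simp
  then show ?thesis
    by (rule lp_le_dominated) (use assms in \<open>auto simp: norm_mult intro!: mult_right_mono\<close>)
qed

lemma lp_le_hamiltonian:
  fixes w :: "int ^ 'd::finite \<Rightarrow> complex"
  assumes "lp_le p w A" "p \<ge> 1" "\<And>n. \<bar>V n\<bar> \<le> B" "B \<ge> 0"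
  shows "lp_le p (\<lambda>n. \<i> * (discrete_laplacian w n + of_real (V n) * w n)) ((4 * real CARD('d) + B) * A)"
proof -
  have "lp_le p (\<lambda>n. discrete_laplacian w n + of_real (V n) * w n) (4 * real CARD('d) * A + B * A)"
    by (intro lp_le_add_ge_1 lp_le_laplacian lp_le_potential assms)
  from lp_le_cmult[OF this, of \<i>] show ?thesis by (simp add: ring_distribs)
qed

lemma continuous_on_hamiltonian:
  assumes "\<And>n. continuous_on S (\<lambda>t. w t n)" "\<And>n. continuous_on S (\<lambda>t. V t n)"
  shows "continuous_on S (\<lambda>t. \<i> * (discrete_laplacian (w t) n + of_real (V t n) * w t n))"
  by (intro continuous_intros continuous_on_discrete_laplacian assms)

lemma continuous_on_picard_term:
  assumes "\<And>n. continuous_on {0..T} (\<lambda>t. V t n)"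
  shows "continuous_on {0..T} (\<lambda>t. picard_term V f k t n)"
proof (induction k arbitrary: n)
  case (Suc k)
  show ?case unfolding picard_term.simps
    by (intro indefinite_integral_continuous_1 integrable_continuous_real continuous_on_hamiltonian Suc assms)
qed simp

lemma has_integral_power_fact:
  fixes t :: real
  assumes "0 \<le> t"
  shows "((\<lambda>s. L * (A * (L * s) ^ k / fact k)) has_integral A * (L * t) ^ Suc k / fact (Suc k)) {0..t}"
proof -
  have "((\<lambda>s. L * (A * (L * s) ^ k / fact k)) has_integral A * (L * t) ^ Suc k / fact (Suc k) - A * (L * 0) ^ Suc k / fact (Suc k)) {0..t}"
  proof (rule fundamental_theorem_of_calculus[OF assms])
    fix x assume "x \<in> {0..t}"
    have "((\<lambda>s. L * s) has_real_derivative L) (at x within {0..t})" by (auto intro!: derivative_eq_intros)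
    then have "((\<lambda>s. A * (L * s) ^ Suc k / fact (Suc k)) has_real_derivative A * ((1 + real k) * (L * (L * x) ^ k)) / fact (Suc k)) (at x within {0..t})"
      by (intro DERIV_cdivide DERIV_cmult DERIV_power_Suc)
    also have "A * ((1 + real k) * (L * (L * x) ^ k)) / fact (Suc k) = L * (A * (L * x) ^ k / fact k)"
    proof -
      have "fact (Suc k) = (1 + real k) * fact k" "1 + real k \<noteq> 0" by simp_all
      then show ?thesis by (simp only: mult.left_commute[of A "1 + real k"] nonzero_mult_divide_mult_cancel_left) (simp add: mult_ac)
    qed
    finally have "((\<lambda>s. A * (L * s) ^ Suc k / fact (Suc k)) has_real_derivative L * (A * (L * x) ^ k / fact k)) (at x within {0..t})" .
    then show "((\<lambda>s. A * (L * s) ^ Suc k / fact (Suc k)) has_vector_derivative L * (A * (L * x) ^ k / fact k)) (at x within {0..t})"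
      by (simp add: has_real_derivative_iff_has_vector_derivative)
  qed
  then show ?thesis by simp
qed

text \<open>The estimate is made in l^1, where passing the norm under the time integral is just an
  exchange with a finite sum. Each integration contributes the operator bound 4d + B and one more
  power of t over the factorial.\<close>

lemma lp_le_picard_term:
  fixes f :: "int ^ 'd::finite \<Rightarrow> complex"
  assumes cont: "\<And>n. continuous_on {0..T} (\<lambda>t. V t n)" and bdd: "\<And>t n. t \<in> {0..T} \<Longrightarrow> \<bar>V t n\<bar> \<le> B" "B \<ge> 0"
    and f: "lp_le 1 f A" and t: "t \<in> {0..T}"
  shows "lp_le 1 (picard_term V f k t) (A * ((4 * real CARD('d) + B) * t) ^ k / fact k)"
  using t
proof (induction k arbitrary: t)
  case 0
  then show ?case using f by simp
next
  case (Suc k)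
  define L where "L = 4 * real CARD('d) + B"
  have A: "A \<ge> 0" and L: "L \<ge> 0" using f bdd(2) by (auto intro: lp_le_nonneg simp: L_def)
  define h where "h s n = \<i> * (discrete_laplacian (picard_term V f k s) n + of_real (V s n) * picard_term V f k s n)" for s n
  have ch: "continuous_on {0..t} (\<lambda>s. h s n)" for n
    unfolding h_def
    by (rule continuous_on_subset[of "{0..T}"], intro continuous_on_hamiltonian continuous_on_picard_term cont) (use Suc.prems in auto)
  have hb: "lp_le 1 (h s) (L * (A * (L * s) ^ k / fact k))" if "s \<in> {0..t}" for s
    using lp_le_hamiltonian[OF Suc.IH, of s "V s" B] bdd that Suc.prems
    by (simp add: h_def[abs_def] L_def)
  show ?case
    unfolding lp_le_def
  proof (intro conjI allI impI)
    show "0 \<le> A * ((4 * real CARD('d) + B) * t) ^ Suc k / fact (Suc k)" using A L Suc.prems by (simp add: L_def[symmetric])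
    fix F :: "(int ^ 'd) set" assume F: "finite F"
    have "(\<Sum>n\<in>F. norm (picard_term V f (Suc k) t n)) \<le> (\<Sum>n\<in>F. integral {0..t} (\<lambda>s. norm (h s n)))"
      by (intro sum_mono) (simp only: picard_term.simps h_def[symmetric],
          intro integral_norm_bound_integral integrable_continuous_real continuous_intros ch order_refl)
    also have "\<dots> = integral {0..t} (\<lambda>s. \<Sum>n\<in>F. norm (h s n))"
      using F by (intro integral_sum[symmetric] integrable_continuous_real continuous_intros ch)
    also have "\<dots> \<le> integral {0..t} (\<lambda>s. L * (A * (L * s) ^ k / fact k))"
    proof (rule integral_le)
      show "(\<lambda>s. \<Sum>n\<in>F. norm (h s n)) integrable_on {0..t}" by (intro integrable_continuous_real continuous_intros ch)
      show "(\<lambda>s. L * (A * (L * s) ^ k / fact k)) integrable_on {0..t}" by (intro integrable_continuous_real continuous_intros) auto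
      fix s assume s: "s \<in> {0..t}"
      show "(\<Sum>n\<in>F. norm (h s n)) \<le> L * (A * (L * s) ^ k / fact k)"
        using lp_le_sum[OF hb[OF s] F] lp_le_nonneg[OF hb[OF s]] by simp
    qed
    also have "\<dots> = A * (L * t) ^ Suc k / fact (Suc k)"
      by (rule integral_unique[OF has_integral_power_fact]) (use Suc.prems in simp)
    finally show "(\<Sum>n\<in>F. norm (picard_term V f (Suc k) t n) powr 1) \<le> (A * ((4 * real CARD('d) + B) * t) ^ Suc k / fact (Suc k)) powr 1"
      using A L Suc.prems by (simp add: L_def del: power_Suc fact_Suc)
  qed
qed

lemma sums_discrete_laplacian:
  assumes "\<And>n. (\<lambda>k. w k n) sums v n"
  shows "(\<lambda>k. discrete_laplacian (w k) n) sums discrete_laplacian v n"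
  unfolding discrete_laplacian_def by (intro sums_sum sums_add sums_diff sums_mult assms)

text \<open>An exponential series majorises the terms and their derivatives uniformly on [0, T],
  which permits differentiation term by term.\<close>

lemma picard_series_local:
  fixes f :: "int ^ 'd::finite \<Rightarrow> complex"
  assumes cont: "\<And>n. continuous_on {0..T} (\<lambda>t. V t n)" and bdd: "\<And>t n. t \<in> {0..T} \<Longrightarrow> \<bar>V t n\<bar> \<le> B" "B \<ge> 0"
    and f: "lp_le 1 f A" and T: "0 \<le> T"
  defines "v \<equiv> \<lambda>t n. \<Sum>k. picard_term V f k t n"
  shows "t \<in> {0..T} \<Longrightarrow> ((\<lambda>\<tau>. v \<tau> n) has_vector_derivative \<i> * (discrete_laplacian (v t) n + of_real (V t n) * v t n)) (at t within {0..T})"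
    and "t \<in> {0..T} \<Longrightarrow> lp_le 1 (v t) (A * exp ((4 * real CARD('d) + B) * T))"
proof -
  define L where "L = 4 * real CARD('d) + B"
  have A: "A \<ge> 0" and L: "L \<ge> 0" using f bdd(2) by (auto intro: lp_le_nonneg simp: L_def)
  define M where "M k = A * (L * T) ^ k / fact k" for k
  have Msums: "M sums (A * exp (L * T))"
    using sums_mult[OF exp_converges[of "L * T"], of A] by (simp add: M_def[abs_def] field_simps)
  have p1: "lp_le 1 (picard_term V f k t) (M k)" if "t \<in> {0..T}" for k t
  proof (rule lp_le_mono_right[OF lp_le_picard_term[OF cont bdd f that]])
    show "A * ((4 * real CARD('d) + B) * t) ^ k / fact k \<le> M k"
      unfolding M_def L_def[symmetric] using that A L
      by (intro divide_right_mono mult_left_mono power_mono) auto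
  qed simp_all
  have sums: "(\<lambda>k. picard_term V f k t n) sums v t n" if "t \<in> {0..T}" for t n
    unfolding v_def
  proof (rule summable_sums, rule summable_comparison_test')
    show "summable M" using Msums by (rule sums_summable)
    show "norm (picard_term V f k t n) \<le> M k" for k using lp_le_pointwise[OF p1[OF that]] by simp
  qed
  show "lp_le 1 (v t) (A * exp ((4 * real CARD('d) + B) * T))" if t: "t \<in> {0..T}"
  proof (rule lp_le_limit)
    show "(\<lambda>N. \<Sum>k<N. picard_term V f k t n) \<longlonglongrightarrow> v t n" for n using sums[OF t] by (simp add: sums_def)
    have m: "(\<Sum>k<N. M k) \<le> A * exp (L * T)" for N
      using sum_le_suminf[OF sums_summable[OF Msums], of "{..<N}"] sums_unique[OF Msums] A L T by (simp add: M_def)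
    have "lp_le 1 (\<lambda>n. \<Sum>k<N. picard_term V f k t n) (\<Sum>k<N. M k)" for N
      by (intro lp_le_sum_family p1 t) auto
    then have "lp_le 1 (\<lambda>n. \<Sum>k<N. picard_term V f k t n) (A * exp (L * T))" for N
      using m by (rule lp_le_mono_right) simp
    then show "\<forall>\<^sub>F N in sequentially. lp_le 1 (\<lambda>n. \<Sum>k<N. picard_term V f k t n) (A * exp ((4 * real CARD('d) + B) * T))"
      by (simp add: L_def)
  qed auto
  define h where "h k t n = \<i> * (discrete_laplacian (picard_term V f k t) n + of_real (V t n) * picard_term V f k t n)" for k t n
  \<comment> \<open>Derivatives are shifted by one index: term k + 1 has derivative
    \<open>h k\<close>, and the constant term 0 contributes nothing.\<close>
  define e where "e k t n = (case k of 0 \<Rightarrow> 0 | Suc k \<Rightarrow> h k t n)" for k t n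
  have de: "((\<lambda>\<tau>. picard_term V f k \<tau> n) has_vector_derivative e k t n) (at t within {0..T})" if "t \<in> {0..T}" for k t n
  proof (cases k)
    case (Suc k')
    show ?thesis unfolding Suc picard_term.simps e_def h_def nat.case
      by (intro integral_has_vector_derivative that continuous_on_hamiltonian continuous_on_picard_term cont)
  qed (simp add: e_def)
  have hsums: "(\<lambda>k. h k t n) sums (\<i> * (discrete_laplacian (v t) n + of_real (V t n) * v t n))" if "t \<in> {0..T}" for t n
    unfolding h_def by (intro sums_mult sums_add sums_discrete_laplacian sums that)
  have esums: "(\<lambda>k. e k t n) sums (\<i> * (discrete_laplacian (v t) n + of_real (V t n) * v t n))" if "t \<in> {0..T}" for t n
    using sums_Suc[of "\<lambda>k. e k t n"] hsums[OF that, of n] by (simp add: e_def)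
  define M' where "M' k = (case k of 0 \<Rightarrow> 0 | Suc k \<Rightarrow> L * M k)" for k
  have M'sum: "summable M'"
    using summable_mult[OF sums_summable[OF Msums], of L]
    by (subst summable_Suc_iff[symmetric]) (simp add: M'_def)
  have eb: "norm (e k t n) \<le> M' k" if "t \<in> {0..T}" for k t n
  proof (cases k)
    case (Suc k')
    have "lp_le 1 (h k' t) (L * M k')"
      unfolding h_def L_def by (intro lp_le_hamiltonian p1 that bdd) auto
    then show ?thesis using lp_le_pointwise[of 1] by (simp add: Suc e_def M'_def)
  qed (simp add: e_def M'_def)
  have unif: "uniform_limit {0..T} (\<lambda>N t. \<Sum>k<N. e k t n) (\<lambda>t. \<i> * (discrete_laplacian (v t) n + of_real (V t n) * v t n)) sequentially" for n
  proof -
    have "uniform_limit {0..T} (\<lambda>N t. \<Sum>k<N. e k t n) (\<lambda>t. \<Sum>k. e k t n) sequentially"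
      by (rule Weierstrass_m_test[OF eb M'sum])
    then show ?thesis
      by (rule uniform_limit_cong'[THEN iffD1, rotated -1]) (use esums in \<open>auto simp: sums_iff\<close>)
  qed
  show "((\<lambda>\<tau>. v \<tau> n) has_vector_derivative \<i> * (discrete_laplacian (v t) n + of_real (V t n) * v t n)) (at t within {0..T})"
    if t: "t \<in> {0..T}"
  proof -
    define g' where "g' t = \<i> * (discrete_laplacian (v t) n + of_real (V t n) * v t n)" for t
    have "\<exists>g. \<forall>x\<in>{0..T}. (\<lambda>k. picard_term V f k x n) sums g x \<and> (g has_derivative (\<lambda>y. y *\<^sub>R g' x)) (at x within {0..T})"
    proof (rule has_derivative_series[where f' = "\<lambda>k x y. y *\<^sub>R e k x n"])
      show "((\<lambda>x. picard_term V f k x n) has_derivative (\<lambda>y. y *\<^sub>R e k x n)) (at x within {0..T})" if "x \<in> {0..T}" for k x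
        using de[OF that] by (simp add: has_vector_derivative_def)
      show "(\<lambda>k. picard_term V f k t n) sums v t n" by (rule sums[OF t])
      fix \<epsilon> :: real assume "\<epsilon> > 0"
      with unif[of n] have "\<forall>\<^sub>F N in sequentially. \<forall>x\<in>{0..T}. dist (\<Sum>k<N. e k x n) (g' x) < \<epsilon>"
        by (auto simp: uniform_limit_iff g'_def)
      then show "\<forall>\<^sub>F N in sequentially. \<forall>x\<in>{0..T}. \<forall>h. norm ((\<Sum>k<N. h *\<^sub>R e k x n) - h *\<^sub>R g' x) \<le> \<epsilon> * norm h"
      proof eventually_elim
        case (elim N)
        show ?case
        proof (intro ballI allI)
          fix x and h :: real assume "x \<in> {0..T}"
          with elim have "norm ((\<Sum>k<N. e k x n) - g' x) \<le> \<epsilon>" by (auto simp: dist_norm intro: less_imp_le)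
          moreover have "(\<Sum>k<N. h *\<^sub>R e k x n) - h *\<^sub>R g' x = h *\<^sub>R ((\<Sum>k<N. e k x n) - g' x)"
            by (simp add: scaleR_sum_right scaleR_diff_right)
          ultimately show "norm ((\<Sum>k<N. h *\<^sub>R e k x n) - h *\<^sub>R g' x) \<le> \<epsilon> * norm h"
            by (simp add: mult.commute[of \<epsilon>] mult_left_mono)
        qed
      qed
    qed (use t in auto)
    then obtain g where g: "\<And>x. x \<in> {0..T} \<Longrightarrow> (\<lambda>k. picard_term V f k x n) sums g x"
        "\<And>x. x \<in> {0..T} \<Longrightarrow> (g has_derivative (\<lambda>y. y *\<^sub>R g' x)) (at x within {0..T})" by blast
    have eq: "g x = v x n" if "x \<in> {0..T}" for x using sums_unique2[OF g(1)[OF that] sums[OF that]] .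
    have "((\<lambda>\<tau>. v \<tau> n) has_derivative (\<lambda>y. y *\<^sub>R g' t)) (at t within {0..T})"
      using has_derivative_transform[OF t _ g(2)[OF t]] eq by simp
    then show ?thesis by (simp add: has_vector_derivative_def g'_def)
  qed
qed

text \<open>The series does not mention T, so the local statements on all intervals concern the same
  function. Data in l^1 cover the finitely supported ones to which existence is applied
  later.\<close>

theorem schrodinger_exists:
  fixes f :: "int ^ 'd::finite \<Rightarrow> complex"
  assumes V: "locally_bounded_potential V" and f: "lp_le 1 f A"
  shows "\<exists>v. schrodinger V v \<and> v 0 = f"
proof -
  define v where "v = (\<lambda>t n. \<Sum>k. picard_term V f k t n)"
  have "((\<lambda>\<tau>. v \<tau> n) has_vector_derivative \<i> * (discrete_laplacian (v t) n + of_real (V t n) * v t n)) (at t within {0..T}) \<and>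
     (\<exists>C. \<forall>t\<in>{0..T}. lp_le 1 (v t) C)"
    if t: "t \<in> {0..T}" for t n T
  proof -
    obtain B where B: "\<And>t n. t \<in> {0..T} \<Longrightarrow> \<bar>V t n\<bar> \<le> B" using V unfolding locally_bounded_potential_def by meson
    then have B0: "B \<ge> 0" using t abs_ge_zero order_trans by blast
    have c: "continuous_on {0..T} (\<lambda>t. V t n)" for n
      using V unfolding locally_bounded_potential_def by (auto intro: continuous_on_subset[of "{0..}"])
    have T: "0 \<le> T" using t by auto
    show ?thesis
      using picard_series_local[where V = V and f = f and T = T and A = A and B = B, OF c B B0 f T] t
      unfolding v_def by blast
  qed
  note loc = this
  have "schrodinger V v"
    unfolding schrodinger_def
  proof (intro conjI allI impI)
    fix t :: real and n assume "0 \<le> t"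
    \<comment> \<open>On [0, t+1] the time t is not the right end, so the derivative within the
      interval is the one within the half-line.\<close>
    then show "((\<lambda>\<tau>. v \<tau> n) has_vector_derivative \<i> * (discrete_laplacian (v t) n + of_real (V t n) * v t n)) (at t within {0..})"
      using loc[of t "t + 1" n] at_within_Icc_eq_Ici[of t "t + 1"] by simp
  next
    fix T :: real
    show "\<exists>B. \<forall>t\<in>{0..T}. lp_le 2 (v t) B"
    proof (cases "0 \<le> T")
      case True
      then obtain C where "\<forall>t\<in>{0..T}. lp_le 1 (v t) C" using loc[of T T] by auto
      then show ?thesis by (meson lp_le_exponent_mono less_numeral_extra(1) one_le_numeral)
    qed auto
  qed
  moreover have "v 0 = f"
  proof
    fix n
    have "picard_term V f k 0 n = (if k = 0 then f n else 0)" for k by (cases k) simp_all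
    then have "(\<lambda>k. picard_term V f k 0 n) sums f n" using sums_single[of 0 "\<lambda>_. f n"] by simp
    then show "v 0 n = f n" by (simp add: v_def sums_iff)
  qed
  ultimately show ?thesis by blast
qed

lemma schrodinger_deriv:
  assumes "schrodinger V v" "t \<ge> 0" "S \<subseteq> {0..}"
  shows "((\<lambda>\<tau>. v \<tau> n) has_vector_derivative \<i> * (discrete_laplacian (v t) n + of_real (V t n) * v t n)) (at t within S)"
  using assms unfolding schrodinger_def by (meson has_vector_derivative_within_subset)

lemma schrodinger_bounded:
  assumes "schrodinger V v"
  obtains B where "\<And>t. t \<in> {0..T} \<Longrightarrow> lp_le 2 (v t) B"
  using assms unfolding schrodinger_def by blast

lemma schrodinger_sum:
  assumes J: "finite J" and v: "\<And>j. j \<in> J \<Longrightarrow> schrodinger V (v j)"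
  shows "schrodinger V (\<lambda>t n. \<Sum>j\<in>J. c j * v j t n)"
  unfolding schrodinger_def
proof (intro conjI allI impI)
  fix t :: real and n assume t: "0 \<le> t"
  have "((\<lambda>\<tau>. \<Sum>j\<in>J. c j * v j \<tau> n) has_vector_derivative (\<Sum>j\<in>J. c j * (\<i> * (discrete_laplacian (v j t) n + of_real (V t n) * v j t n)))) (at t within {0..})"
    by (intro has_vector_derivative_sum has_vector_derivative_mult_right schrodinger_deriv v t order_refl)
  then show "((\<lambda>\<tau>. \<Sum>j\<in>J. c j * v j \<tau> n) has_vector_derivative \<i> * (discrete_laplacian (\<lambda>n. \<Sum>j\<in>J. c j * v j t n) n + of_real (V t n) * (\<Sum>j\<in>J. c j * v j t n))) (at t within {0..})"
    by (simp add: discrete_laplacian_sum discrete_laplacian_cmult sum_distrib_left sum.distrib[symmetric] algebra_simps)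
next
  fix T
  have "\<exists>B. \<forall>t\<in>{0..T}. lp_le 2 (v j t) B" if "j \<in> J" for j using v[OF that] by (simp add: schrodinger_def)
  then obtain B where "\<And>j t. j \<in> J \<Longrightarrow> t \<in> {0..T} \<Longrightarrow> lp_le 2 (v j t) (B j)" by metis
  then have "lp_le 2 (\<lambda>n. \<Sum>j\<in>J. c j * v j t n) (\<Sum>j\<in>J. norm (c j) * B j)" if "t \<in> {0..T}" for t
    using that by (intro lp_le_sum_family lp_le_cmult J) auto
  then show "\<exists>B. \<forall>t\<in>{0..T}. lp_le 2 (\<lambda>n. \<Sum>j\<in>J. c j * v j t n) B" by blast
qed

lemma schrodinger_diff:
  assumes v: "schrodinger V v" and w: "schrodinger V w"
  shows "schrodinger V (\<lambda>t n. v t n - w t n)"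
proof -
  have "schrodinger V (\<lambda>t n. \<Sum>b\<in>{True, False}. (if b then 1 else -1) * (if b then v else w) t n)"
    by (rule schrodinger_sum) (use v w in auto)
  then show ?thesis by simp
qed

section \<open>Mass conservation and the weak Duhamel formula\<close>

lemma locally_bounded_potentialE:
  assumes "locally_bounded_potential V" "0 \<le> T"
  obtains B where "B \<ge> 0" "\<And>t n. t \<in> {0..T} \<Longrightarrow> \<bar>V t n\<bar> \<le> B"
proof -
  obtain B where B: "\<And>t n. t \<in> {0..T} \<Longrightarrow> \<bar>V t n\<bar> \<le> B" using assms unfolding locally_bounded_potential_def by meson
  moreover have "B \<ge> 0" using B[of 0 undefined] assms(2) by auto
  ultimately show ?thesis using that by blast
qed

lemma lp_le_2_iff_infsum:
  assumes "lp_le 2 v B" "0 \<le> A"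
  shows "lp_le 2 v A \<longleftrightarrow> Re (\<Sum>\<^sub>\<infinity>n. cnj (v n) * v n) \<le> A\<^sup>2"
proof -
  have cv: "cnj (v n) * v n = of_real ((norm (v n))\<^sup>2)" for n
    by (metis complex_norm_square mult.commute)
  have p2: "x powr 2 = x\<^sup>2" if "0 \<le> x" for x :: real using that by (cases "x = 0") (auto simp: powr_numeral)
  have cB: "lp_le 2 (\<lambda>n. cnj (v n)) B" unfolding lp_le_def complex_mod_cnj by (rule assms(1)[unfolded lp_le_def])
  have s: "(\<lambda>n. of_real ((norm (v n))\<^sup>2) :: complex) summable_on UNIV"
    using cauchy_schwarz_infsum(1)[OF cB assms(1)] by (simp add: cv)
  have sr: "(\<lambda>n. (norm (v n))\<^sup>2) summable_on UNIV" using summable_on_Re[OF s] by simp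
  have "Re (\<Sum>\<^sub>\<infinity>n. cnj (v n) * v n) = (\<Sum>\<^sub>\<infinity>n. (norm (v n))\<^sup>2)"
    unfolding cv infsum_Re[OF s, symmetric] by simp
  moreover have "lp_le 2 v A \<longleftrightarrow> (\<Sum>\<^sub>\<infinity>n. (norm (v n))\<^sup>2) \<le> A\<^sup>2"
  proof
    assume "lp_le 2 v A"
    then show "(\<Sum>\<^sub>\<infinity>n. (norm (v n))\<^sup>2) \<le> A\<^sup>2"
      using sr assms(2) by (intro infsum_le_finite_sums) (auto simp: lp_le_def p2)
  next
    assume *: "(\<Sum>\<^sub>\<infinity>n. (norm (v n))\<^sup>2) \<le> A\<^sup>2"
    have "(\<Sum>n\<in>F. (norm (v n))\<^sup>2) \<le> A\<^sup>2" if "finite F" for F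
      using finite_sum_le_infsum[OF sr that] * by simp
    then show "lp_le 2 v A" using assms(2) by (auto simp: lp_le_def p2)
  qed
  ultimately show ?thesis by simp
qed

text \<open>Pair \<open>v\<close> with its conjugate, which follows the backward equation. The
  potential terms cancel because V is real, so the squared l^2 norm is constant.\<close>

lemma schrodinger_conservation:
  assumes v: "schrodinger V v" and V: "locally_bounded_potential V" and A: "lp_le 2 (v 0) A" and t: "t \<ge> 0"
  shows "lp_le 2 (v t) A"
proof -
  obtain U where U: "\<And>s. s \<in> {0..t} \<Longrightarrow> lp_le 2 (v s) U" using schrodinger_bounded[OF v] by blast
  obtain B where B: "B \<ge> 0" "\<And>s n. s \<in> {0..t} \<Longrightarrow> \<bar>V s n\<bar> \<le> B" using locally_bounded_potentialE[OF V t] by blast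
  define a where "a s n = \<i> * (of_real (V s n) * v s n)" for s n
  have a: "lp_le 2 (a s) (B * U)" if "s \<in> {0..t}" for s
    using lp_le_cmult[OF lp_le_potential[OF U[OF that] _ B(2)[OF that] B(1)], of \<i>] by (simp add: a_def[abs_def])
  have cn: "lp_le 2 (\<lambda>n. cnj (w n)) C \<longleftrightarrow> lp_le 2 w C" for w :: "(int, 'a) vec \<Rightarrow> complex" and C by (simp add: lp_le_def)
  have dv: "((\<lambda>\<tau>. v \<tau> n) has_vector_derivative (a s n + \<i> * discrete_laplacian (v s) n)) (at s within {0..t})" if "s \<in> {0..t}" for s n
    using schrodinger_deriv[OF v, of s "{0..t}" n] that by (auto simp: a_def algebra_simps)
  have dcv: "((\<lambda>\<tau>. cnj (v \<tau> n)) has_vector_derivative (cnj (a s n) - \<i> * discrete_laplacian (\<lambda>n. cnj (v s n)) n)) (at s within {0..t})" if "s \<in> {0..t}" for s n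
    using has_vector_derivative_cnj[OF dv[OF that]] by (simp add: discrete_laplacian_cnj)
  have "((\<lambda>s. (\<Sum>\<^sub>\<infinity>n. cnj (v s n) * a s n) + (\<Sum>\<^sub>\<infinity>n. cnj (a s n) * v s n)) has_integral
     (\<Sum>\<^sub>\<infinity>n. cnj (v t n) * v t n) - (\<Sum>\<^sub>\<infinity>n. cnj (v 0 n) * v 0 n)) {0..t}"
    by (rule has_integral_pairing[where X = U and U = U and A = "B * U" and B = "B * U", OF t dcv dv]) (auto simp: cn U a)
  moreover have "(\<Sum>\<^sub>\<infinity>n. cnj (v s n) * a s n) + (\<Sum>\<^sub>\<infinity>n. cnj (a s n) * v s n) = 0" for s
  proof -
    have "(\<Sum>\<^sub>\<infinity>n. cnj (a s n) * v s n) = (\<Sum>\<^sub>\<infinity>n. - (cnj (v s n) * a s n))"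
      by (intro infsum_cong) (simp add: a_def)
    then show ?thesis by (simp add: infsum_uminus)
  qed
  ultimately have "((\<lambda>s. 0) has_integral (\<Sum>\<^sub>\<infinity>n. cnj (v t n) * v t n) - (\<Sum>\<^sub>\<infinity>n. cnj (v 0 n) * v 0 n)) {0..t}"
    by simp
  then have "(\<Sum>\<^sub>\<infinity>n. cnj (v t n) * v t n) = (\<Sum>\<^sub>\<infinity>n. cnj (v 0 n) * v 0 n)"
    using has_integral_is_0 has_integral_unique by fastforce
  then show ?thesis
    using lp_le_2_iff_infsum[OF U[of t]] lp_le_2_iff_infsum[OF U[of 0]] A t lp_le_nonneg[OF A] by auto
qed

text \<open>The function s -> y(t - s) follows the backward free equation, so the pairing identity
  applies with no source on that side. The test vector y(0) plays the role of the dual vector: as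
  the Laplacian is symmetric for the bilinear pairing, the free propagator is its own
  transpose.\<close>

lemma schrodinger_duhamel:
  assumes y: "schrodinger (\<lambda>_ _. 0) y" and v: "schrodinger V v" and V: "locally_bounded_potential V" and t: "t \<ge> 0"
  shows "((\<lambda>s. \<Sum>\<^sub>\<infinity>n. y (t - s) n * (\<i> * (of_real (V s n) * v s n))) has_integral
     (\<Sum>\<^sub>\<infinity>n. y 0 n * v t n) - (\<Sum>\<^sub>\<infinity>n. y t n * v 0 n)) {0..t}"
proof -
  obtain U where U: "\<And>s. s \<in> {0..t} \<Longrightarrow> lp_le 2 (v s) U" using schrodinger_bounded[OF v] by blast
  obtain Y where Y: "\<And>s. s \<in> {0..t} \<Longrightarrow> lp_le 2 (y s) Y" using schrodinger_bounded[OF y] by blast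
  obtain B where B: "B \<ge> 0" "\<And>s n. s \<in> {0..t} \<Longrightarrow> \<bar>V s n\<bar> \<le> B" using locally_bounded_potentialE[OF V t] by blast
  define a where "a s n = \<i> * (of_real (V s n) * v s n)" for s n
  have a: "lp_le 2 (a s) (B * U)" if "s \<in> {0..t}" for s
    using lp_le_cmult[OF lp_le_potential[OF U[OF that] _ B(2)[OF that] B(1)], of \<i>] by (simp add: a_def[abs_def])
  have dv: "((\<lambda>\<tau>. v \<tau> n) has_vector_derivative (a s n + \<i> * discrete_laplacian (v s) n)) (at s within {0..t})" if "s \<in> {0..t}" for s n
    using schrodinger_deriv[OF v, of s "{0..t}" n] that by (auto simp: a_def algebra_simps)
  have dy: "((\<lambda>\<tau>. y (t - \<tau>) n) has_vector_derivative (0 - \<i> * discrete_laplacian (y (t - s)) n)) (at s within {0..t})" if "s \<in> {0..t}" for s n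
  proof -
    have "((\<lambda>\<tau>. t - \<tau>) has_vector_derivative -1) (at s within {0..t})"
      by (auto intro!: derivative_eq_intros)
    moreover have "((\<lambda>\<tau>. y \<tau> n) has_vector_derivative \<i> * discrete_laplacian (y (t - s)) n) (at (t - s) within (\<lambda>\<tau>. t - \<tau>) ` {0..t})"
      using schrodinger_deriv[OF y, of "t - s" "(\<lambda>\<tau>. t - \<tau>) ` {0..t}" n] that by auto
    ultimately have "((\<lambda>\<tau>. y \<tau> n) \<circ> (\<lambda>\<tau>. t - \<tau>) has_vector_derivative (-1) *\<^sub>R (\<i> * discrete_laplacian (y (t - s)) n)) (at s within {0..t})"
      by (rule vector_diff_chain_within)
    then show ?thesis by (simp add: o_def)
  qed
  have "((\<lambda>s. (\<Sum>\<^sub>\<infinity>n. y (t - s) n * a s n) + (\<Sum>\<^sub>\<infinity>n. 0 * v s n)) has_integral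
     (\<Sum>\<^sub>\<infinity>n. y (t - t) n * v t n) - (\<Sum>\<^sub>\<infinity>n. y (t - 0) n * v 0 n)) {0..t}"
    by (rule has_integral_pairing[where X = Y and U = U and A = "B * U" and B = 0, OF t dy dv]) (auto simp: U Y a lp_le_zero_vector)
  then show ?thesis by (simp add: a_def)
qed

section \<open>Dispersive decay of the free evolution\<close>

definition free_kernel :: "real \<Rightarrow> int ^ 'd::finite \<Rightarrow> complex" where
  "free_kernel t k = (\<Prod>j\<in>UNIV. lattice_kernel t (k $ j))"

lemma free_kernel_0: "free_kernel 0 k = (if k = 0 then 1 else 0)"
  by (auto simp: free_kernel_def lattice_kernel_0 vec_eq_iff)

lemma free_kernel_le_1: "norm (free_kernel t k) \<le> 1"
  unfolding free_kernel_def prod_norm[symmetric] by (intro prod_le_1) (auto simp: lattice_kernel_le_1)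

lemma free_kernel_decay:
  fixes k :: "int ^ 'd::finite"
  assumes "t \<ge> 0"
  shows "norm (free_kernel t k) \<le> 8 ^ CARD('d) * (1 + t) powr (- (real CARD('d) / 3))"
proof -
  have "norm (free_kernel t k) \<le> (\<Prod>j\<in>(UNIV::'d set). 8 * (1 + t) powr (-1/3))"
    unfolding free_kernel_def prod_norm[symmetric] by (intro prod_mono conjI norm_ge_zero lattice_kernel_decay assms)
  also have "\<dots> = 8 ^ CARD('d) * (1 + t) powr (- (real CARD('d) / 3))"
    using assms by (simp add: power_mult_distrib powr_realpow[symmetric] powr_powr)
  finally show ?thesis .
qed

text \<open>The product rule yields one summand per coordinate, and the derivative of factor j is
  the part of the Laplacian in direction j.\<close>

lemma free_kernel_deriv:
  "((\<lambda>t. free_kernel t k) has_vector_derivative \<i> * discrete_laplacian (free_kernel t) k) (at t within S)"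
proof -
  define g' where "g' j = \<i> * (lattice_kernel t (k $ j + 1) + lattice_kernel t (k $ j - 1) - 2 * lattice_kernel t (k $ j))" for j
  define P where "P j = (\<Prod>i\<in>UNIV - {j}. lattice_kernel t (k $ i))" for j
  have "((\<lambda>t. free_kernel t k) has_derivative (\<lambda>y. \<Sum>j\<in>UNIV. (y *\<^sub>R g' j) * P j)) (at t within S)"
    unfolding free_kernel_def P_def
    by (intro has_derivative_prod) (use lattice_kernel_deriv in \<open>simp add: has_vector_derivative_def g'_def\<close>)
  moreover have "(\<lambda>y. \<Sum>j\<in>UNIV. (y *\<^sub>R g' j) * P j) = (\<lambda>y. y *\<^sub>R (\<Sum>j\<in>UNIV. g' j * P j))"
    by (simp add: scaleR_sum_right)
  moreover have "(\<Sum>j\<in>UNIV. g' j * P j) = \<i> * discrete_laplacian (free_kernel t) k"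
  proof -
    have sp: "free_kernel t k' = lattice_kernel t (k' $ j) * (\<Prod>i\<in>UNIV - {j}. lattice_kernel t (k' $ i))" for k' j
      unfolding free_kernel_def by (rule prod.remove) auto
    have "free_kernel t (k + axis j 1) = lattice_kernel t (k $ j + 1) * P j"
      "free_kernel t (k - axis j 1) = lattice_kernel t (k $ j - 1) * P j"
      "free_kernel t k = lattice_kernel t (k $ j) * P j" for j
      unfolding sp[of _ j] P_def by (auto intro!: prod.cong simp: axis_def)
    then have "free_kernel t (k + axis j 1) + free_kernel t (k - axis j 1) - 2 * free_kernel t k =
        (lattice_kernel t (k $ j + 1) + lattice_kernel t (k $ j - 1) - 2 * lattice_kernel t (k $ j)) * P j" for j
      by (simp add: algebra_simps)
    then show ?thesis by (simp add: discrete_laplacian_def g'_def sum_distrib_left mult.assoc)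
  qed
  ultimately show ?thesis by (simp add: has_vector_derivative_def)
qed

lemma norm_discrete_laplacian_le:
  fixes v :: "int ^ 'd::finite \<Rightarrow> complex"
  assumes "\<And>n. norm (v n) \<le> M"
  shows "norm (discrete_laplacian v n) \<le> 4 * real CARD('d) * M"
proof -
  have "norm (discrete_laplacian v n) \<le> (\<Sum>j\<in>(UNIV::'d set). 4 * M)"
    unfolding discrete_laplacian_def
  proof (intro order_trans[OF norm_sum] sum_mono)
    fix j
    have "norm (v (n + axis j 1) + v (n - axis j 1) - 2 * v n) \<le> norm (v (n + axis j 1)) + norm (v (n - axis j 1)) + norm (2 * v n)"
      by (intro order_trans[OF norm_triangle_ineq4] add_right_mono norm_triangle_ineq)
    then show "norm (v (n + axis j 1) + v (n - axis j 1) - 2 * v n) \<le> 4 * M"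
      using assms[of "n + axis j 1"] assms[of "n - axis j 1"] assms[of n] by (simp add: norm_mult)
  qed
  then show ?thesis by simp
qed

text \<open>Stated for bounded rather than l^2 functions, because the explicit kernel is only known
  to be bounded. Iterating the integral equation gives M (Lt)^k / k!, which tends to 0.\<close>

lemma free_evolution_unique:
  fixes w :: "real \<Rightarrow> int ^ 'd::finite \<Rightarrow> complex"
  assumes dw: "\<And>t n. t \<in> {0..T} \<Longrightarrow> ((\<lambda>\<tau>. w \<tau> n) has_vector_derivative \<i> * discrete_laplacian (w t) n) (at t within {0..T})"
    and bdd: "\<And>t n. t \<in> {0..T} \<Longrightarrow> norm (w t n) \<le> M" and w0: "\<And>n. w 0 n = 0" and t: "t \<in> {0..T}"
  shows "w t n = 0"
proof -
  define L where "L = 4 * real CARD('d)"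
  have "norm (w t n) \<le> M * (L * t) ^ k / fact k" if "t \<in> {0..T}" for k t n
    using that
  proof (induction k arbitrary: t n)
    case 0
    then show ?case using bdd by simp
  next
    case (Suc k)
    then have t: "0 \<le> t" "t \<le> T" by auto
    have i: "((\<lambda>s. \<i> * discrete_laplacian (w s) n) has_integral w t n - w 0 n) {0..t}"
      using t by (intro fundamental_theorem_of_calculus) (auto intro: has_vector_derivative_within_subset[OF dw])
    have g: "((\<lambda>s. L * (M * (L * s) ^ k / fact k)) has_integral M * (L * t) ^ Suc k / fact (Suc k)) {0..t}"
      by (rule has_integral_power_fact[OF t(1)])
    have "norm (integral {0..t} (\<lambda>s. \<i> * discrete_laplacian (w s) n)) \<le> integral {0..t} (\<lambda>s. L * (M * (L * s) ^ k / fact k))"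
    proof (rule integral_norm_bound_integral)
      fix s assume s: "s \<in> {0..t}"
      have "norm (discrete_laplacian (w s) n) \<le> 4 * real CARD('d) * (M * (L * s) ^ k / fact k)"
        by (rule norm_discrete_laplacian_le) (use Suc.IH[of s] s t in auto)
      then show "norm (\<i> * discrete_laplacian (w s) n) \<le> L * (M * (L * s) ^ k / fact k)"
        by (simp add: norm_mult L_def)
    qed (use i g in auto)
    then show ?case unfolding integral_unique[OF i] integral_unique[OF g] by (simp add: w0)
  qed
  then have le: "norm (w t n) \<le> M * (L * t) ^ k / fact k" for k using t by blast
  have "(\<lambda>k. M * ((L * t) ^ k /\<^sub>R fact k)) \<longlonglongrightarrow> M * 0"
    by (intro tendsto_mult tendsto_const summable_LIMSEQ_zero sums_summable[OF exp_converges])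
  then have "norm (w t n) \<le> M * 0"
    by (rule tendsto_lowerbound) (use le in \<open>auto simp: field_simps\<close>)
  then show ?thesis by simp
qed

text \<open>Identifies the solution with a finite convolution: the difference is bounded, solves the
  free equation and starts from 0.\<close>

lemma free_evolution_kernel:
  fixes v :: "real \<Rightarrow> int ^ 'd::finite \<Rightarrow> complex"
  assumes v: "schrodinger (\<lambda>_ _. 0) v" and G: "finite G" "\<And>n. n \<notin> G \<Longrightarrow> v 0 n = 0" and t: "t \<ge> 0"
  shows "v t n = (\<Sum>m\<in>G. v 0 m * free_kernel t (n - m))"
proof -
  define w where "w t n = v t n - (\<Sum>m\<in>G. v 0 m * free_kernel t (n - m))" for t n
  obtain B where B: "\<And>s. s \<in> {0..t} \<Longrightarrow> lp_le 2 (v s) B" using schrodinger_bounded[OF v] by blast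
  have "w t n = 0"
  proof (rule free_evolution_unique[of t w "B + (\<Sum>m\<in>G. norm (v 0 m))"])
    fix s and n :: "int ^ 'd" assume s: "s \<in> {0..t}"
    have lapG: "discrete_laplacian (\<lambda>n. free_kernel s (n - m)) n = discrete_laplacian (free_kernel s) (n - m)" for m
      by (simp add: discrete_laplacian_def algebra_simps)
    have "((\<lambda>\<tau>. w \<tau> n) has_vector_derivative \<i> * (discrete_laplacian (v s) n + of_real 0 * v s n) - (\<Sum>m\<in>G. v 0 m * (\<i> * discrete_laplacian (free_kernel s) (n - m)))) (at s within {0..t})"
      unfolding w_def
      by (intro has_vector_derivative_diff has_vector_derivative_sum has_vector_derivative_mult_right free_kernel_deriv schrodinger_deriv[OF v]) (use s in auto)
    then show "((\<lambda>\<tau>. w \<tau> n) has_vector_derivative \<i> * discrete_laplacian (w s) n) (at s within {0..t})"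
      unfolding w_def discrete_laplacian_diff discrete_laplacian_sum discrete_laplacian_cmult lapG
      by (simp add: algebra_simps sum_distrib_left)
    have "norm (\<Sum>m\<in>G. v 0 m * free_kernel s (n - m)) \<le> (\<Sum>m\<in>G. norm (v 0 m))"
      by (intro order_trans[OF norm_sum] sum_mono) (simp add: norm_mult mult_left_le free_kernel_le_1)
    then show "norm (w s n) \<le> B + (\<Sum>m\<in>G. norm (v 0 m))"
      unfolding w_def using lp_le_pointwise[OF B[OF s], of n] norm_triangle_ineq4[of "v s n"] by (smt (verit))
  next
    fix n
    have "(\<Sum>m\<in>G. v 0 m * free_kernel 0 (n - m)) = (\<Sum>m\<in>G. if m = n then v 0 n else 0)"
      by (intro sum.cong) (auto simp: free_kernel_0)
    also have "\<dots> = v 0 n" using G by (auto simp: sum.delta)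
    finally show "w 0 n = 0" by (simp add: w_def)
  qed (use t in auto)
  then show ?thesis by (simp add: w_def)
qed

section \<open>Uniqueness, interpolation of propagators and the free decay estimate\<close>

lemma locally_bounded_potential_0: "locally_bounded_potential (\<lambda>_ _. 0)"
  by (auto simp: locally_bounded_potential_def)

lemma lp_le_1_fin_support:
  assumes "finite G" "\<And>n. n \<notin> G \<Longrightarrow> f n = 0"
  shows "lp_le 1 f (lp_fin 1 G f)"
  using assms by (intro lp_le_fin) auto

lemma schrodinger_unique:
  assumes v: "schrodinger V v" and w: "schrodinger V w" and V: "locally_bounded_potential V"
    and eq: "v 0 = w 0" and t: "t \<ge> 0"
  shows "v t = w t"
proof
  fix n
  have "lp_le 2 (\<lambda>n. v 0 n - w 0 n) 0" by (simp add: eq lp_le_def)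
  then have "lp_le 2 (\<lambda>n. v t n - w t n) 0"
    by (rule schrodinger_conservation[OF schrodinger_diff[OF v w] V _ t])
  from lp_le_zero[OF _ this, of n] show "v t n = w t n" by simp
qed

lemma holder_fin:
  fixes v :: "'a \<Rightarrow> complex"
  assumes v: "lp_le p v A" and pq: "p > 1" "q > 1" "1/p + 1/q = 1" and F: "finite F"
  shows "norm (\<Sum>n\<in>F. h n * v n) \<le> A * lp_fin q F h"
proof -
  define h' where "h' n = (if n \<in> F then h n else 0)" for n
  have "lp_le q h' (lp_fin q F h')" using F pq by (intro lp_le_fin) (auto simp: h'_def)
  then have h': "lp_le q h' (lp_fin q F h)" by (simp add: lp_fin_def h'_def)
  have "norm (\<Sum>n\<in>F. h n * v n) \<le> (\<Sum>n\<in>F. norm (v n) * norm (h' n))"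
    by (intro order_trans[OF norm_sum] sum_mono) (simp add: norm_mult h'_def)
  also have "\<dots> \<le> A * lp_fin q F h" by (rule holder_lp_le[OF v h' pq F])
  finally show ?thesis .
qed

text \<open>One endpoint is mass conservation, which gives the constant 1 on l^2; the other is the
  hypothesis \<open>b0\<close> on all linear evolutions with finitely supported data.\<close>

lemma propagator_interpolation:
  fixes v :: "real \<Rightarrow> int ^ 'd::finite \<Rightarrow> complex"
  assumes V: "locally_bounded_potential V" and t: "t \<ge> 0" and q: "q0 > 0" "q > 0" "1/q = (1-\<theta>)/q0 + \<theta>/2"
    and \<theta>: "0 \<le> \<theta>" "\<theta> \<le> 1" and M: "M > 0"
    and b0: "\<And>w F G h. schrodinger V w \<Longrightarrow> finite F \<Longrightarrow> finite G \<Longrightarrow> (\<And>n. n \<notin> G \<Longrightarrow> w 0 n = 0) \<Longrightarrow>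
       norm (\<Sum>n\<in>F. h n * w t n) \<le> M * lp_fin q0 F h * lp_fin q0 G (w 0)"
    and v: "schrodinger V v" and F: "finite F" and G: "finite G" "\<And>n. n \<notin> G \<Longrightarrow> v 0 n = 0"
  shows "norm (\<Sum>n\<in>F. h n * v t n) \<le> M powr (1-\<theta>) * lp_fin q F h * lp_fin q G (v 0)"
proof -
  \<comment> \<open>The evolutions of the unit vectors are the columns of the propagator matrix at
    time t, to which Riesz-Thorin applies.\<close>
  have "\<exists>v. schrodinger V v \<and> v 0 = (\<lambda>n. if n = m then 1 else 0)" for m
    by (rule schrodinger_exists[OF V lp_le_1_fin_support[of "{m}"]]) auto
  then obtain K where K: "\<And>m. schrodinger V (K m)" "\<And>m. K m 0 = (\<lambda>n. if n = m then 1 else 0)" by metis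
  define w where "w g t n = (\<Sum>m\<in>G. g m * K m t n)" for g t n
  have w: "schrodinger V (w g)" for g
    unfolding w_def by (rule schrodinger_sum[OF G(1) K(1)])
  have w0: "w g 0 n = (if n \<in> G then g n else 0)" for g n
  proof -
    have "w g 0 n = (\<Sum>m\<in>G. if n = m then g n else 0)" unfolding w_def K(2) by (intro sum.cong) auto
    then show ?thesis using G(1) by (simp add: sum.delta)
  qed
  have lw0: "lp_fin r G (w g 0) = lp_fin r G g" for r g by (simp add: lp_fin_def w0)
  have eq: "(\<Sum>n\<in>F. \<Sum>m\<in>G. h n * K m t n * g m) = (\<Sum>n\<in>F. h n * w g t n)" for h g
    unfolding w_def by (simp add: sum_distrib_left mult_ac)
  have "norm (\<Sum>n\<in>F. \<Sum>m\<in>G. h n * K m t n * v 0 m) \<le> M powr (1-\<theta>) * 1 powr \<theta> * lp_fin q F h * lp_fin q G (v 0)"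
  proof (rule riesz_thorin[OF F G(1) q(1) _ q(2,3) \<theta> M])
    fix h g
    show "norm (\<Sum>n\<in>F. \<Sum>m\<in>G. h n * K m t n * g m) \<le> M * lp_fin q0 F h * lp_fin q0 G g"
      unfolding eq using b0[OF w F G(1), of g h] w0 by (simp add: lw0)
    have "lp_le 2 (w g 0) (lp_fin 2 G (w g 0))" using G(1) w0 by (intro lp_le_fin) auto
    then have "lp_le 2 (w g t) (lp_fin 2 G g)"
      unfolding lw0 by (rule schrodinger_conservation[OF w V _ t])
    then show "norm (\<Sum>n\<in>F. \<Sum>m\<in>G. h n * K m t n * g m) \<le> 1 * lp_fin 2 F h * lp_fin 2 G g"
      unfolding eq using holder_fin[of 2 "w g t" "lp_fin 2 G g" 2 F h] F by (simp add: mult.commute)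
  qed auto
  \<comment> \<open>By uniqueness the given solution is the superposition of these columns.\<close>
  moreover have "w (v 0) t = v t"
    by (rule schrodinger_unique[OF w v V _ t]) (use w0 G in auto)
  ultimately show ?thesis by (simp add: eq)
qed

text \<open>Interpolation at \<theta> = 2/p between l^1 -> l^\<infinity>, where the supremum of the
  kernel is the bound, and l^2 -> l^2. The rate d/3 is thereby multiplied by 1 - 2/p, and 8^d only
  decreases under a power at most 1.\<close>

lemma free_evolution_decay:
  fixes v :: "real \<Rightarrow> int ^ 'd::finite \<Rightarrow> complex"
  assumes v: "schrodinger (\<lambda>_ _. 0) v" and G: "finite G" "\<And>n. n \<notin> G \<Longrightarrow> v 0 n = 0" and t: "t \<ge> 0"
    and p: "p \<ge> 2" and q: "q > 1" "1/p + 1/q = 1"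
  shows "lp_le p (v t) (8 ^ CARD('d) * (1 + t) powr (- (real CARD('d) * (p - 2) / (3 * p))) * lp_fin q G (v 0))"
proof (rule lp_le_dual[OF _ q])
  define M where "M = 8 ^ CARD('d) * (1 + t) powr (- (real CARD('d) / 3))"
  have M: "M > 0" using t by (simp add: M_def)
  show "p > 1" using p by simp
  show "0 \<le> 8 ^ CARD('d) * (1 + t) powr (- (real CARD('d) * (p - 2) / (3 * p))) * lp_fin q G (v 0)"
    by (simp add: lp_fin_nonneg)
  fix F :: "(int ^ 'd) set" and h :: "int ^ 'd \<Rightarrow> complex" assume F: "finite F" and "\<And>n. n \<notin> F \<Longrightarrow> h n = 0"
  have "norm (\<Sum>n\<in>F. h n * v t n) \<le> M powr (1 - 2/p) * lp_fin q F h * lp_fin q G (v 0)"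
  proof -
    have "norm (\<Sum>n\<in>F. h n * v t n) \<le> M powr (1 - (2/p)) * lp_fin q F h * lp_fin q G (v 0)"
    proof (rule propagator_interpolation)
      show "(1::real) > 0" by simp
      show "locally_bounded_potential (\<lambda>(_::real) (_::int ^ 'd). 0)" by (rule locally_bounded_potential_0)
      show "1 / q = (1 - 2/p) / 1 + (2/p) / 2" using q by simp
      fix w :: "real \<Rightarrow> int ^ 'd \<Rightarrow> complex" and F G :: "(int ^ 'd) set" and h :: "int ^ 'd \<Rightarrow> complex"
      assume w: "schrodinger (\<lambda>_ _. 0) w" and FG: "finite F" "finite G" and w0: "\<And>n. n \<notin> G \<Longrightarrow> w 0 n = 0"
      have "norm (\<Sum>n\<in>F. h n * w t n) \<le> (\<Sum>n\<in>F. \<Sum>m\<in>G. norm (h n) * (norm (w 0 m) * M))"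
      proof (intro order_trans[OF norm_sum] sum_mono)
        fix n
        have e: "w t n = (\<Sum>m\<in>G. w 0 m * free_kernel t (n - m))"
          by (rule free_evolution_kernel[OF w FG(2) _ t]) (rule w0)
        have "norm (w t n) \<le> (\<Sum>m\<in>G. norm (w 0 m) * M)"
          unfolding e M_def
          by (intro order_trans[OF norm_sum] sum_mono) (auto simp: norm_mult intro!: mult_left_mono free_kernel_decay t)
        then show "norm (h n * w t n) \<le> (\<Sum>m\<in>G. norm (h n) * (norm (w 0 m) * M))"
          unfolding norm_mult sum_distrib_left[symmetric] by (intro mult_left_mono) auto
      qed
      also have "\<dots> = M * lp_fin 1 F h * lp_fin 1 G (w 0)"
        by (simp add: lp_fin_def sum_nonneg sum_product mult_ac sum_distrib_left)
      finally show "norm (\<Sum>n\<in>F. h n * w t n) \<le> M * lp_fin 1 F h * lp_fin 1 G (w 0)" .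
    qed (use p q t M v F G in auto)
    then show ?thesis .
  qed
  also have "M powr (1 - 2/p) \<le> 8 ^ CARD('d) * (1 + t) powr (- (real CARD('d) * (p - 2) / (3 * p)))"
  proof -
    have "M powr (1 - 2/p) = (8 ^ CARD('d)) powr (1 - 2/p) * (1 + t) powr (- (real CARD('d) / 3) * (1 - 2/p))"
      using t by (simp add: M_def powr_mult powr_powr)
    also have "(8 ^ CARD('d)) powr (1 - 2/p) \<le> (8 ^ CARD('d)) powr (1::real)"
      using p by (intro powr_mono) auto
    also have "- (real CARD('d) / 3) * (1 - 2/p) = - (real CARD('d) * (p - 2) / (3 * p))"
      using p by (simp add: field_simps)
    finally show ?thesis by (simp add: mult_right_mono)
  qed
  finally show "norm (\<Sum>n\<in>F. h n * v t n) \<le> 8 ^ CARD('d) * (1 + t) powr (- (real CARD('d) * (p - 2) / (3 * p))) * lp_fin q G (v 0) * lp_fin q F h"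
    by (simp add: mult_ac lp_fin_nonneg mult_left_mono mult_right_mono)
qed

section \<open>Perturbation by a small decaying potential\<close>

lemma has_integral_powr_tail:
  fixes \<beta> t :: real
  assumes "\<beta> > 1" "t \<ge> 0"
  shows "((\<lambda>s. (1 + s) powr (- \<beta>)) has_integral (1 - (1 + t) powr (1 - \<beta>)) / (\<beta> - 1)) {0..t}" (is ?A)
    and "((\<lambda>s. (1 + (t - s)) powr (- \<beta>)) has_integral (1 - (1 + t) powr (1 - \<beta>)) / (\<beta> - 1)) {0..t}" (is ?B)
proof -
  have e: "1 - \<beta> - 1 = - \<beta>" by simp
  have "((\<lambda>s. (1 + s) powr (- \<beta>)) has_integral - ((1 + t) powr (1 - \<beta>) / (\<beta> - 1)) - - ((1 + 0) powr (1 - \<beta>) / (\<beta> - 1))) {0..t}"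
  proof (rule fundamental_theorem_of_calculus[OF assms(2)])
    fix s assume s: "s \<in> {0..t}"
    have "((\<lambda>s. - ((1 + s) powr (1 - \<beta>) / (\<beta> - 1))) has_real_derivative - ((1 - \<beta>) * (1 + s) powr (1 - \<beta> - 1) / (\<beta> - 1))) (at s within {0..t})"
      using s assms by (auto intro!: derivative_eq_intros)
    moreover have "- ((1 - \<beta>) * (1 + s) powr (1 - \<beta> - 1) / (\<beta> - 1)) = (1 + s) powr (- \<beta>)"
      unfolding e using assms by (simp add: field_simps)
    ultimately show "((\<lambda>s. - ((1 + s) powr (1 - \<beta>) / (\<beta> - 1))) has_vector_derivative (1 + s) powr (- \<beta>)) (at s within {0..t})"
      by (simp add: has_real_derivative_iff_has_vector_derivative)
  qed
  then show ?A by (simp add: diff_divide_distrib)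
  have "((\<lambda>s. (1 + (t - s)) powr (- \<beta>)) has_integral ((1 + (t - t)) powr (1 - \<beta>) / (\<beta> - 1)) - ((1 + (t - 0)) powr (1 - \<beta>) / (\<beta> - 1))) {0..t}"
  proof (rule fundamental_theorem_of_calculus[OF assms(2)])
    fix s assume s: "s \<in> {0..t}"
    have "((\<lambda>s. ((1 + (t - s)) powr (1 - \<beta>) / (\<beta> - 1))) has_real_derivative - ((1 - \<beta>) * (1 + (t - s)) powr (1 - \<beta> - 1) / (\<beta> - 1))) (at s within {0..t})"
      using s assms by (auto intro!: derivative_eq_intros)
    moreover have "- ((1 - \<beta>) * (1 + (t - s)) powr (1 - \<beta> - 1) / (\<beta> - 1)) = (1 + (t - s)) powr (- \<beta>)"
      unfolding e using assms by (simp add: field_simps)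
    ultimately show "((\<lambda>s. ((1 + (t - s)) powr (1 - \<beta>) / (\<beta> - 1))) has_vector_derivative (1 + (t - s)) powr (- \<beta>)) (at s within {0..t})"
      by (simp add: has_real_derivative_iff_has_vector_derivative)
  qed
  then show ?B by (simp add: diff_divide_distrib)
qed

text \<open>For s <= t/2 the factor with t - s is comparable to (1+t)^(-\<alpha>); for s > t/2 the
  same holds for the \<alpha>-part of the other factor. Adding the two majorants avoids splitting
  the integral. The constant 4 is the comparison factor 2 times the two tails.\<close>

lemma convolution_bound:
  fixes \<alpha> \<beta> t :: real
  assumes \<alpha>: "0 \<le> \<alpha>" "\<alpha> \<le> 1" and \<beta>: "\<alpha> \<le> \<beta>" "\<beta> > 1" and t: "t \<ge> 0"
  shows "(\<lambda>s. (1 + (t - s)) powr (- \<alpha>) * (1 + s) powr (- \<beta>)) integrable_on {0..t}"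
    and "integral {0..t} (\<lambda>s. (1 + (t - s)) powr (- \<alpha>) * (1 + s) powr (- \<beta>)) \<le> 4 / (\<beta> - 1) * (1 + t) powr (- \<alpha>)"
proof -
  show i: "(\<lambda>s. (1 + (t - s)) powr (- \<alpha>) * (1 + s) powr (- \<beta>)) integrable_on {0..t}"
    by (intro integrable_continuous_real continuous_intros) auto
  define c where "c = 2 * (1 + t) powr (- \<alpha>)"
  have c: "c \<ge> 0" by (simp add: c_def)
  have two: "(2::real) powr \<alpha> \<le> 2" using powr_mono[of \<alpha> 1 "2::real"] \<alpha> by simp
  have half: "x powr (- \<alpha>) \<le> c" if "x > 0" "1 + t \<le> 2 * x" for x
  proof -
    have "(1 + t) powr \<alpha> \<le> (2 * x) powr \<alpha>" using that t \<alpha> by (intro powr_mono2) auto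
    also have "\<dots> = 2 powr \<alpha> * x powr \<alpha>" using that by (simp add: powr_mult)
    also have "\<dots> \<le> 2 * x powr \<alpha>" using two by (intro mult_right_mono) auto
    finally have "1 / x powr \<alpha> \<le> 2 / (1 + t) powr \<alpha>"
      using that t by (simp add: field_simps)
    then show ?thesis by (simp add: c_def powr_minus_divide)
  qed
  have pt: "(1 + (t - s)) powr (- \<alpha>) * (1 + s) powr (- \<beta>) \<le> c * ((1 + s) powr (- \<beta>) + (1 + (t - s)) powr (- \<beta>))"
    if s: "s \<in> {0..t}" for s
  proof (cases "s \<le> t - s")
    case True
    have "(1 + (t - s)) powr (- \<alpha>) * (1 + s) powr (- \<beta>) \<le> c * (1 + s) powr (- \<beta>)"
      using s True by (intro mult_right_mono half) auto
    also have "\<dots> \<le> c * ((1 + s) powr (- \<beta>) + (1 + (t - s)) powr (- \<beta>))" using c by (intro mult_left_mono) auto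
    finally show ?thesis .
  next
    case False
    \<comment> \<open>The surplus decay \<beta> - \<alpha> is moved from s to the smaller t - s,
      where together with \<alpha> it restores the integrable power \<beta>.\<close>
    have "(1 + s) powr (- \<beta>) = (1 + s) powr (- \<alpha>) * (1 + s) powr (- (\<beta> - \<alpha>))" by (simp add: powr_add[symmetric])
    also have "\<dots> \<le> c * (1 + (t - s)) powr (- (\<beta> - \<alpha>))"
      using s False \<beta> c by (intro mult_mono half powr_mono2') auto
    finally have "(1 + (t - s)) powr (- \<alpha>) * (1 + s) powr (- \<beta>) \<le> (1 + (t - s)) powr (- \<alpha>) * (c * (1 + (t - s)) powr (- (\<beta> - \<alpha>)))"
      by (intro mult_left_mono) auto
    also have "\<dots> = c * (1 + (t - s)) powr (- \<beta>)" by (simp add: powr_add[symmetric])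
    also have "\<dots> \<le> c * ((1 + s) powr (- \<beta>) + (1 + (t - s)) powr (- \<beta>))" using c by (intro mult_left_mono) auto
    finally show ?thesis .
  qed
  define J where "J = (1 - (1 + t) powr (1 - \<beta>)) / (\<beta> - 1)"
  have h: "((\<lambda>s. c * ((1 + s) powr (- \<beta>) + (1 + (t - s)) powr (- \<beta>))) has_integral c * (J + J)) {0..t}"
    unfolding J_def by (intro has_integral_mult_right has_integral_add has_integral_powr_tail \<beta> t)
  have "integral {0..t} (\<lambda>s. (1 + (t - s)) powr (- \<alpha>) * (1 + s) powr (- \<beta>)) \<le> c * (J + J)"
    by (rule has_integral_le[OF integrable_integral[OF i] h pt])
  also have "\<dots> \<le> c * (1 / (\<beta> - 1) + 1 / (\<beta> - 1))"
  proof -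
    have "J \<le> 1 / (\<beta> - 1)" unfolding J_def using \<beta> by (intro divide_right_mono) auto
    then show ?thesis using c by (intro mult_left_mono add_mono)
  qed
  also have "\<dots> = 4 / (\<beta> - 1) * (1 + t) powr (- \<alpha>)" by (simp add: c_def field_simps)
  finally show "integral {0..t} (\<lambda>s. (1 + (t - s)) powr (- \<alpha>) * (1 + s) powr (- \<beta>)) \<le> 4 / (\<beta> - 1) * (1 + t) powr (- \<alpha>)" .
qed

lemma norm_infsum_le_of_finite:
  fixes f :: "'a \<Rightarrow> complex"
  assumes "\<And>F. finite F \<Longrightarrow> (\<Sum>n\<in>F. norm (f n)) \<le> B"
  shows "norm (\<Sum>\<^sub>\<infinity>n. f n) \<le> B"
proof -
  have s: "(\<lambda>n. norm (f n)) summable_on UNIV"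
    by (rule nonneg_bdd_above_summable_on) (use assms in \<open>auto simp: bdd_above_def\<close>)
  have "norm (\<Sum>\<^sub>\<infinity>n. f n) \<le> (\<Sum>\<^sub>\<infinity>n. norm (f n))" by (rule norm_infsum_bound) fact
  also have "\<dots> \<le> B" using s by (rule infsum_le_finite_sums) (use assms in auto)
  finally show ?thesis .
qed

lemma infsum_finite_support:
  fixes f :: "'a \<Rightarrow> complex"
  assumes "finite F" "\<And>n. n \<notin> F \<Longrightarrow> f n = 0"
  shows "(\<Sum>\<^sub>\<infinity>n. f n) = (\<Sum>n\<in>F. f n)"
proof -
  have "(\<Sum>\<^sub>\<infinity>n. f n) = (\<Sum>\<^sub>\<infinity>n\<in>F. f n)" using assms by (intro infsum_cong_neutral) auto
  then show ?thesis using assms by simp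
qed

lemma lp_le_limit_bound:
  assumes "\<And>k. lp_le p v (A k)" "A \<longlonglongrightarrow> B" "p > 0"
  shows "lp_le p v B"
  unfolding lp_le_def
proof (intro conjI allI impI)
  show "0 \<le> B" by (rule tendsto_lowerbound[OF assms(2)]) (use lp_le_nonneg[OF assms(1)] in auto)
  fix F :: "'a set" assume "finite F"
  have "(\<lambda>k. A k powr p) \<longlonglongrightarrow> B powr p"
    by (rule tendsto_powr'[OF assms(2) tendsto_const]) (use assms(3) lp_le_nonneg[OF assms(1)] in auto)
  then show "(\<Sum>n\<in>F. norm (v n) powr p) \<le> B powr p"
    by (rule tendsto_lowerbound) (use lp_le_sum[OF assms(1) \<open>finite F\<close>] in auto)
qed

text \<open>Of the power 2\<sigma> of |u|, the part r - 2 goes into the three-factor Hoelder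
  inequality; the rest is bounded pointwise, since the l^r norm dominates the supremum. This is why
  r - 2 <= 2\<sigma> is required.\<close>

lemma potential_pairing_bound:
  fixes y v u :: "'a \<Rightarrow> complex"
  assumes y: "lp_le r y Y" and v: "lp_le r v X" and u: "lp_le r u U" and r: "r > 2" "r - 2 \<le> 2 * \<sigma>"
    and V: "\<And>n. \<bar>V n\<bar> \<le> norm (u n) powr (2 * \<sigma>)"
  shows "norm (\<Sum>\<^sub>\<infinity>n. y n * (\<i> * (of_real (V n) * v n))) \<le> Y * X * U powr (2 * \<sigma>)"
proof (rule norm_infsum_le_of_finite)
  fix F :: "'a set" assume F: "finite F"
  have U: "U \<ge> 0" using u by (rule lp_le_nonneg)
  have "(\<Sum>n\<in>F. norm (y n * (\<i> * (of_real (V n) * v n)))) \<le> (\<Sum>n\<in>F. norm (y n) * norm (v n) * norm (u n) powr (r - 2) * U powr (2 * \<sigma> - (r - 2)))"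
  proof (rule sum_mono)
    fix n
    have "\<bar>V n\<bar> \<le> norm (u n) powr (r - 2) * norm (u n) powr (2 * \<sigma> - (r - 2))"
      using V[of n] by (simp add: powr_add[symmetric])
    also have "\<dots> \<le> norm (u n) powr (r - 2) * U powr (2 * \<sigma> - (r - 2))"
      using r lp_le_pointwise[OF u] by (intro mult_left_mono powr_mono2) auto
    finally have "norm (y n) * norm (v n) * \<bar>V n\<bar> \<le> norm (y n) * norm (v n) * (norm (u n) powr (r - 2) * U powr (2 * \<sigma> - (r - 2)))"
      by (intro mult_left_mono) auto
    then show "norm (y n * (\<i> * (of_real (V n) * v n))) \<le> norm (y n) * norm (v n) * norm (u n) powr (r - 2) * U powr (2 * \<sigma> - (r - 2))"
      by (simp add: norm_mult mult_ac)
  qed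
  also have "\<dots> \<le> (Y * X * U powr (r - 2)) * U powr (2 * \<sigma> - (r - 2))"
    unfolding sum_distrib_right[symmetric] by (intro mult_right_mono lp_le_mult3[OF y v u r(1) F]) auto
  also have "\<dots> = Y * X * U powr (2 * \<sigma>)" by (simp add: powr_add[symmetric])
  finally show "(\<Sum>n\<in>F. norm (y n * (\<i> * (of_real (V n) * v n)))) \<le> Y * X * U powr (2 * \<sigma>)" .
qed

text \<open>The Duhamel term is a contraction in the weighted norm, so its fixed-point bound follows by
  iterating from the crude bound that conservation of the \<open>l\<^sup>2\<close> norm provides.\<close>

lemma perturbed_decay:
  fixes u v :: "real \<Rightarrow> int ^ 'd::finite \<Rightarrow> complex" and r \<sigma> a :: real
  defines "\<alpha> \<equiv> real CARD('d) * (r - 2) / (3 * r)" and "C \<equiv> 8 ^ CARD('d)"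
  assumes V: "locally_bounded_potential V" and v: "schrodinger V v"
    and r: "r > 2" "r - 2 \<le> 2 * \<sigma>" "1/r + 1/q = 1" "q > 1" and \<alpha>: "\<alpha> \<le> 1" "(2 * \<sigma> + 1) * \<alpha> > 1"
    and Vu: "\<And>s n. s \<in> {0..T} \<Longrightarrow> \<bar>V s n\<bar> \<le> norm (u s n) powr (2 * \<sigma>)"
    and u: "\<And>s. s \<in> {0..T} \<Longrightarrow> lp_le r (u s) (a * (1 + s) powr (- \<alpha>))"
    and a: "0 \<le> a" "C * a powr (2 * \<sigma>) * (4 / ((2 * \<sigma> + 1) * \<alpha> - 1)) \<le> 1 / 2"
    and A: "lp_le q (v 0) A" and t: "t \<in> {0..T}"
  shows "lp_le r (v t) (2 * C * A * (1 + t) powr (- \<alpha>))"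
proof -
  \<comment> \<open>The decay rate of the source V v: 2\<sigma> factors from the potential and one
    from \<open>v\<close>.\<close>
  define \<beta> where "\<beta> = (2 * \<sigma> + 1) * \<alpha>"
  have \<alpha>0: "\<alpha> \<ge> 0" using r by (simp add: \<alpha>_def)
  have \<beta>: "\<beta> > 1" "\<alpha> \<le> \<beta>" using \<alpha> by (auto simp: \<beta>_def)
  have C: "C > 0" by (simp add: C_def)
  have A0: "A \<ge> 0" using A by (rule lp_le_nonneg)
  have T: "T \<ge> 0" using t by auto
  define P where "P X \<longleftrightarrow> (\<forall>t\<in>{0..T}. lp_le r (v t) (X * (1 + t) powr (- \<alpha>)))" for X
  \<comment> \<open>The linear part contributes C A, and smallness of \<open>a\<close> makes the
    Duhamel part at most X/2. The fixed point of X -> C A + X/2 is 2 C A.\<close>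
  have step: "P (C * A + X / 2)" if PX: "P X" for X
    unfolding P_def
  proof
    fix t assume t: "t \<in> {0..T}"
    then have t0: "t \<ge> 0" by simp
    have X: "X \<ge> 0" using PX T lp_le_nonneg[of r "v 0"] by (force simp: P_def)
    show "lp_le r (v t) ((C * A + X / 2) * (1 + t) powr (- \<alpha>))"
    proof (rule lp_le_dual[OF _ r(4,3)])
      show "r > 1" using r by simp
      show "0 \<le> (C * A + X / 2) * (1 + t) powr (- \<alpha>)" using C A0 X by simp
      fix F :: "(int ^ 'd) set" and h assume F: "finite F" and h: "\<And>n. n \<notin> F \<Longrightarrow> h n = (0::complex)"
      define H where "H = lp_fin q F h"
      have H: "H \<ge> 0" by (simp add: H_def lp_fin_nonneg)
      have "lp_le 1 h (lp_fin 1 F h)" by (rule lp_le_1_fin_support[OF F]) (rule h)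
      \<comment> \<open>The test vector is evolved freely, so that free decay acts on it inside the
        Duhamel integral.\<close>
      then obtain y where y: "schrodinger (\<lambda>_ _. 0) y" and y0: "y 0 = h"
        using schrodinger_exists[OF locally_bounded_potential_0] by blast
      have yd: "lp_le r (y \<tau>) (C * (1 + \<tau>) powr (- \<alpha>) * H)" if "\<tau> \<ge> 0" for \<tau>
        using free_evolution_decay[OF y F _ that _ r(4) r(3)] h r by (simp add: y0 C_def \<alpha>_def H_def)
      define f where "f s = (\<Sum>\<^sub>\<infinity>n. y (t - s) n * (\<i> * (of_real (V s n) * v s n)))" for s
      have f: "(f has_integral (\<Sum>\<^sub>\<infinity>n. y 0 n * v t n) - (\<Sum>\<^sub>\<infinity>n. y t n * v 0 n)) {0..t}"
        unfolding f_def by (rule schrodinger_duhamel[OF y v V t0])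
      have fin: "(\<Sum>\<^sub>\<infinity>n. y 0 n * v t n) = (\<Sum>n\<in>F. h n * v t n)"
        unfolding y0 using F h by (intro infsum_finite_support) auto
      have lin: "norm (\<Sum>\<^sub>\<infinity>n. y t n * v 0 n) \<le> C * (1 + t) powr (- \<alpha>) * H * A"
        using holder_infsum(2)[OF yd[OF t0] A _ r(4,3)] r by simp
      define D where "D = C * H * X * a powr (2 * \<sigma>)"
      have fb: "norm (f s) \<le> D * ((1 + (t - s)) powr (- \<alpha>) * (1 + s) powr (- \<beta>))" if s: "s \<in> {0..t}" for s
      proof -
        have sT: "s \<in> {0..T}" using s t by auto
        have "norm (f s) \<le> (C * (1 + (t - s)) powr (- \<alpha>) * H) * (X * (1 + s) powr (- \<alpha>)) * (a * (1 + s) powr (- \<alpha>)) powr (2 * \<sigma>)"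
          unfolding f_def
          by (rule potential_pairing_bound[OF yd _ u[OF sT] r(1,2) Vu[OF sT]]) (use s sT PX in \<open>auto simp: P_def\<close>)
        also have "(a * (1 + s) powr (- \<alpha>)) powr (2 * \<sigma>) = a powr (2 * \<sigma>) * (1 + s) powr (- (2 * \<sigma> * \<alpha>))"
          using a s by (simp add: powr_mult powr_powr mult_ac)
        also have "(C * (1 + (t - s)) powr (- \<alpha>) * H) * (X * (1 + s) powr (- \<alpha>)) * (a powr (2 * \<sigma>) * (1 + s) powr (- (2 * \<sigma> * \<alpha>)))
           = D * ((1 + (t - s)) powr (- \<alpha>) * ((1 + s) powr (- \<alpha>) * (1 + s) powr (- (2 * \<sigma> * \<alpha>))))"
          by (simp add: D_def mult_ac)
        also have "(1 + s) powr (- \<alpha>) * (1 + s) powr (- (2 * \<sigma> * \<alpha>)) = (1 + s) powr (- \<beta>)"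
          by (simp add: powr_add[symmetric] \<beta>_def algebra_simps)
        finally show ?thesis .
      qed
      have D: "D \<ge> 0" using C H X by (simp add: D_def)
      note conv = convolution_bound[OF \<alpha>0 \<alpha>(1) \<beta>(2,1) t0]
      have "norm (integral {0..t} f) \<le> integral {0..t} (\<lambda>s. D * ((1 + (t - s)) powr (- \<alpha>) * (1 + s) powr (- \<beta>)))"
        using f has_integral_mult_right[OF integrable_integral[OF conv(1)], of D]
        by (intro integral_norm_bound_integral fb) (auto simp: integrable_on_def)
      also have "\<dots> \<le> D * (4 / (\<beta> - 1) * (1 + t) powr (- \<alpha>))"
        using mult_left_mono[OF conv(2) D] by simp
      also have "\<dots> = (C * a powr (2 * \<sigma>) * (4 / (\<beta> - 1))) * (H * X * (1 + t) powr (- \<alpha>))"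
        by (simp add: D_def mult_ac)
      also have "\<dots> \<le> 1 / 2 * (H * X * (1 + t) powr (- \<alpha>))"
        using a(2) H X by (intro mult_right_mono) (auto simp: \<beta>_def)
      finally have "norm ((\<Sum>n\<in>F. h n * v t n) - (\<Sum>\<^sub>\<infinity>n. y t n * v 0 n)) \<le> 1 / 2 * (H * X * (1 + t) powr (- \<alpha>))"
        unfolding integral_unique[OF f] fin .
      then have "norm (\<Sum>n\<in>F. h n * v t n) \<le> 1 / 2 * (H * X * (1 + t) powr (- \<alpha>)) + C * (1 + t) powr (- \<alpha>) * H * A"
        using lin norm_triangle_sub[of "\<Sum>n\<in>F. h n * v t n" "\<Sum>\<^sub>\<infinity>n. y t n * v 0 n"] by linarith
      then show "norm (\<Sum>n\<in>F. h n * v t n) \<le> (C * A + X / 2) * (1 + t) powr (- \<alpha>) * lp_fin q F h"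
        by (simp add: H_def algebra_simps)
    qed
  qed
  \<comment> \<open>The starting constant may depend on T, because the iteration makes its influence
    vanish.\<close>
  obtain B where B: "\<And>s. s \<in> {0..T} \<Longrightarrow> lp_le 2 (v s) B" using schrodinger_bounded[OF v] by blast
  have "P (B * (1 + T) powr \<alpha>)"
    unfolding P_def
  proof
    fix s assume s: "s \<in> {0..T}"
    have "lp_le r (v s) B" by (rule lp_le_exponent_mono[OF B[OF s]]) (use r in auto)
    then show "lp_le r (v s) (B * (1 + T) powr \<alpha> * (1 + s) powr (- \<alpha>))"
    proof (rule lp_le_mono_right)
      have "1 \<le> (1 + T) powr \<alpha> * (1 + s) powr (- \<alpha>)"
        using s \<alpha>0 powr_mono2[of \<alpha> "1 + s" "1 + T"] by (simp add: powr_minus_divide)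
      then have "B * 1 \<le> B * ((1 + T) powr \<alpha> * (1 + s) powr (- \<alpha>))"
        using lp_le_nonneg[OF B[OF s]] by (intro mult_left_mono)
      then show "B \<le> B * (1 + T) powr \<alpha> * (1 + s) powr (- \<alpha>)" by (simp add: mult_ac)
    qed (use r in simp)
  qed
  then obtain X0 where X0: "P X0" by blast
  \<comment> \<open>Each step halves the distance to the fixed point 2 C A.\<close>
  have it: "P (2 * C * A + (X0 - 2 * C * A) * (1/2) ^ k)" for k
  proof (induction k)
    case (Suc k)
    have "C * A + (2 * C * A + (X0 - 2 * C * A) * (1/2) ^ k) / 2 = 2 * C * A + (X0 - 2 * C * A) * (1/2) ^ Suc k"
      by (simp add: add_divide_distrib)
    with step[OF Suc] show ?case by (simp only:)
  qed (use X0 in simp)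
  show ?thesis
  proof (rule lp_le_limit_bound)
    show "lp_le r (v t) ((2 * C * A + (X0 - 2 * C * A) * (1/2) ^ k) * (1 + t) powr (- \<alpha>))" for k
      using it t unfolding P_def by blast
    have "(\<lambda>k. (2 * C * A + (X0 - 2 * C * A) * (1/2) ^ k) * (1 + t) powr (- \<alpha>)) \<longlonglongrightarrow> (2 * C * A + (X0 - 2 * C * A) * 0) * (1 + t) powr (- \<alpha>)"
      by (intro tendsto_intros LIMSEQ_power_zero) simp
    then show "(\<lambda>k. (2 * C * A + (X0 - 2 * C * A) * (1/2) ^ k) * (1 + t) powr (- \<alpha>)) \<longlonglongrightarrow> 2 * C * A * (1 + t) powr (- \<alpha>)" by simp
  qed (use r in simp)
qed

text \<open>At the first time at which \<phi> takes a value c with b < c <= a, the premise of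
  \<open>step\<close> holds, and its conclusion \<phi> <= b contradicts \<phi> = c.\<close>

lemma continuity_bootstrap:
  fixes \<phi> :: "real \<Rightarrow> real"
  assumes cont: "continuous_on {0..T} \<phi>" and init: "\<phi> 0 \<le> b" and ba: "b < a"
    and step: "\<And>t. t \<in> {0..T} \<Longrightarrow> (\<And>s. s \<in> {0..t} \<Longrightarrow> \<phi> s \<le> a) \<Longrightarrow> \<phi> t \<le> b"
    and t: "t \<in> {0..T}"
  shows "\<phi> t \<le> b"
proof (rule ccontr)
  assume "\<not> \<phi> t \<le> b"
  \<comment> \<open>Not above a, so that \<phi> <= a up to the first hitting time, and not above
    \<phi> t, so that the value is attained.\<close>
  define c where "c = min (\<phi> t) a"
  have c: "b < c" "c \<le> a" "c \<le> \<phi> t" using \<open>\<not> \<phi> t \<le> b\<close> ba by (auto simp: c_def)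
  have hit: "\<exists>x\<ge>0. x \<le> s \<and> \<phi> x = c" if "s \<in> {0..t}" "c \<le> \<phi> s" for s
  proof (rule IVT')
    show "continuous_on {0..s} \<phi>" using cont by (rule continuous_on_subset) (use that t in auto)
  qed (use that init c in auto)
  define Z where "Z = {x \<in> {0..t}. \<phi> x = c}"
  have "closed Z" unfolding Z_def
    by (intro continuous_closed_preimage_constant continuous_on_subset[OF cont]) (use t in auto)
  have "Z \<noteq> {}" using hit[of t] c t by (auto simp: Z_def)
  have bdd: "bdd_below Z" by (auto simp: Z_def bdd_below_def)
  have "Inf Z \<in> Z" using closed_contains_Inf[OF \<open>Z \<noteq> {}\<close> bdd \<open>closed Z\<close>] .
  then have z: "Inf Z \<in> {0..t}" "\<phi> (Inf Z) = c" by (auto simp: Z_def)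
  have "\<phi> (Inf Z) \<le> b"
  proof (rule step)
    fix s assume s: "s \<in> {0..Inf Z}"
    show "\<phi> s \<le> a"
    proof (rule ccontr)
      assume "\<not> \<phi> s \<le> a"
      then obtain x where x: "0 \<le> x" "x \<le> s" "\<phi> x = c" using hit[of s] s z c by auto
      then have "x \<in> Z" using s z by (auto simp: Z_def)
      then have "Inf Z \<le> x" using bdd by (rule cInf_lower)
      then have "s = Inf Z" using x s by auto
      then show False using \<open>\<not> \<phi> s \<le> a\<close> z c by simp
    qed
  qed (use z t in auto)
  then show False using z c by simp
qed

section \<open>The nonlinear equation\<close>

lemma lp_norm_diff_le:
  assumes v: "v \<in> lp_space p" and w: "w \<in> lp_space p" and d: "lp_le p (\<lambda>n. v n - w n) D" and p: "p > 1"
  shows "\<bar>lp_norm p v - lp_norm p w\<bar> \<le> D"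
proof -
  have p0: "p > 0" using p by simp
  have "lp_le p (\<lambda>n. w n + (v n - w n)) (lp_norm p w + D)"
    by (rule lp_le_add[OF lp_le_norm[OF w p0] d p])
  then have 1: "lp_norm p v \<le> lp_norm p w + D" using lp_le_imp(2)[of p v] p0 by simp
  have "lp_le p (\<lambda>n. v n + (-1) * (v n - w n)) (lp_norm p v + norm (-1::complex) * D)"
    by (rule lp_le_add[OF lp_le_norm[OF v p0] lp_le_cmult[OF d] p])
  then have 2: "lp_norm p w \<le> lp_norm p v + D" using lp_le_imp(2)[of p w] p0 by simp
  from 1 2 show ?thesis by linarith
qed

lemma lp_space_mono:
  assumes "v \<in> lp_space p" "0 < p" "p \<le> q"
  shows "v \<in> lp_space q" "lp_norm q v \<le> lp_norm p v"
  using lp_le_imp[OF lp_le_exponent_mono[OF lp_le_norm[OF assms(1,2)] assms(2,3)]] assms by auto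

text \<open>Continuity in l^2 passes to p >= 2 by the embedding with constant 1; the bootstrap needs
  it at the exponent r.\<close>

lemma dnls_continuous_lp_norm:
  assumes u: "dnls_solution s \<sigma> u" and p: "p \<ge> 2"
  shows "continuous_on {0..} (\<lambda>t. lp_norm p (u t))"
  unfolding continuous_on_def
proof
  fix t :: real assume t: "t \<in> {0..}"
  have l2: "u \<tau> \<in> lp_space 2" if "\<tau> \<ge> 0" for \<tau> using u that by (simp add: dnls_solution_def)
  have lim: "((\<lambda>\<tau>. lp_norm 2 (\<lambda>n. u \<tau> n - u t n)) \<longlongrightarrow> 0) (at t within {0..})"
    using u t by (simp add: dnls_solution_def)
  have "\<bar>lp_norm p (u \<tau>) - lp_norm p (u t)\<bar> \<le> lp_norm 2 (\<lambda>n. u \<tau> n - u t n)" if \<tau>: "\<tau> \<in> {0..}" for \<tau>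
  proof (rule lp_norm_diff_le)
    show "u \<tau> \<in> lp_space p" "u t \<in> lp_space p"
      using lp_space_mono(1)[OF l2] \<tau> t p by auto
    have "lp_le 2 (\<lambda>n. u \<tau> n + (-1) * u t n) (lp_norm 2 (u \<tau>) + norm (-1::complex) * lp_norm 2 (u t))"
      by (intro lp_le_add lp_le_cmult lp_le_norm l2) (use \<tau> t in auto)
    then have "(\<lambda>n. u \<tau> n - u t n) \<in> lp_space 2" using lp_le_imp(1)[of 2] by simp
    then have "lp_le 2 (\<lambda>n. u \<tau> n - u t n) (lp_norm 2 (\<lambda>n. u \<tau> n - u t n))" by (rule lp_le_norm) simp
    then show "lp_le p (\<lambda>n. u \<tau> n - u t n) (lp_norm 2 (\<lambda>n. u \<tau> n - u t n))"
      by (rule lp_le_exponent_mono) (use p in auto)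
  qed (use p in auto)
  then have "\<forall>\<^sub>F \<tau> in at t within {0..}. norm (lp_norm p (u \<tau>) - lp_norm p (u t)) \<le> lp_norm 2 (\<lambda>n. u \<tau> n - u t n)"
    by (auto simp: eventually_at_filter)
  then have "((\<lambda>\<tau>. lp_norm p (u \<tau>) - lp_norm p (u t)) \<longlongrightarrow> 0) (at t within {0..})"
    using lim by (rule Lim_null_comparison)
  then show "((\<lambda>t. lp_norm p (u t)) \<longlongrightarrow> lp_norm p (u t)) (at t within {0..})"
    by (simp add: LIM_zero_iff)
qed

lemma dnls_linear:
  fixes u :: "real \<Rightarrow> int ^ 'd::finite \<Rightarrow> complex"
  assumes u: "dnls_solution s \<sigma> u" and \<sigma>: "\<sigma> > 0"
  defines "V \<equiv> \<lambda>t n. s * norm (u t n) powr (2 * \<sigma>)"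
  shows "schrodinger V u" "locally_bounded_potential V"
proof -
  have bdd: "\<exists>B. \<forall>t\<in>{0..T}. lp_le 2 (u t) B" for T
  proof -
    have "continuous_on {0..T} (\<lambda>t. lp_norm 2 (u t))"
      by (rule continuous_on_subset[OF dnls_continuous_lp_norm[OF u order_refl]]) auto
    then have "bounded ((\<lambda>t. lp_norm 2 (u t)) ` {0..T})"
      by (intro compact_imp_bounded compact_continuous_image) auto
    then obtain B where B: "\<forall>x\<in>(\<lambda>t. lp_norm 2 (u t)) ` {0..T}. norm x \<le> B" by (auto simp: bounded_iff)
    have "lp_le 2 (u t) B" if "t \<in> {0..T}" for t
    proof (rule lp_le_mono_right[OF lp_le_norm])
      show "u t \<in> lp_space 2" using u that by (simp add: dnls_solution_def)
      show "lp_norm 2 (u t) \<le> B" using B that by (auto simp: abs_le_iff)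
    qed auto
    then show ?thesis by blast
  qed
  have D: "((\<lambda>\<tau>. u \<tau> n) has_vector_derivative \<i> * (discrete_laplacian (u t) n + of_real (V t n) * u t n)) (at t within {0..})"
    if t: "t \<ge> 0" for t n
  proof -
    obtain D where D: "((\<lambda>\<tau>. u \<tau> n) has_vector_derivative D) (at t within {0..})"
      and eq: "\<i> * D + discrete_laplacian (u t) n + of_real s * of_real (norm (u t n) powr (2 * \<sigma>)) * u t n = 0"
      using u t unfolding dnls_solution_def by blast
    have "\<i> * D + (discrete_laplacian (u t) n + of_real (V t n) * u t n) = 0"
      using eq by (simp add: V_def add.assoc)
    then have "\<i> * D = - (discrete_laplacian (u t) n + of_real (V t n) * u t n)"
      by (simp only: eq_neg_iff_add_eq_0)
    moreover have "D = - (\<i> * (\<i> * D))" by (simp add: mult.assoc[symmetric])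
    ultimately have "D = \<i> * (discrete_laplacian (u t) n + of_real (V t n) * u t n)"
      by (simp only: mult_minus_right minus_minus)
    with D show ?thesis by simp
  qed
  show "schrodinger V u" unfolding schrodinger_def using D bdd by blast
  have cont: "continuous_on {0..} (\<lambda>t. u t n)" for n
    using D by (intro continuous_on_vector_derivative) auto
  show "locally_bounded_potential V"
    unfolding locally_bounded_potential_def
  proof (intro conjI allI)
    show "continuous_on {0..} (\<lambda>t. V t n)" for n
      unfolding V_def by (intro continuous_intros continuous_on_powr' cont) (use \<sigma> in auto)
    fix T
    obtain B where B: "\<And>t. t \<in> {0..T} \<Longrightarrow> lp_le 2 (u t) B" using bdd by blast
    have "\<bar>V t n\<bar> \<le> \<bar>s\<bar> * B powr (2 * \<sigma>)" if "t \<in> {0..T}" for t n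
      unfolding V_def abs_mult using lp_le_pointwise[OF B[OF that], of n] \<sigma>
      by (intro mult_left_mono) (auto intro: powr_mono2)
    then show "\<exists>B. \<forall>t\<in>{0..T}. \<forall>n. \<bar>V t n\<bar> \<le> B" by blast
  qed
qed

lemma dnls_decay:
  fixes u :: "real \<Rightarrow> int ^ 'd::finite \<Rightarrow> complex" and r \<sigma> a :: real
  defines "\<alpha> \<equiv> real CARD('d) * (r - 2) / (3 * r)" and "C \<equiv> 8 ^ CARD('d)"
  assumes u: "dnls_solution s \<sigma> u" and s: "\<bar>s\<bar> \<le> 1"
    and r: "r > 2" "r - 2 \<le> 2 * \<sigma>" "1/r + 1/q = 1" "q > 1" and \<alpha>: "\<alpha> \<le> 1" "(2 * \<sigma> + 1) * \<alpha> > 1"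
    and a: "0 < a" "C * a powr (2 * \<sigma>) * (4 / ((2 * \<sigma> + 1) * \<alpha> - 1)) \<le> 1 / 2"
    and u0: "u 0 \<in> lp_space q" "lp_norm q (u 0) \<le> a / (4 * C)"
    and p: "2 \<le> p" "p \<le> r" "1/p + 1/p' = 1" and t: "t \<ge> 0"
  shows "lp_le p (u t) (2 * C * (1 + t) powr (- (real CARD('d) * (p - 2) / (3 * p))) * lp_norm p' (u 0))"
proof -
  define V where "V t n = s * norm (u t n) powr (2 * \<sigma>)" for t n
  have \<sigma>: "\<sigma> > 0" using r by simp
  have sol: "schrodinger V u" and V: "locally_bounded_potential V"
    using dnls_linear[OF u \<sigma>] by (simp_all add: V_def[abs_def])
  have Vu: "\<bar>V t n\<bar> \<le> norm (u t n) powr (2 * \<sigma>)" for t n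
    using mult_right_mono[OF s, of "norm (u t n) powr (2 * \<sigma>)"] by (simp add: V_def abs_mult)
  have C: "C \<ge> 1" by (simp add: C_def)
  have q2: "q \<le> 2"
  proof (rule ccontr)
    assume "\<not> q \<le> 2"
    then have "1/q < 1/2" by (simp add: field_simps)
    moreover have "1/r < 1/2" using r by (simp add: field_simps)
    ultimately show False using r by linarith
  qed
  have l2: "u t \<in> lp_space 2" if "t \<ge> 0" for t using u that by (simp add: dnls_solution_def)
  have lr: "u t \<in> lp_space r" if "t \<ge> 0" for t using lp_space_mono(1)[OF l2[OF that], of r] r by simp
  have u0q: "lp_le q (u 0) (a / (4 * C))"
    by (rule lp_le_mono_right[OF lp_le_norm[OF u0(1)] u0(2)]) (use r in auto)
  \<comment> \<open>The assumption of size a is returned as 2 C (a / (4 C)) = a/2; this margin fixes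
    the smallness of the datum.\<close>
  have decay: "lp_norm r (u t) * (1 + t) powr \<alpha> \<le> a / 2" if t: "t \<ge> 0" for t
  proof (rule continuity_bootstrap[where T = t and \<phi> = "\<lambda>t. lp_norm r (u t) * (1 + t) powr \<alpha>" and a = a])
    show "continuous_on {0..t} (\<lambda>t. lp_norm r (u t) * (1 + t) powr \<alpha>)"
      by (intro continuous_intros continuous_on_subset[OF dnls_continuous_lp_norm[OF u]]) (use r in auto)
    have "lp_norm r (u 0) \<le> lp_norm q (u 0)" by (rule lp_space_mono(2)[OF u0(1)]) (use r q2 in auto)
    also have "\<dots> \<le> a / (4 * C)" by fact
    also have "\<dots> \<le> a / 2" using a C by (intro divide_left_mono) auto
    finally show "lp_norm r (u 0) * (1 + 0) powr \<alpha> \<le> a / 2" by simp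
    show "a / 2 < a" using a by simp
    show "t \<in> {0..t}" using t by simp
    fix T assume T: "T \<in> {0..t}" and small: "\<And>s. s \<in> {0..T} \<Longrightarrow> lp_norm r (u s) * (1 + s) powr \<alpha> \<le> a"
    have ub: "lp_le r (u s) (a * (1 + s) powr - \<alpha>)" if "s \<in> {0..T}" for s
    proof (rule lp_le_mono_right[OF lp_le_norm[OF lr]])
      show "lp_norm r (u s) \<le> a * (1 + s) powr (- \<alpha>)"
        using small[OF that] that by (simp add: powr_minus_divide pos_le_divide_eq)
    qed (use that r in auto)
    have "lp_le r (u T) (2 * C * (a / (4 * C)) * (1 + T) powr (- \<alpha>))"
      unfolding \<alpha>_def C_def
      by (rule perturbed_decay[OF V sol r, where T = T and a = a and u = u])
         (use \<alpha> Vu ub a u0q T in \<open>auto simp: \<alpha>_def C_def\<close>)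
    then have "lp_norm r (u T) \<le> 2 * C * (a / (4 * C)) * (1 + T) powr (- \<alpha>)"
      using r by (intro lp_le_imp) auto
    then have "lp_norm r (u T) \<le> a / 2 * (1 + T) powr (- \<alpha>)" using C by simp
    then show "lp_norm r (u T) * (1 + T) powr \<alpha> \<le> a / 2"
      using T by (simp add: powr_minus_divide pos_le_divide_eq)
  qed
  have ub: "lp_le r (u s) (a * (1 + s) powr - \<alpha>)" if "s \<ge> 0" for s
  proof (rule lp_le_mono_right[OF lp_le_norm[OF lr]])
    have "lp_norm r (u s) \<le> a / 2 * (1 + s) powr (- \<alpha>)"
      using decay[OF that] that by (simp add: powr_minus_divide pos_le_divide_eq)
    also have "\<dots> \<le> a * (1 + s) powr (- \<alpha>)" using a by (intro mult_right_mono) auto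
    finally show "lp_norm r (u s) \<le> a * (1 + s) powr (- \<alpha>)" .
  qed (use that r in auto)
  define M where "M = 2 * C * (1 + t) powr (- \<alpha>)"
  have M: "M > 0" using C t by (simp add: M_def)
  \<comment> \<open>The position of p between 2 and r on the scale 1 - 2/p. The decay rate is linear
    on this scale, so \<alpha> \<kappa> is exactly d(p-2)/(3p).\<close>
  define \<kappa> where "\<kappa> = (1 - 2/p) / (1 - 2/r)"
  have r2: "1 - 2/r > 0" using r by simp
  have "1 - 2/p \<le> 1 - 2/r" using p r by (simp add: frac_le)
  then have \<kappa>: "0 \<le> \<kappa>" "\<kappa> \<le> 1" using p r2 by (auto simp: \<kappa>_def)
  have "1 - 2/r \<noteq> 0" using r2 by linarith
  then have \<kappa>r: "\<kappa> * (1 - 2/r) = 1 - 2/p"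
    by (simp only: \<kappa>_def times_divide_eq_left nonzero_mult_div_cancel_right not_False_eq_True)
  have p'1: "p' > 1"
  proof -
    have "1/p \<le> 1/2" "1/p > 0" using p by (auto simp: frac_le)
    then have "0 < 1/p'" "1/p' < 1" using p by linarith+
    then show ?thesis by (simp add: divide_less_eq)
  qed
  have p'e: "1/p' = (1 - (1 - \<kappa>))/q + (1 - \<kappa>)/2"
  proof -
    have "(1 - (1 - \<kappa>))/q = \<kappa> * (1/q)" by simp
    also have "1/q = 1 - 1/r" using r(3) by linarith
    finally have "(1 - (1 - \<kappa>))/q + (1 - \<kappa>)/2 = \<kappa> * (1 - 1/r) + (1 - \<kappa>)/2" by (simp only:)
    also have "\<dots> = 1/2 + \<kappa> * (1 - 2/r) / 2" using r(1) by (simp add: field_simps)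
    also have "\<dots> = 1 - 1/p" unfolding \<kappa>r by (simp add: diff_divide_distrib)
    finally show ?thesis using p(3) by linarith
  qed
  have fin: "lp_le p (v t) (M powr \<kappa> * lp_fin p' G (v 0))"
    if v: "schrodinger V v" and G: "finite G" "\<And>n. n \<notin> G \<Longrightarrow> v 0 n = 0" for v G
  proof (rule lp_le_dual[OF _ p'1 p(3)])
    show "p > 1" using p by simp
    show "0 \<le> M powr \<kappa> * lp_fin p' G (v 0)" by (simp add: lp_fin_nonneg)
    fix F :: "(int ^ 'd) set" and h :: "int ^ 'd \<Rightarrow> complex" assume F: "finite F"
    have "norm (\<Sum>n\<in>F. h n * v t n) \<le> M powr (1 - (1 - \<kappa>)) * lp_fin p' F h * lp_fin p' G (v 0)"
    proof (rule propagator_interpolation[OF V t _ _ p'e])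
      fix w :: "real \<Rightarrow> int ^ 'd \<Rightarrow> complex" and F G :: "(int ^ 'd) set" and h :: "int ^ 'd \<Rightarrow> complex"
      assume w: "schrodinger V w" and FG: "finite F" "finite G" and w0: "\<And>n. n \<notin> G \<Longrightarrow> w 0 n = 0"
      have lw: "lp_le q (w 0) (lp_fin q G (w 0))" using FG w0 r by (intro lp_le_fin) auto
      have "lp_le r (w t) (2 * C * lp_fin q G (w 0) * (1 + t) powr (- \<alpha>))"
        unfolding \<alpha>_def C_def
        by (rule perturbed_decay[OF V w r, where T = t and a = a and u = u])
           (use \<alpha> Vu ub a lw t in \<open>auto simp: \<alpha>_def C_def\<close>)
      from holder_fin[OF this _ r(4,3) FG(1), of h] r
      show "norm (\<Sum>n\<in>F. h n * w t n) \<le> M * lp_fin q F h * lp_fin q G (w 0)"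
        by (simp add: M_def mult_ac)
    qed (use \<kappa> M v F G r p'1 in auto)
    then show "norm (\<Sum>n\<in>F. h n * v t n) \<le> M powr \<kappa> * lp_fin p' G (v 0) * lp_fin p' F h"
      by (simp add: mult_ac)
  qed
  have M\<kappa>: "M powr \<kappa> \<le> 2 * C * (1 + t) powr (- (real CARD('d) * (p - 2) / (3 * p)))"
  proof -
    have "M powr \<kappa> = (2 * C) powr \<kappa> * (1 + t) powr (- (\<alpha> * \<kappa>))"
      using C t by (simp add: M_def powr_mult powr_powr)
    also have "\<alpha> * \<kappa> = real CARD('d) / 3 * (\<kappa> * (1 - 2/r))" using r by (simp add: \<alpha>_def field_simps)
    also have "\<dots> = real CARD('d) * (p - 2) / (3 * p)" unfolding \<kappa>r using p by (simp add: field_simps)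
    also have "(2 * C) powr \<kappa> \<le> (2 * C) powr 1" using C \<kappa> by (intro powr_mono) auto
    finally show ?thesis using C by (simp add: mult_right_mono)
  qed
  define N where "N = lp_norm p' (u 0)"
  \<comment> \<open>Passing to conjugates reverses p <= r; hence the datum, given in l^q, also lies
    in l^p'.\<close>
  have "q \<le> p'"
  proof (rule ccontr)
    assume "\<not> q \<le> p'"
    then have "1/q < 1/p'" using p'1 by (simp add: frac_less2)
    moreover have "1/r \<le> 1/p" using p r by (simp add: frac_le)
    ultimately show False using r p by linarith
  qed
  then have "u 0 \<in> lp_space p'" using lp_space_mono(1)[OF u0(1)] r(4) by simp
  then have u0p: "lp_le p' (u 0) N"
    unfolding N_def using p'1 by (intro lp_le_norm) auto
  \<comment> \<open>Interpolation covers finitely supported data only, so the datum is truncated and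
    evolved in the potential of the full solution u.\<close>
  define f where "f k n = (if n \<in> exhaust k then u 0 n else 0)" for k :: nat and n
  have "\<exists>v. schrodinger V v \<and> v 0 = f k" for k
    by (rule schrodinger_exists[OF V lp_le_1_fin_support[of "exhaust k"]]) (auto simp: finite_exhaust f_def)
  then obtain v where v: "\<And>k. schrodinger V (v k)" "\<And>k. v k 0 = f k" by metis
  have bound: "lp_le p (v k t) (2 * C * (1 + t) powr (- (real CARD('d) * (p - 2) / (3 * p))) * N)" for k
  proof (rule lp_le_mono_right[OF fin[OF v(1) finite_exhaust[of k]]])
    have "lp_fin p' (exhaust k) (v k 0) = lp_fin p' (exhaust k) (u 0)" by (simp add: v(2) lp_fin_def f_def)
    also have "\<dots> \<le> N" using lp_fin_le[OF u0p finite_exhaust] p'1 by simp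
    finally show "M powr \<kappa> * lp_fin p' (exhaust k) (v k 0) \<le> 2 * C * (1 + t) powr (- (real CARD('d) * (p - 2) / (3 * p))) * N"
      using M\<kappa> C by (intro mult_mono) (auto simp: lp_fin_nonneg)
  qed (use p in \<open>auto simp: v(2) f_def\<close>)
  define S where "S = (\<Sum>\<^sub>\<infinity>n. norm (u 0 n) powr 2)"
  \<comment> \<open>The l^2 norm of the discarded tail. Mass conservation for the difference keeps
    this error constant in time, so the truncated evolutions converge to u at every site and the
    uniform bound survives by Fatou.\<close>
  define \<eta> where "\<eta> k = sqrt (S - (\<Sum>n\<in>exhaust k. norm (u 0 n) powr 2))" for k
  have s2: "(\<lambda>n. norm (u 0 n) powr 2) summable_on UNIV" using l2[of 0] by (simp add: lp_space_def)
  have "lp_le 2 (\<lambda>n. u 0 n - v k 0 n) (\<eta> k)" for k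
    unfolding lp_le_def
  proof (intro conjI allI impI)
    have nn: "0 \<le> S - (\<Sum>n\<in>exhaust k. norm (u 0 n) powr 2)"
      using finite_sum_le_infsum[OF s2 finite_exhaust[of k]] by (simp add: S_def)
    then show "0 \<le> \<eta> k" by (simp add: \<eta>_def)
    fix F :: "(int ^ 'd) set" assume F: "finite F"
    have "(\<Sum>n\<in>F. norm (u 0 n - v k 0 n) powr 2) = (\<Sum>n\<in>F - exhaust k. norm (u 0 n) powr 2)"
      using F by (intro sum.mono_neutral_cong_right) (auto simp: v(2) f_def)
    also have "\<dots> = (\<Sum>n\<in>F \<union> exhaust k. norm (u 0 n) powr 2) - (\<Sum>n\<in>exhaust k. norm (u 0 n) powr 2)"
      using F finite_exhaust[of k] by (subst sum_diff[symmetric]) (auto simp: Un_Diff)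
    also have "\<dots> \<le> S - (\<Sum>n\<in>exhaust k. norm (u 0 n) powr 2)"
      using finite_sum_le_infsum[OF s2, of "F \<union> exhaust k"] F finite_exhaust[of k] by (simp add: S_def)
    also have "\<dots> = \<eta> k powr 2" using nn by (cases "\<eta> k = 0") (auto simp: \<eta>_def powr_numeral)
    finally show "(\<Sum>n\<in>F. norm (u 0 n - v k 0 n) powr 2) \<le> \<eta> k powr 2" .
  qed
  then have "lp_le 2 (\<lambda>n. u t n - v k t n) (\<eta> k)" for k
    by (rule schrodinger_conservation[OF schrodinger_diff[OF sol v(1)] V _ t])
  then have near: "norm (v k t n - u t n) \<le> \<eta> k" for k n
    using lp_le_pointwise[of 2 "\<lambda>n. u t n - v k t n" "\<eta> k" n] by (simp add: norm_minus_commute)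
  have "\<eta> \<longlonglongrightarrow> sqrt (S - S)"
    unfolding \<eta>_def S_def by (intro tendsto_intros infsum_exhaust_limit s2)
  then have \<eta>0: "\<eta> \<longlonglongrightarrow> 0" by simp
  have "lp_le p (u t) (2 * C * (1 + t) powr (- (real CARD('d) * (p - 2) / (3 * p))) * N)"
  proof (rule lp_le_limit)
    show "(\<lambda>k. v k t n) \<longlonglongrightarrow> u t n" for n
      by (rule LIM_zero_cancel, rule Lim_null_comparison[OF _ \<eta>0]) (simp add: near)
  qed (use bound p in auto)
  then show ?thesis by (simp add: N_def)
qed

theorem theorem4:
  fixes \<sigma> :: real and d :: nat
  assumes "d = CARD('d::finite)" and "d \<in> {1, 2}" and "\<sigma> > 2 / real d"
  shows "\<exists>\<epsilon>>0. \<exists>C::real. \<forall>s\<in>{1, -1}.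
    (\<forall>u :: real \<Rightarrow> int ^ 'd \<Rightarrow> complex.
       dnls_solution s \<sigma> u \<longrightarrow>
       u 0 \<in> lp_space ((8 + 2 * real d) / (real d + 7)) \<longrightarrow>
       lp_norm ((8 + 2 * real d) / (real d + 7)) (u 0) \<le> \<epsilon> \<longrightarrow>
       (\<forall>p p' t :: real.
          2 \<le> p \<longrightarrow> p \<le> (8 + 2 * real d) / (real d + 1) \<longrightarrow> 1 / p + 1 / p' = 1 \<longrightarrow> t > 0 \<longrightarrow>
          u t \<in> lp_space p \<and>
          lp_norm p (u t) \<le> C * t powr (- (real d * (p - 2) / (3 * p))) * lp_norm p' (u 0))) \<and>
    (\<forall>(\<Lambda>::real) (\<phi> :: int ^ 'd \<Rightarrow> complex).
       \<phi> \<in> lp_space ((8 + 2 * real d) / (real d + 7)) \<longrightarrow>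
       lp_norm ((8 + 2 * real d) / (real d + 7)) \<phi> \<le> \<epsilon> \<longrightarrow>
       dnls_solution s \<sigma> (\<lambda>t n. exp (\<i> * of_real (\<Lambda> * t)) * \<phi> n) \<longrightarrow>
       (\<forall>n. \<phi> n = 0))"
proof -
  define r where "r = (8 + 2 * real d) / (real d + 1)"
  define q where "q = (8 + 2 * real d) / (real d + 7)"
  define \<alpha> where "\<alpha> = real CARD('d) * (r - 2) / (3 * r)"
  define C :: real where "C = 8 ^ CARD('d)"
  have C: "C > 0" by (simp add: C_def)
  \<comment> \<open>In both dimensions (2\<sigma> + 1) \<alpha> > 1 is precisely the hypothesis on
    \<sigma>.\<close>
  have cases: "d = 1 \<and> r = 5 \<and> q = 5/4 \<and> \<alpha> = 1/5 \<and> \<sigma> > 2 \<or> d = 2 \<and> r = 4 \<and> q = 4/3 \<and> \<alpha> = 1/3 \<and> \<sigma> > 1"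
    using assms(2,3) by (auto simp: r_def q_def \<alpha>_def assms(1)[symmetric])
  have r: "r > 2" "r - 2 \<le> 2 * \<sigma>" "1/r + 1/q = 1" "q > 1" and \<alpha>: "\<alpha> > 0" "\<alpha> \<le> 1" "(2 * \<sigma> + 1) * \<alpha> > 1"
  proof -
    have "r > 2 \<and> r - 2 \<le> 2 * \<sigma> \<and> 1/r + 1/q = 1 \<and> q > 1 \<and> \<alpha> > 0 \<and> \<alpha> \<le> 1 \<and> (2 * \<sigma> + 1) * \<alpha> > 1"
      using cases by (elim disjE conjE) (simp_all only:, simp_all)
    then show "r > 2" "r - 2 \<le> 2 * \<sigma>" "1/r + 1/q = 1" "q > 1" "\<alpha> > 0" "\<alpha> \<le> 1" "(2 * \<sigma> + 1) * \<alpha> > 1"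
      by simp_all
  qed
  have \<sigma>: "\<sigma> > 0" using cases by auto
  define \<gamma> where "\<gamma> = (2 * \<sigma> + 1) * \<alpha> - 1"
  have \<gamma>: "\<gamma> > 0" using \<alpha> by (simp add: \<gamma>_def)
  \<comment> \<open>Solves C a^(2\<sigma>) 4 / \<gamma> = 1/2, the contraction factor demanded of
    the Duhamel term.\<close>
  define a where "a = (\<gamma> / (8 * C)) powr (1 / (2 * \<sigma>))"
  have a: "a > 0" using \<gamma> C by (simp add: a_def)
  have "a powr (2 * \<sigma>) = \<gamma> / (8 * C)" using \<sigma> \<gamma> C by (simp add: a_def powr_powr)
  then have a2: "C * a powr (2 * \<sigma>) * (4 / ((2 * \<sigma> + 1) * \<alpha> - 1)) \<le> 1 / 2"
    using C \<gamma> by (simp add: \<gamma>_def[symmetric])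
  define \<epsilon> where "\<epsilon> = a / (4 * C)"
  have main: "u t \<in> lp_space p \<and> lp_norm p (u t) \<le> 2 * C * t powr (- (real d * (p - 2) / (3 * p))) * lp_norm p' (u 0)"
    if s: "s \<in> {1, -1}" and u: "dnls_solution s \<sigma> u" and u0: "u 0 \<in> lp_space q" "lp_norm q (u 0) \<le> \<epsilon>"
      and p: "2 \<le> p" "p \<le> r" "1 / p + 1 / p' = 1" and t: "t > 0"
    for s p p' t and u :: "real \<Rightarrow> int ^ 'd \<Rightarrow> complex"
  proof -
    have le: "lp_le p (u t) (2 * C * (1 + t) powr (- (real d * (p - 2) / (3 * p))) * lp_norm p' (u 0))"
      unfolding C_def assms(1)
      by (rule dnls_decay[OF u _ r, where a = a])
         (use s \<alpha> a a2 u0 p t in \<open>auto simp: \<alpha>_def C_def \<epsilon>_def\<close>)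
    \<comment> \<open>The bound obtained is in terms of 1 + t; as the exponent is nonpositive, it
      implies the one in t.\<close>
    have "(1 + t) powr (- (real d * (p - 2) / (3 * p))) \<le> t powr (- (real d * (p - 2) / (3 * p)))"
      using p t by (intro powr_mono2') auto
    then have "2 * C * (1 + t) powr (- (real d * (p - 2) / (3 * p))) * lp_norm p' (u 0) \<le> 2 * C * t powr (- (real d * (p - 2) / (3 * p))) * lp_norm p' (u 0)"
      using C by (intro mult_right_mono mult_left_mono) (auto simp: lp_norm_nonneg)
    then show ?thesis using lp_le_imp[OF le] p by auto
  qed
  \<comment> \<open>The l^r norm of a standing wave is constant in time, whereas the decay estimate
    at p = r, where \<alpha> > 0, bounds it by a quantity tending to 0.\<close>
  have standing: "\<phi> n = 0"
    if s: "s \<in> {1, -1}" and \<phi>: "\<phi> \<in> lp_space q" "lp_norm q \<phi> \<le> \<epsilon>"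
      and u: "dnls_solution s \<sigma> (\<lambda>t n. exp (\<i> * of_real (\<Lambda> * t)) * \<phi> n)"
    for s \<Lambda> n and \<phi> :: "int ^ 'd \<Rightarrow> complex"
  proof -
    define u where "u t n = exp (\<i> * of_real (\<Lambda> * t)) * \<phi> n" for t n
    have nu: "norm (u t n) = norm (\<phi> n)" for t n
      by (simp add: u_def norm_mult)
    have u0: "u 0 = \<phi>" by (simp add: u_def fun_eq_iff)
    have nlp: "lp_norm r (u t) = lp_norm r \<phi>" "u t \<in> lp_space r \<longleftrightarrow> \<phi> \<in> lp_space r" for t
      by (simp_all add: lp_norm_def lp_space_def nu)
    have b: "\<phi> \<in> lp_space r" "lp_norm r \<phi> \<le> 2 * C * t powr (- \<alpha>) * lp_norm q \<phi>" if "t > 0" for t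
      using main[OF s u[folded u_def], of r q t] \<phi> r that
      by (auto simp: u0 nlp \<alpha>_def assms(1))
    have "((\<lambda>t. 2 * C * t powr (- \<alpha>) * lp_norm q \<phi>) \<longlongrightarrow> 2 * C * 0 * lp_norm q \<phi>) at_top"
      by (intro tendsto_intros tendsto_neg_powr filterlim_ident) (use \<alpha> in auto)
    then have "lp_norm r \<phi> \<le> 2 * C * 0 * lp_norm q \<phi>"
    proof (rule tendsto_lowerbound)
      show "\<forall>\<^sub>F t in at_top. lp_norm r \<phi> \<le> 2 * C * t powr (- \<alpha>) * lp_norm q \<phi>"
        using eventually_gt_at_top[of "0::real"] by eventually_elim (rule b(2))
    qed simp
    then have "lp_norm r \<phi> = 0" using lp_norm_nonneg[of r \<phi>] by simp
    then have "lp_le r \<phi> 0" using lp_le_norm[OF b(1)[of 1], of] r by simp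
    then show ?thesis using lp_le_zero[of r \<phi> n] r by simp
  qed
  show ?thesis
    unfolding r_def[symmetric] q_def[symmetric]
  proof (rule exI[of _ \<epsilon>], intro conjI exI[of _ "2 * C"] ballI allI impI)
    show "\<epsilon> > 0" using a C by (simp add: \<epsilon>_def)
  qed (use main standing in blast)+
qed

end
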